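(* Let $q,p\in\mathbf{Pol}$. For every $\delta>0$ there exist $s\in\mathbf{Pol}$ and a polytime probabilistic strategy $\mathsf{coll}_\delta$ on the game $!_s\big(!_q(\mathbf{Str}_\iota\multimap\mathbf{B})\multimap\mathbf{Str}_p\big)\multimap(\mathbf{Str}_\iota\multimap\mathbf{B})\otimes(\mathbf{Str}_\iota\multimap\mathbf{B})$ such that for every deterministic strategy $\mathsf{f}$ on $!_q(\mathbf{Str}_\iota\multimap\mathbf{B})\multimap\mathbf{Str}_p$ computing the family $\{F_n\}_{n\in\mathbb{N}}$, the composition $\mathsf{f};\mathsf{coll}_\delta$ computes, with probability at least $1-\delta$, two families of functions $g=\{g_n\}$, $h=\{h_n\}$ with $g_n,h_n:\{0,1\}^n\to\{0,1\}$ such that: (1) $H(g_n,h_n)\ge 0.1$; (2) $F_n(g_n)=F_n(h_n)$; (3) for every function $f:\{0,1\}^n\to\{0,1\}$ on which $\mathsf{coll}_\delta$ queries its argument (i.e. every $f$ supplied as argument to $F_n$ during the interaction), $H(f,g_n)\ge 0.1$ and $H(f,h_n)\ge 0.1$.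
   Context: $n$ is the security parameter. $\mathbf{Pol}$ is a fixed set of unary polynomially bounded total functions on $\mathbb{N}$ containing the identity $\iota$ and $\lceil\log_2\rceil$, closed under addition, multiplication and composition. Parametrized games: a game $G=(O_G,P_G,\{L_G(n)\}_n)$ has opponent moves $O_G$, player moves $P_G$, and for each $n$ a non-empty prefix-closed set $L_G(n)$ of finite alternating sequences starting with an opponent move (legal plays), of length bounded by some polynomial in $n$. A (deterministic) strategy $\mathsf{f}=\{\mathsf{f}_n\}$ on $G$ assigns (partially) to odd-length legal plays a player move keeping the play legal, in a consistent way, and is total in the sense that whenever $s$ is a play of $\mathsf{f}$ and $sx$ is legal then $\mathsf{f}_n(sx)$ is defined; it is polytime computable if $\mathsf{f}_n(s)$ is computable in time polynomial in $|(1^n,s)|$. Ground games: $\mathbf{B}$ has plays $\varepsilon,\ ?,\ ?b$ with $b\in\{0,1\}$; $\mathbf{Str}_r$ has plays $\varepsilon,\ ?,\ ?w$ with $w\in\{0,1\}^{r(n)}$. The oracle game $\mathbf{O}^p$ has plays alternating a question $?$ and a bit answer, with at most $p(n)$ questions. Bounded exponential $!_rG$: moves are pairs $(i,m)$ with $i\in\mathbb{N}$ and $m$ a move of $G$; a play is legal at $n$ if each projection onto copy $i$ is legal in $G$, a move in copy $i+1$ only occurs after some move in copy $i$, and copies used are at most $r(n)$. $G\multimap H$: opponent moves $P_G+O_H$, player moves $O_G+P_H$, legal plays are the alternating sequences whose restrictions to $G$ and to $H$ are legal. $G\otimes H$: opponent moves $O_G+O_H$, player moves $P_G+P_H$, legal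 plays are the alternating sequences whose restrictions to $G$ and to $H$ are legal (standard tensor of games). Composition $\mathsf{f};\mathsf{g}$ of strategies on $A\multimap B$ and $B\multimap C$ is obtained by letting them interact on $B$ and hiding the $B$ moves; for $\mathsf{f}$ on $X$ and a strategy on $!_sX\multimap Y$, $\mathsf{f};\mathsf{coll}$ means composing $s(n)$ copies of $\mathsf{f}$ with it. A probabilistic strategy on $G$ is a polytime computable deterministic strategy on $\mathbf{O}^r\multimap G$ for some $r\in\mathbf{Pol}$, where the oracle's answers are independent uniformly random bits; probabilities refer to these bits. A deterministic strategy on $!_q(\mathbf{Str}_\iota\multimap\mathbf{B})\multimap\mathbf{Str}_p$ computes $F_n:(\{0,1\}^n\to\{0,1\})\to\{0,1\}^{p(n)}$: $F_n(f)$ is the string it outputs when each query $w\in\{0,1\}^n$ it poses to its argument is answered by $f(w)$ (it may query at most $q(n)$ times). Normalized Hamming distance: for $f,g:\{0,1\}^n\to X$, $H(f,g)=\Pr_{i\in\{0,1\}^n}[f(i)\neq g(i)]$ with $i$ uniform.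
   Formalization: The properties are claimed for all sufficiently large n (with a threshold independent of f), not for every n: with q(n)=p(n)=2n and n=1, F_1 may query both points and output both values, so it is injective and no collision with H(g_1,h_1)≥0.1 exists. *)

theory Defs
  imports "HOL-Probability.Probability" "HOL-Library.Sublist"
begin

section \<open>Polynomially bounded functions and polynomial time\<close>

definition poly_bounded :: "(nat \<Rightarrow> nat) \<Rightarrow> bool" where
  "poly_bounded f \<longleftrightarrow> (\<exists>c d. \<forall>n. f n \<le> c * n ^ d + c)"

text \<open>The class \<open>Pol\<close> is a parameter constrained by the following closure conditions.
  The logarithm of \<open>0\<close> is \<open>0\<close>.\<close>

definition pol_class :: "(nat \<Rightarrow> nat) set \<Rightarrow> bool" where
  "pol_class Pol \<longleftrightarrow>
     (\<forall>f\<in>Pol. poly_bounded f) \<and>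
     (\<lambda>n. n) \<in> Pol \<and>
     (\<lambda>n. nat \<lceil>log 2 (real n)\<rceil>) \<in> Pol \<and>
     (\<forall>f\<in>Pol. \<forall>g\<in>Pol. (\<lambda>n. f n + g n) \<in> Pol) \<and>
     (\<forall>f\<in>Pol. \<forall>g\<in>Pol. (\<lambda>n. f n * g n) \<in> Pol) \<and>
     (\<forall>f\<in>Pol. \<forall>g\<in>Pol. (\<lambda>n. f (g n)) \<in> Pol)"

text \<open>Deterministic multi-tape Turing machines. Tapes are infinite in both directions, and
  symbol \<open>0\<close> is the blank. The states are the numbers below \<open>tm_states M\<close>, of which \<open>0\<close> is the
  initial one; the number \<open>tm_states M\<close> itself stands for the halting state. The transition
  function reads one symbol per tape, and returns the new state together with, for each tape,
  the symbol to write and the head movement.\<close>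

record tm =
  tm_tapes :: nat
  tm_symbols :: nat
  tm_states :: nat
  tm_delta :: "nat \<Rightarrow> nat list \<Rightarrow> nat \<times> (nat \<times> int) list"

definition valid_tm :: "tm \<Rightarrow> bool" where
  "valid_tm M \<longleftrightarrow> tm_tapes M \<ge> 1 \<and> tm_symbols M \<ge> 3 \<and>
     (\<forall>q<tm_states M. \<forall>xs. length xs = tm_tapes M \<longrightarrow> set xs \<subseteq> {..<tm_symbols M} \<longrightarrow>
        fst (tm_delta M q xs) \<le> tm_states M \<and>
        length (snd (tm_delta M q xs)) = tm_tapes M \<and>
        set (snd (tm_delta M q xs)) \<subseteq> {..<tm_symbols M} \<times> {-1, 0, 1})"

type_synonym tape = "(int \<Rightarrow> nat) \<times> int"

fun tape_act :: "nat \<times> int \<Rightarrow> tape \<Rightarrow> tape" where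
  "tape_act (a, d) (t, h) = (t(h := a), h + d)"

fun tm_step :: "tm \<Rightarrow> nat \<times> tape list \<Rightarrow> nat \<times> tape list" where
  "tm_step M (q, ts) =
     (if q < tm_states M
      then let (q', acts) = tm_delta M q (map (\<lambda>(t, h). t h) ts)
           in (q', map2 tape_act acts ts)
      else (q, ts))"

definition bit_symbol :: "bool \<Rightarrow> nat" where
  "bit_symbol b = (if b then 2 else 1)"

definition input_tape :: "bool list \<Rightarrow> tape" where
  "input_tape x =
     ((\<lambda>i. if 0 \<le> i \<and> i < int (length x) then bit_symbol (x ! nat i) else 0), 0)"

definition tm_init :: "tm \<Rightarrow> bool list \<Rightarrow> nat \<times> tape list" where
  "tm_init M x = (0, input_tape x # replicate (tm_tapes M - 1) ((\<lambda>_. 0), 0))"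

text \<open>The output is found on the last tape, between cell \<open>0\<close> and the first blank after it.\<close>

definition has_output :: "tape \<Rightarrow> bool list \<Rightarrow> bool" where
  "has_output t y \<longleftrightarrow>
     (\<forall>i<length y. fst t (int i) = bit_symbol (y ! i)) \<and> fst t (int (length y)) = 0"

definition tm_computes_within :: "tm \<Rightarrow> bool list \<Rightarrow> bool list \<Rightarrow> nat \<Rightarrow> bool" where
  "tm_computes_within M x y T \<longleftrightarrow>
     (\<exists>k\<le>T. \<exists>ts. (tm_step M ^^ k) (tm_init M x) = (tm_states M, ts) \<and> has_output (last ts) y)"

text \<open>Binary prefix codes for the moves and plays of games. Natural numbers only occur as indices
  of copies of a game and are written in unary: since copy \<open>i + 1\<close> can only be opened after copy
  \<open>i\<close>, an index never exceeds the length of the play it occurs in.\<close>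

class prefix_code =
  fixes enc :: "'a \<Rightarrow> bool list"
  assumes enc_prefix_free: "enc x @ xs = enc y @ ys \<Longrightarrow> x = y"

instantiation bool :: prefix_code
begin
definition enc_bool :: "bool \<Rightarrow> bool list" where "enc_bool b = [b]"
instance by standard (simp add: enc_bool_def)
end

instantiation nat :: prefix_code
begin
definition enc_nat :: "nat \<Rightarrow> bool list" where "enc_nat k = replicate k True @ [False]"
instance
proof
  fix x y :: nat and xs ys
  show "enc x @ xs = enc y @ ys \<Longrightarrow> x = y"
    unfolding enc_nat_def
  proof (induction x arbitrary: y)
    case 0
    then show ?case by (cases y) auto
  next
    case (Suc x)
    then show ?case by (cases y) auto
  qed
qed
end

instantiation sum :: (prefix_code, prefix_code) prefix_code
begin
fun enc_sum :: "'a + 'b \<Rightarrow> bool list" where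
  "enc_sum (Inl x) = False # enc x"
| "enc_sum (Inr y) = True # enc y"
instance
proof
  fix x y :: "'a + 'b" and xs ys
  show "enc x @ xs = enc y @ ys \<Longrightarrow> x = y"
    by (cases x; cases y) (auto dest: enc_prefix_free)
qed
end

instantiation prod :: (prefix_code, prefix_code) prefix_code
begin
fun enc_prod :: "'a \<times> 'b \<Rightarrow> bool list" where
  "enc_prod (x, y) = enc x @ enc y"
instance
proof
  fix x y :: "'a \<times> 'b" and xs ys
  assume *: "enc x @ xs = enc y @ ys"
  obtain a b c d where xy: "x = (a, b)" "y = (c, d)" by (cases x, cases y) auto
  with * have "enc a @ enc b @ xs = enc c @ enc d @ ys" by simp
  moreover from this have "a = c" by (rule enc_prefix_free)
  ultimately show "x = y" using xy by (auto dest: enc_prefix_free)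
qed
end

instantiation list :: (prefix_code) prefix_code
begin
fun enc_list :: "'a list \<Rightarrow> bool list" where
  "enc_list [] = [False]"
| "enc_list (x # xs) = True # enc x @ enc_list xs"
instance
proof
  fix x y :: "'a list" and xs ys
  show "enc x @ xs = enc y @ ys \<Longrightarrow> x = y"
  proof (induction x arbitrary: y)
    case Nil
    then show ?case by (cases y) auto
  next
    case (Cons a x)
    then obtain b y' where y: "y = b # y'" by (cases y) auto
    with Cons.prems have *: "enc a @ enc x @ xs = enc b @ enc y' @ ys" by simp
    then have "a = b" by (rule enc_prefix_free)
    with * y Cons.IH show ?case by auto
  qed
qed
end

section \<open>Games\<close>

text \<open>The moves of the ground games and of the oracle game.\<close>

datatype 'a ground = Ask | Ans 'a

instantiation ground :: (prefix_code) prefix_code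
begin
fun enc_ground :: "'a ground \<Rightarrow> bool list" where
  "enc_ground Ask = [False]"
| "enc_ground (Ans x) = True # enc x"
instance
proof
  fix x y :: "'a ground" and xs ys
  show "enc x @ xs = enc y @ ys \<Longrightarrow> x = y"
    by (cases x; cases y) (auto dest: enc_prefix_free)
qed
end

record 'm game =
  omoves :: "'m set"
  pmoves :: "'m set"
  plays :: "nat \<Rightarrow> 'm list set"

definition alternating :: "'m set \<Rightarrow> 'm set \<Rightarrow> 'm list \<Rightarrow> bool" where
  "alternating Om Pm t \<longleftrightarrow> (\<forall>i<length t. t ! i \<in> (if even i then Om else Pm))"

definition is_game :: "'m game \<Rightarrow> bool" where
  "is_game G \<longleftrightarrow> omoves G \<inter> pmoves G = {} \<and>
     (\<forall>n. plays G n \<noteq> {}) \<and>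
     (\<forall>n. \<forall>t\<in>plays G n. alternating (omoves G) (pmoves G) t) \<and>
     (\<forall>n. \<forall>t\<in>plays G n. \<forall>t'. prefix t' t \<longrightarrow> t' \<in> plays G n) \<and>
     (\<exists>b. poly_bounded b \<and> (\<forall>n. \<forall>t\<in>plays G n. length t \<le> b n))"

definition bits :: "nat \<Rightarrow> bool list set" where
  "bits k = {w. length w = k}"

definition B_game :: "bool ground game" where
  "B_game = \<lparr>omoves = {Ask}, pmoves = range Ans,
     plays = (\<lambda>n. {[], [Ask]} \<union> {[Ask, Ans b] | b. True})\<rparr>"

definition Str_game :: "(nat \<Rightarrow> nat) \<Rightarrow> bool list ground game" where
  "Str_game r = \<lparr>omoves = {Ask}, pmoves = range Ans,
     plays = (\<lambda>n. {[], [Ask]} \<union> {[Ask, Ans w] | w. w \<in> bits (r n)})\<rparr>"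

definition oracle_game :: "(nat \<Rightarrow> nat) \<Rightarrow> bool ground game" where
  "oracle_game p = \<lparr>omoves = {Ask}, pmoves = range Ans,
     plays = (\<lambda>n. {t. alternating {Ask} (range Ans) t \<and> count_list t Ask \<le> p n})\<rparr>"

definition lefts :: "('a + 'b) list \<Rightarrow> 'a list" where
  "lefts t = [x. Inl x \<leftarrow> t]"

definition rights :: "('a + 'b) list \<Rightarrow> 'b list" where
  "rights t = [y. Inr y \<leftarrow> t]"

definition copy :: "nat \<Rightarrow> (nat \<times> 'm) list \<Rightarrow> 'm list" where
  "copy i t = [m. (j, m) \<leftarrow> t, j = i]"

text \<open>The bounded exponential; the copies are numbered from \<open>0\<close>, so at most \<open>r n\<close> of them are used
  if and only if all the indices are below \<open>r n\<close>.\<close>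

definition bang :: "(nat \<Rightarrow> nat) \<Rightarrow> 'm game \<Rightarrow> (nat \<times> 'm) game" where
  "bang r G = \<lparr>omoves = UNIV \<times> omoves G, pmoves = UNIV \<times> pmoves G,
     plays = (\<lambda>n. {t. alternating (UNIV \<times> omoves G) (UNIV \<times> pmoves G) t \<and>
       (\<forall>i. copy i t \<in> plays G n) \<and>
       (\<forall>k<length t. \<forall>i. fst (t ! k) = Suc i \<longrightarrow> (\<exists>l<k. fst (t ! l) = i)) \<and>
       (\<forall>m\<in>set t. fst m < r n)})\<rparr>"

definition lolli :: "'a game \<Rightarrow> 'b game \<Rightarrow> ('a + 'b) game"  (infixr "\<multimap>" 60) where
  "G \<multimap> H = \<lparr>omoves = pmoves G <+> omoves H, pmoves = omoves G <+> pmoves H,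
     plays = (\<lambda>n. {t. alternating (pmoves G <+> omoves H) (omoves G <+> pmoves H) t \<and>
       lefts t \<in> plays G n \<and> rights t \<in> plays H n})\<rparr>"

definition tensor :: "'a game \<Rightarrow> 'b game \<Rightarrow> ('a + 'b) game"  (infixr "\<otimes>" 65) where
  "G \<otimes> H = \<lparr>omoves = omoves G <+> omoves H, pmoves = pmoves G <+> pmoves H,
     plays = (\<lambda>n. {t. alternating (omoves G <+> omoves H) (pmoves G <+> pmoves H) t \<and>
       lefts t \<in> plays G n \<and> rights t \<in> plays H n})\<rparr>"

section \<open>Strategies\<close>

type_synonym 'm strategy = "nat \<Rightarrow> 'm list \<Rightarrow> 'm option"

text \<open>The even-length plays in which the player follows a given partial function.\<close>

inductive_set plays_of :: "('m list \<Rightarrow> 'm option) \<Rightarrow> 'm list set" for f where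
  plays_of_Nil: "[] \<in> plays_of f"
| plays_of_step: "t \<in> plays_of f \<Longrightarrow> f (t @ [x]) = Some y \<Longrightarrow> t @ [x, y] \<in> plays_of f"

definition is_strategy :: "'m game \<Rightarrow> 'm strategy \<Rightarrow> bool" where
  "is_strategy G f \<longleftrightarrow> (\<forall>n.
     (\<forall>t y. f n t = Some y \<longrightarrow>
        odd (length t) \<and> t \<in> plays G n \<and> t @ [y] \<in> plays G n \<and> butlast t \<in> plays_of (f n)) \<and>
     (\<forall>t x. t \<in> plays_of (f n) \<longrightarrow> t @ [x] \<in> plays G n \<longrightarrow> f n (t @ [x]) \<noteq> None))"

text \<open>The machine only has to be correct, and to respect the time bound, on positions where the
  strategy is defined: legality of a position may depend on arbitrary functions in \<open>Pol\<close>.\<close>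

definition polytime :: "('m::prefix_code) strategy \<Rightarrow> bool" where
  "polytime f \<longleftrightarrow> (\<exists>M T. valid_tm M \<and> poly_bounded T \<and>
     (\<forall>n t y. f n t = Some y \<longrightarrow>
        (let x = replicate n True @ [False] @ enc t
         in tm_computes_within M x (enc y) (T (length x)))))"

text \<open>A strategy at a fixed value of the security parameter is determined by its set of even-length
  plays. If \<open>S\<close> are the plays of a strategy on \<open>A\<close> and \<open>T\<close> those of a strategy on \<open>A \<multimap> C\<close>,
  then \<open>compose S T\<close> are the plays of their composition on \<open>C\<close>.\<close>

definition compose :: "'a list set \<Rightarrow> ('a + 'c) list set \<Rightarrow> 'c list set" where
  "compose S T = {rights u | u. u \<in> T \<and> lefts u \<in> S}"

text \<open>The plays on \<open>bang r G\<close> of \<open>r n\<close> copies of the strategy on \<open>G\<close> with plays \<open>S\<close>.\<close>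

definition copies :: "(nat \<Rightarrow> nat) \<Rightarrow> 'm game \<Rightarrow> nat \<Rightarrow> 'm list set \<Rightarrow> (nat \<times> 'm) list set" where
  "copies r G n S = {t \<in> plays (bang r G) n. \<forall>i. copy i t \<in> S}"

text \<open>A probabilistic strategy on \<open>G\<close> with at most \<open>r n\<close> coin tosses, and the plays of the oracle
  whose successive answers are \<open>\<omega>\<close>.\<close>

definition prob_strategy ::
  "(nat \<Rightarrow> nat) \<Rightarrow> ('m::prefix_code) game \<Rightarrow> (bool ground + 'm) strategy \<Rightarrow> bool" where
  "prob_strategy r G f \<longleftrightarrow> is_strategy (oracle_game r \<multimap> G) f \<and> polytime f"

definition oracle_plays :: "(nat \<Rightarrow> nat) \<Rightarrow> nat \<Rightarrow> bool list \<Rightarrow> bool ground list set" where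
  "oracle_plays r n \<omega> = {t \<in> plays (oracle_game r) n. even (length t) \<and>
     (\<forall>j. 2 * j + 1 < length t \<longrightarrow> t ! (2 * j + 1) = Ans (\<omega> ! j))}"

section \<open>Functions computed by strategies\<close>

abbreviation fun_game :: "(bool list ground + bool ground) game" where
  "fun_game \<equiv> Str_game (\<lambda>n. n) \<multimap> B_game"

abbreviation hash_game :: "(nat \<Rightarrow> nat) \<Rightarrow> (nat \<Rightarrow> nat) \<Rightarrow>
    (nat \<times> (bool list ground + bool ground) + bool list ground) game" where
  "hash_game q p \<equiv> bang q fun_game \<multimap> Str_game p"

text \<open>A function \<open>\<phi>\<close> on strings of length \<open>n\<close> is an argument of type \<open>bool list \<Rightarrow> bool\<close>, of which
  only the values on \<open>bits n\<close> matter. As a strategy on \<open>fun_game\<close> it asks for its argument \<open>w\<close> and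
  answers \<open>\<phi> w\<close>.\<close>

definition fun_plays :: "nat \<Rightarrow> (bool list \<Rightarrow> bool) \<Rightarrow> (bool list ground + bool ground) list set" where
  "fun_plays n \<phi> = {[], [Inr Ask, Inl Ask]} \<union>
     {[Inr Ask, Inl Ask, Inl (Ans w), Inr (Ans (\<phi> w))] | w. w \<in> bits n}"

definition computes ::
  "(nat \<Rightarrow> nat) \<Rightarrow> (nat \<times> (bool list ground + bool ground) + bool list ground) strategy \<Rightarrow>
   (nat \<Rightarrow> (bool list \<Rightarrow> bool) \<Rightarrow> bool list) \<Rightarrow> bool" where
  "computes q f F \<longleftrightarrow> (\<forall>n \<phi>.
     [Ask, Ans (F n \<phi>)] \<in> compose (copies q fun_game n (fun_plays n \<phi>)) (plays_of (f n)))"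

text \<open>In the play \<open>t\<close> of \<open>fun_game\<close> the player has answered \<open>b\<close>, and \<open>t\<close> can occur when the argument
  is \<open>w\<close>. The player is free to answer without having asked for the argument; such a \<open>t\<close> can occur
  for every \<open>w\<close>.\<close>

definition answers :: "bool list \<Rightarrow> (bool list ground + bool ground) list \<Rightarrow> bool \<Rightarrow> bool" where
  "answers w t b \<longleftrightarrow> rights t = [Ask, Ans b] \<and> (lefts t = [] \<or> lefts t = [Ask, Ans w])"

text \<open>The strategy on \<open>fun_game \<otimes> fun_game\<close> with plays \<open>T\<close> computes the functions \<open>g\<close> and \<open>h\<close>: each
  component answers, and its answer does not depend on what happens in the other one.\<close>

definition computes_pair ::
  "nat \<Rightarrow> ((bool list ground + bool ground) + (bool list ground + bool ground)) list set \<Rightarrow>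
   (bool list \<Rightarrow> bool) \<Rightarrow> (bool list \<Rightarrow> bool) \<Rightarrow> bool" where
  "computes_pair n T g h \<longleftrightarrow> (\<forall>w\<in>bits n.
     (\<exists>t\<in>T. answers w (lefts t) (g w)) \<and> (\<forall>t\<in>T. \<forall>b. answers w (lefts t) b \<longrightarrow> b = g w) \<and>
     (\<exists>t\<in>T. answers w (rights t) (h w)) \<and> (\<forall>t\<in>T. \<forall>b. answers w (rights t) b \<longrightarrow> b = h w))"

definition hamming :: "nat \<Rightarrow> (bool list \<Rightarrow> 'x) \<Rightarrow> (bool list \<Rightarrow> 'x) \<Rightarrow> real" where
  "hamming n f g = measure_pmf.prob (pmf_of_set (bits n)) {w. f w \<noteq> g w}"

text \<open>Let \<open>S\<close> be the plays of a strategy on \<open>hash_game q p\<close> and \<open>T\<close> those of a strategy on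
  \<open>bang s (hash_game q p) \<multimap> Y\<close>. The first predicate says that \<open>v\<close> is an initial segment of the
  interaction of the two that ends with the opening of copy \<open>i\<close> of the argument.

  A finite interaction reveals only some values of the function \<open>\<phi>\<close> which \<open>T\<close> supplies as argument to
  copy \<open>i\<close>, so the second predicate also considers how the interaction could go on if the player of
  copy \<open>i\<close> posed other queries (all other copies follow \<open>S\<close>): any query \<open>w\<close> posed in copy \<open>i\<close> is
  answered by \<open>\<phi> w\<close>, if at all, and every \<open>w\<close> is answered in some continuation. The proviso
  \<open>0 < q n\<close> is needed because no query can be posed if \<open>q n = 0\<close>.\<close>

definition opens_copy ::
  "(nat \<times> (bool list ground + bool ground) + bool list ground) list set \<Rightarrow>
   (nat \<times> (nat \<times> (bool list ground + bool ground) + bool list ground) + 'y) list set \<Rightarrow>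
   (nat \<times> (nat \<times> (bool list ground + bool ground) + bool list ground) + 'y) list \<Rightarrow> nat \<Rightarrow> bool" where
  "opens_copy S T v i \<longleftrightarrow> v \<in> T \<and> copy i (lefts v) = [Inr Ask] \<and>
     (\<forall>j. j \<noteq> i \<longrightarrow> copy j (lefts v) \<in> S)"

definition supplies ::
  "(nat \<Rightarrow> nat) \<Rightarrow> nat \<Rightarrow>
   (nat \<times> (bool list ground + bool ground) + bool list ground) list set \<Rightarrow>
   (nat \<times> (nat \<times> (bool list ground + bool ground) + bool list ground) + 'y) list set \<Rightarrow>
   (nat \<times> (nat \<times> (bool list ground + bool ground) + bool list ground) + 'y) list \<Rightarrow> nat \<Rightarrow>
   (bool list \<Rightarrow> bool) \<Rightarrow> bool" where
  "supplies q n S T v i \<phi> \<longleftrightarrow>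
     (let U = {u \<in> T. prefix v u \<and> (\<forall>j. j \<noteq> i \<longrightarrow> copy j (lefts u) \<in> S)};
          answered = (\<lambda>u w b. \<exists>k. answers w (copy k (lefts (copy i (lefts u)))) b)
      in (\<forall>u\<in>U. \<forall>w\<in>bits n. \<forall>b. answered u w b \<longrightarrow> b = \<phi> w) \<and>
         (0 < q n \<longrightarrow> (\<forall>w\<in>bits n. \<exists>u\<in>U. answered u w (\<phi> w))))"

section \<open>The constructions yield games\<close>

lemma poly_bounded_iff:
  "poly_bounded f \<longleftrightarrow> (\<exists>c d. \<forall>n. f n \<le> c * (n + 1) ^ d)"
proof
  assume "poly_bounded f"
  then obtain c d where cd: "\<And>n. f n \<le> c * n ^ d + c" unfolding poly_bounded_def by blast
  have "f n \<le> (2 * c) * (n + 1) ^ d" for n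
  proof -
    have "n ^ d \<le> (n + 1) ^ d" "1 \<le> (n + 1) ^ d" by (auto intro: power_mono)
    then have "c * n ^ d + c * 1 \<le> c * (n + 1) ^ d + c * (n + 1) ^ d"
      by (intro add_mono mult_le_mono2) auto
    with cd[of n] show ?thesis by simp
  qed
  then show "\<exists>c d. \<forall>n. f n \<le> c * (n + 1) ^ d" by blast
next
  assume "\<exists>c d. \<forall>n. f n \<le> c * (n + 1) ^ d"
  then obtain c d where cd: "\<And>n. f n \<le> c * (n + 1) ^ d" by blast
  have "f n \<le> (c * 2 ^ d) * n ^ d + c * 2 ^ d" for n
  proof (cases "n = 0")
    case True
    then have "f n \<le> c" using cd[of n] by simp
    also have "c \<le> c * 2 ^ d" by simp
    finally show ?thesis by simp
  next
    case False
    then have "(n + 1) ^ d \<le> (2 * n) ^ d" by (intro power_mono) auto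
    then have "c * (n + 1) ^ d \<le> c * (2 ^ d * n ^ d)"
      by (intro mult_le_mono2) (simp add: power_mult_distrib)
    with cd[of n] have "f n \<le> c * (2 ^ d * n ^ d)" by (rule le_trans)
    then show ?thesis by (simp add: mult.assoc)
  qed
  then show "poly_bounded f" unfolding poly_bounded_def by blast
qed

lemma poly_bounded_const: "poly_bounded (\<lambda>_. k)"
  unfolding poly_bounded_def by (rule exI[of _ k]) simp

lemma poly_bounded_add:
  assumes "poly_bounded f" "poly_bounded g"
  shows "poly_bounded (\<lambda>n. f n + g n)"
proof -
  obtain c d c' d' where cd: "\<And>n. f n \<le> c * (n + 1) ^ d" "\<And>n. g n \<le> c' * (n + 1) ^ d'"
    using assms unfolding poly_bounded_iff by blast
  have "f n + g n \<le> (c + c') * (n + 1) ^ (d + d')" for n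
  proof -
    have "(n + 1) ^ d \<le> (n + 1) ^ (d + d')" "(n + 1) ^ d' \<le> (n + 1) ^ (d + d')"
      by (auto intro!: power_increasing)
    then have "c * (n + 1) ^ d + c' * (n + 1) ^ d' \<le> c * (n + 1) ^ (d + d') + c' * (n + 1) ^ (d + d')"
      by (intro add_mono mult_le_mono2) auto
    with cd[of n] show ?thesis by (simp add: distrib_right)
  qed
  then show ?thesis unfolding poly_bounded_iff by blast
qed

lemma poly_bounded_mult:
  assumes "poly_bounded f" "poly_bounded g"
  shows "poly_bounded (\<lambda>n. f n * g n)"
proof -
  obtain c d c' d' where cd: "\<And>n. f n \<le> c * (n + 1) ^ d" "\<And>n. g n \<le> c' * (n + 1) ^ d'"
    using assms unfolding poly_bounded_iff by blast
  have "f n * g n \<le> (c * c') * (n + 1) ^ (d + d')" for n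
    using mult_le_mono[OF cd(1)[of n] cd(2)[of n]] by (simp add: power_add algebra_simps)
  then show ?thesis unfolding poly_bounded_iff by blast
qed

lemma alternating_prefix: "alternating Om Pm t \<Longrightarrow> prefix t' t \<Longrightarrow> alternating Om Pm t'"
  by (auto simp: alternating_def prefix_def nth_append split: if_splits)

lemma lefts_append: "lefts (s @ t) = lefts s @ lefts t"
  by (simp add: lefts_def)

lemma rights_append: "rights (s @ t) = rights s @ rights t"
  by (simp add: rights_def)

lemma copy_append: "copy i (s @ t) = copy i s @ copy i t"
  by (simp add: copy_def)

lemma length_lefts_rights: "length t = length (lefts t) + length (rights t)"
  by (induction t) (auto simp: lefts_def rights_def split: sum.splits)

lemma length_copies:
  "\<forall>m\<in>set t. fst m < k \<Longrightarrow> length t = (\<Sum>i<k. length (copy i t))"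
proof (induction t)
  case (Cons m t)
  have "(\<Sum>i<k. length (copy i (m # t))) = (\<Sum>i<k. (if i = fst m then 1 else 0) + length (copy i t))"
    by (rule sum.cong) (auto simp: copy_def split: prod.splits)
  also have "\<dots> = 1 + (\<Sum>i<k. length (copy i t))"
    using Cons.prems by (simp add: sum.distrib)
  finally show ?case using Cons by simp
qed (simp add: copy_def)

lemma is_game_nil: "is_game G \<Longrightarrow> [] \<in> plays G n"
  unfolding is_game_def by (metis Nil_prefix all_not_in_conv)

lemma is_game_ground:
  assumes "\<And>n. plays G n = {[], [Ask]} \<union> {[Ask, Ans x] | x. x \<in> X n}"
    and "omoves G = {Ask}" and "pmoves G = range Ans"
  shows "is_game G"
proof -
  have 1: "\<exists>b. poly_bounded b \<and> (\<forall>n. \<forall>t\<in>plays G n. length t \<le> b n)"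
    by (rule exI[of _ "\<lambda>_. 2"]) (auto simp: poly_bounded_const assms)
  have 2: "alternating (omoves G) (pmoves G) t" if "t \<in> plays G n" for n t
    using that by (auto simp: assms alternating_def nth_Cons split: nat.splits)
  have 3: "t' \<in> plays G n" if "t \<in> plays G n" "prefix t' t" for n t t'
    using that by (auto simp: assms prefix_Cons)
  have 4: "[] \<in> plays G n" for n
    by (simp add: assms)
  have 5: "omoves G \<inter> pmoves G = {}"
    by (auto simp: assms)
  show ?thesis
    unfolding is_game_def using 1 2 3 4 5 by blast
qed

lemma is_game_B: "is_game B_game"
  by (rule is_game_ground[where X = "\<lambda>_. UNIV"]) (auto simp: B_game_def)

lemma is_game_Str: "is_game (Str_game r)"
  by (rule is_game_ground[where X = "\<lambda>n. bits (r n)"]) (auto simp: Str_game_def)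

lemma alternating_Cons2:
  "alternating Om Pm (x # y # t) \<longleftrightarrow> x \<in> Om \<and> y \<in> Pm \<and> alternating Om Pm t"
  unfolding alternating_def by (auto simp: less_Suc_eq_0_disj nth_Cons split: nat.splits)

lemma length_oracle_play:
  "alternating {Ask} (range Ans) t \<Longrightarrow> length t \<le> 2 * count_list t Ask"
proof (induction t rule: induct_list012)
  case (3 x y t)
  then show ?case by (auto simp: alternating_Cons2)
qed (auto simp: alternating_def)

lemma is_game_oracle:
  assumes "poly_bounded p"
  shows "is_game (oracle_game p)"
proof -
  have "poly_bounded (\<lambda>n. 2 * p n)"
    by (intro poly_bounded_mult poly_bounded_const assms)
  moreover have "length t \<le> 2 * p n" if "t \<in> plays (oracle_game p) n" for n t
    using that length_oracle_play[of t] by (auto simp: oracle_game_def)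
  ultimately have "\<exists>b. poly_bounded b \<and> (\<forall>n. \<forall>t\<in>plays (oracle_game p) n. length t \<le> b n)"
    by blast
  moreover have "[] \<in> plays (oracle_game p) n" for n
    by (simp add: oracle_game_def alternating_def)
  moreover have "t' \<in> plays (oracle_game p) n"
    if t: "t \<in> plays (oracle_game p) n" and p: "prefix t' t" for n t t'
  proof -
    obtain u where "t = t' @ u" using p by (auto simp: prefix_def)
    with t p show ?thesis by (auto simp: oracle_game_def intro: alternating_prefix)
  qed
  moreover have "alternating (omoves (oracle_game p)) (pmoves (oracle_game p)) t"
    if "t \<in> plays (oracle_game p) n" for n t
    using that by (simp add: oracle_game_def)
  moreover have "omoves (oracle_game p) \<inter> pmoves (oracle_game p) = {}"
    by (auto simp: oracle_game_def)
  ultimately show ?thesis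
    unfolding is_game_def by blast
qed

lemma is_game_bang:
  assumes G: "is_game G" and r: "poly_bounded r"
  shows "is_game (bang r G)"
proof -
  obtain b where b: "poly_bounded b" "\<And>n t. t \<in> plays G n \<Longrightarrow> length t \<le> b n"
    using G unfolding is_game_def by blast
  have "length t \<le> r n * b n" if t: "t \<in> plays (bang r G) n" for n t
  proof -
    have "length t = (\<Sum>i<r n. length (copy i t))"
      by (rule length_copies) (use t in \<open>auto simp: bang_def\<close>)
    also have "\<dots> \<le> (\<Sum>i<r n. b n)"
      by (rule sum_mono) (use t b(2) in \<open>auto simp: bang_def\<close>)
    finally show ?thesis by simp
  qed
  then have 1: "\<exists>b. poly_bounded b \<and> (\<forall>n. \<forall>t\<in>plays (bang r G) n. length t \<le> b n)"
    using poly_bounded_mult[OF r b(1)] by blast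
  have 2: "t' \<in> plays (bang r G) n" if t: "t \<in> plays (bang r G) n" and p: "prefix t' t" for n t t'
  proof -
    obtain s where s: "t = t' @ s" using p by (auto simp: prefix_def)
    have "copy i t' \<in> plays G n" for i
    proof -
      have "copy i t \<in> plays G n" "prefix (copy i t') (copy i t)"
        using t s by (auto simp: bang_def copy_append)
      then show ?thesis using G unfolding is_game_def by blast
    qed
    moreover have "\<exists>l<k. fst (t' ! l) = i" if k: "k < length t'" "fst (t' ! k) = Suc i" for k i
    proof -
      have "k < length t" "fst (t ! k) = Suc i" using k s by (auto simp: nth_append)
      moreover have "\<forall>k<length t. \<forall>i. fst (t ! k) = Suc i \<longrightarrow> (\<exists>l<k. fst (t ! l) = i)"
        using t by (simp add: bang_def)
      ultimately obtain l where "l < k" "fst (t ! l) = i" by blast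
      then show ?thesis using k s by (auto simp: nth_append)
    qed
    moreover have "alternating (UNIV \<times> omoves G) (UNIV \<times> pmoves G) t'"
      using t p by (auto simp: bang_def intro: alternating_prefix)
    moreover have "\<forall>m\<in>set t'. fst m < r n"
      using t s by (simp add: bang_def)
    ultimately show ?thesis by (simp add: bang_def)
  qed
  have 3: "[] \<in> plays (bang r G) n" for n
    using is_game_nil[OF G] by (simp add: bang_def alternating_def copy_def)
  have 4: "omoves (bang r G) \<inter> pmoves (bang r G) = {}"
    using G unfolding is_game_def bang_def by auto
  have 5: "alternating (omoves (bang r G)) (pmoves (bang r G)) t" if "t \<in> plays (bang r G) n" for n t
    using that by (simp add: bang_def)
  show ?thesis unfolding is_game_def using 1 2 3 4 5 by blast
qed

lemma is_game_sum:
  assumes G: "is_game G" and H: "is_game H"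
    and disj: "Om \<inter> Pm = {}"
    and K: "K = \<lparr>omoves = Om, pmoves = Pm,
      plays = (\<lambda>n. {t. alternating Om Pm t \<and> lefts t \<in> plays G n \<and> rights t \<in> plays H n})\<rparr>"
  shows "is_game K"
proof -
  obtain b where b: "poly_bounded b" "\<And>n t. t \<in> plays G n \<Longrightarrow> length t \<le> b n"
    using G unfolding is_game_def by blast
  obtain c where c: "poly_bounded c" "\<And>n t. t \<in> plays H n \<Longrightarrow> length t \<le> c n"
    using H unfolding is_game_def by blast
  have "length t \<le> b n + c n" if "t \<in> plays K n" for n t
    using that b(2)[of "lefts t" n] c(2)[of "rights t" n] length_lefts_rights[of t]
    by (auto simp: K)
  then have 1: "\<exists>b. poly_bounded b \<and> (\<forall>n. \<forall>t\<in>plays K n. length t \<le> b n)"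
    using poly_bounded_add[OF b(1) c(1)] by blast
  have 2: "t' \<in> plays K n" if t: "t \<in> plays K n" and p: "prefix t' t" for n t t'
  proof -
    have "prefix (lefts t') (lefts t)" "prefix (rights t') (rights t)"
      using p by (auto simp: prefix_def lefts_append rights_append)
    moreover have "lefts t \<in> plays G n" "rights t \<in> plays H n" using t by (auto simp: K)
    ultimately have "lefts t' \<in> plays G n" "rights t' \<in> plays H n"
      using G H unfolding is_game_def by blast+
    moreover have "alternating Om Pm t'"
      using t p by (auto simp: K intro: alternating_prefix)
    ultimately show ?thesis by (simp add: K)
  qed
  have 3: "[] \<in> plays K n" for n
    using is_game_nil[OF G] is_game_nil[OF H]
    by (simp add: K alternating_def lefts_def rights_def)
  have 4: "omoves K \<inter> pmoves K = {}"
    using disj by (simp add: K)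
  have 5: "alternating (omoves K) (pmoves K) t" if "t \<in> plays K n" for n t
    using that by (simp add: K)
  show ?thesis unfolding is_game_def using 1 2 3 4 5 by blast
qed

lemma is_game_lolli: "is_game G \<Longrightarrow> is_game H \<Longrightarrow> is_game (G \<multimap> H)"
  by (rule is_game_sum[where Om = "pmoves G <+> omoves H" and Pm = "omoves G <+> pmoves H"])
     (auto simp: lolli_def is_game_def)

lemma is_game_tensor: "is_game G \<Longrightarrow> is_game H \<Longrightarrow> is_game (G \<otimes> H)"
  by (rule is_game_sum[where Om = "omoves G <+> omoves H" and Pm = "pmoves G <+> pmoves H"])
     (auto simp: tensor_def is_game_def)

end

theory Submission
  imports Defs "HOL-Real_Asymp.Real_Asymp"
begin

text \<open>A deterministic strategy computing \<open>F\<close> queries its argument at most \<open>q n\<close> times. Run it on the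
  constant function \<open>0\<close> and let \<open>Q\<close> be the set of its queries. Every function vanishing on \<open>Q\<close> has
  the same image as \<open>0\<close>, in particular \<open>g w = (w \<notin> Q)\<close> and
  \<open>h w = (w \<notin> Q \<and> first bit of w)\<close>. As \<open>Q\<close> is negligible among the \<open>2^n\<close> strings, \<open>0\<close>, \<open>g\<close> and
  \<open>h\<close> are at pairwise distance about \<open>1/2\<close> or more. No coins are tossed, so the success probability is \<open>1\<close>.

  To answer for \<open>w\<close>, the collision finder reruns \<open>F\<close> on \<open>0\<close> after receiving \<open>w\<close>, using one copy
  of \<open>F\<close> for each of the two components, and compares every query with \<open>w\<close>; by determinism all runs yield
  the same \<open>Q\<close>. Since \<open>w\<close> precedes the queries, its next move can be computed by a Turing machine in a
  single pass over the position.\<close>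

text \<open>The finder has to be a legal and total strategy against every opponent, not only against
  copies of one \<open>f\<close>: the players met in its two copies may behave differently. Runs are
  therefore defined without reference to a strategy, and an invariant of all positions reachable
  against arbitrary opponents describes each opened copy as a run on the zero function. A fixed
  \<open>f\<close> enters only when it is composed with the finder.

  Parity of alternating plays keeps the invariant small. While a run is in progress the opponent can
  move only in the copy that hosts it, and otherwise only in the two components, so runs never
  interleave and one pending argument is all that must be remembered.

  Polynomial time is demanded of a Turing machine working on encoded positions. Scanners are
  compiled into such machines once and for all, with quadratic running time; what remains to be
  verified is a parser for codes of plays.\<close>

section \<open>One-pass scanners as Turing machines\<close>

datatype head_act = Keep | Adv | Put bool | Rew | Cut

text \<open>Besides its state, a scanner has a work tape with one head and an output. In reaction to an input
  bit and the symbol under the head it acts on the work tape, discards the output if the third component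
  says so, and appends some bits to it. \<open>Rew\<close> moves the head back to cell \<open>0\<close>, and \<open>Cut\<close> does so after
  writing a blank.\<close>

type_synonym 'q scanner = "'q \<Rightarrow> bool \<Rightarrow> nat \<Rightarrow> 'q \<times> head_act \<times> bool \<times> bool list"

text \<open>\<open>Adv\<close> stops at a blank so that all cells to the left of the head stay
  nonblank. A rewinding head can then recognize cell \<open>-1\<close> as the first blank it
  meets.\<close>

fun act_head :: "head_act \<Rightarrow> (int \<Rightarrow> nat) \<Rightarrow> nat \<Rightarrow> (int \<Rightarrow> nat) \<times> nat" where
  "act_head Keep t h = (t, h)"
| "act_head Adv t h = (t, if t (int h) = 0 then h else Suc h)"
| "act_head (Put b) t h = (t(int h := bit_symbol b), Suc h)"
| "act_head Rew t h = (t, 0)"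
| "act_head Cut t h = (t(int h := 0), 0)"

fun scan_step :: "'q scanner \<Rightarrow> 'q \<times> ((int \<Rightarrow> nat) \<times> nat) \<times> bool list \<Rightarrow> bool \<Rightarrow>
    'q \<times> ((int \<Rightarrow> nat) \<times> nat) \<times> bool list" where
  "scan_step \<delta> (q, (t, h), out) b =
     (let (q', a, r, ps) = \<delta> q b (t (int h)) in (q', act_head a t h, (if r then [] else out) @ ps))"

fun head_move :: "head_act \<Rightarrow> nat \<Rightarrow> nat \<times> int" where
  "head_move Keep y = (y, 0)"
| "head_move Adv y = (y, if y = 0 then 0 else 1)"
| "head_move (Put b) y = (bit_symbol b, 1)"
| "head_move Rew y = (y, -1)"
| "head_move Cut y = (0, -1)"

text \<open>The flags of a control state say that the work tape, respectively the output tape, is being rewound,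
  and the list contains the output bits still to be written. The next input bit is read when there is
  nothing left to do.\<close>

type_synonym 'q ctl = "'q \<times> bool \<times> bool \<times> bool list"

text \<open>A rewind walks left to the blank at cell \<open>-1\<close> and then takes one step
  right. Discarding the output erases nothing, so old bits may survive beyond the head; the blank
  written on halting cuts them off.\<close>

fun scan_ctl :: "'q scanner \<Rightarrow> 'q ctl \<Rightarrow> nat \<Rightarrow> nat \<Rightarrow> nat \<Rightarrow> 'q ctl option \<times> (nat \<times> int) list" where
  "scan_ctl \<delta> (q, True, l, ps) x y z =
     (if y = 0 then (Some (q, False, l, ps), [(x, 0), (y, 1), (z, 0)])
      else (Some (q, True, l, ps), [(x, 0), (y, -1), (z, 0)]))"
| "scan_ctl \<delta> (q, False, True, ps) x y z =
     (if z = 0 then (Some (q, False, False, ps), [(x, 0), (y, 0), (z, 1)])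
      else (Some (q, False, True, ps), [(x, 0), (y, 0), (z, -1)]))"
| "scan_ctl \<delta> (q, False, False, b # ps) x y z =
     (Some (q, False, False, ps), [(x, 0), (y, 0), (bit_symbol b, 1)])"
| "scan_ctl \<delta> (q, False, False, []) x y z =
     (if x = 0 then (None, [(x, 0), (y, 0), (0, 0)])
      else let (q', a, r, ps) = \<delta> q (x = 2) y
           in (Some (q', a = Rew \<or> a = Cut, r, ps), [(x, 1), head_move a y, (z, if r then -1 else 0)]))"

text \<open>Machine states are numbers with \<open>0\<close> as the initial one. Any numbering is
  corrected by a transposition.\<close>

lemma ex_bij_betw_nat_start:
  assumes "finite S" "x \<in> S"
  obtains e where "bij_betw e S {..<card S}" "e x = (0::nat)"
proof -
  obtain e where e: "bij_betw e S {0..<card S}"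
    using ex_bij_betw_finite_nat[OF assms(1)] by blast
  have "e x \<in> {..<card S}" "0 \<in> {..<card S}"
    using e assms by (auto simp: bij_betw_def card_gt_0_iff)
  then have "bij_betw (Transposition.transpose (e x) 0) {..<card S} {..<card S}"
    by (intro permutes_imp_bij permutes_swap_id)
  then have "bij_betw (Transposition.transpose (e x) 0 \<circ> e) S {..<card S}"
    using e by (auto intro: bij_betw_trans simp: atLeast0LessThan)
  then show thesis
    by (rule that) simp
qed

section \<open>Compilation of a scanner into a three-tape machine\<close>

locale scanner_tm =
  fixes \<delta> :: "('q::finite) scanner" and k :: nat and q0 :: 'q and e :: "'q ctl \<Rightarrow> nat"
  assumes pushes: "\<And>q b y q' a r ps. \<delta> q b y = (q', a, r, ps) \<Longrightarrow> length ps \<le> k"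
    and e: "bij_betw e {(q, l, l', ps). length ps \<le> k} {..<card {(q :: 'q, l :: bool, l' :: bool, ps :: bool list). length ps \<le> k}}"
    and e0: "e (q0, False, False, []) = 0"
begin

definition ctls :: "'q ctl set" where "ctls = {(q, l, l', ps). length ps \<le> k}"

definition scan_tm :: tm where
  "scan_tm = \<lparr>tm_tapes = 3, tm_symbols = 3, tm_states = card ctls,
     tm_delta = (\<lambda>q xs. map_prod (case_option (card ctls) e) id
       (scan_ctl \<delta> (inv_into ctls e q) (xs ! 0) (xs ! 1) (xs ! 2)))\<rparr>"

lemma e_ctls: "bij_betw e ctls {..<card ctls}"
  using e by (simp add: ctls_def)

lemma e_less: "c \<in> ctls \<Longrightarrow> e c < card ctls"
  using e_ctls by (auto simp: bij_betw_def)

lemma scan_ctl_ctls: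
  assumes "c \<in> ctls" "scan_ctl \<delta> c x y z = (Some c', as)"
  shows "c' \<in> ctls"
  using assms
  by (cases "(\<delta>, c, x, y, z)" rule: scan_ctl.cases)
     (auto simp: ctls_def Let_def split: if_splits prod.splits dest: pushes)

lemma bit_symbol_less: "bit_symbol b < 3"
  by (simp add: bit_symbol_def)

lemma head_move_range: "y < 3 \<Longrightarrow> fst (head_move a y) < 3 \<and> snd (head_move a y) \<in> {-1, 0, 1}"
  by (cases a) (auto simp: bit_symbol_less)

lemma scan_ctl_actions:
  assumes "scan_ctl \<delta> c x y z = (c', as)" "x < 3" "y < 3" "z < 3"
  shows "length as = 3 \<and> list_all (\<lambda>m. fst m < 3 \<and> snd m \<in> {-1, 0, 1}) as"
  using assms head_move_range[OF assms(3)]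
  by (cases "(\<delta>, c, x, y, z)" rule: scan_ctl.cases)
     (auto simp: Let_def case_prod_unfold bit_symbol_less split: if_splits)

lemma valid_scan_tm: "valid_tm scan_tm"
proof -
  have "case_option (card ctls) e (fst (scan_ctl \<delta> (inv_into ctls e q) x y z)) \<le> card ctls \<and>
      length (snd (scan_ctl \<delta> (inv_into ctls e q) x y z)) = 3 \<and>
      set (snd (scan_ctl \<delta> (inv_into ctls e q) x y z)) \<subseteq> {..<3} \<times> {-1, 0, 1}"
    if "q < card ctls" "x < 3" "y < 3" "z < 3" for q x y z
  proof -
    obtain c' as where *: "scan_ctl \<delta> (inv_into ctls e q) x y z = (c', as)" by fastforce
    have "inv_into ctls e q \<in> ctls"
      using e_ctls that(1) by (intro inv_into_into) (auto simp: bij_betw_def)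
    with * have "case_option (card ctls) e c' \<le> card ctls"
      by (auto split: option.splits intro: less_imp_le e_less scan_ctl_ctls)
    with scan_ctl_actions[OF * that(2-4)] * show ?thesis by (fastforce simp: list_all_iff)
  qed
  moreover have "xs ! i < 3" if "set xs \<subseteq> {..<3}" "length xs = 3" "i < 3" for xs :: "nat list" and i
    using that by (auto simp: subset_iff)
  ultimately show ?thesis
    unfolding valid_tm_def scan_tm_def by simp
qed

lemma tm_step_scan:
  assumes "c \<in> ctls" "scan_ctl \<delta> c (f x) (g y) (h z) = (c', [a, b, d])"
  shows "tm_step scan_tm (e c, [(f, x), (g, y), (h, z)]) =
     (case_option (card ctls) e c', [tape_act a (f, x), tape_act b (g, y), tape_act d (h, z)])"
proof -
  have "inv_into ctls e (e c) = c"
    using e_ctls assms(1) by (auto simp: bij_betw_def)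
  with assms e_less[OF assms(1)] show ?thesis
    by (simp add: scan_tm_def numeral_2_eq_2)
qed

text \<open>Here \<open>h\<close> is the head position before the step to the left that starts the
  rewind: \<open>h\<close> steps reach the blank at \<open>-1\<close>, and one more returns to
  \<open>0\<close>.\<close>

lemma rewind_work:
  assumes "t (-1) = 0" "\<forall>i<h. t (int i) \<noteq> 0" "length ps \<le> k"
  shows "(tm_step scan_tm ^^ Suc h) (e (q, True, l, ps), [T, (t, int h - 1), (u, i)]) =
     (e (q, False, l, ps), [T, (t, 0), (u, i)])"
  using assms
proof (induction h)
  case 0
  obtain f x where "T = (f, x)" by fastforce
  with 0 show ?case
    using tm_step_scan[of "(q, True, l, ps)" f x t "-1" u i] by (simp add: ctls_def fun_upd_idem del: tm_step.simps)
next
  case (Suc h)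
  obtain f x where T: "T = (f, x)" by fastforce
  have nz: "t (int h) \<noteq> 0" using Suc.prems(2) by blast
  have "tm_step scan_tm (e (q, True, l, ps), [T, (t, int (Suc h) - 1), (u, i)]) =
    (e (q, True, l, ps), [T, (t, int h - 1), (u, i)])"
    using nz Suc.prems(3) tm_step_scan[of "(q, True, l, ps)" f x t "int h" u i] by (simp add: ctls_def T del: tm_step.simps)
  then show ?case
    using Suc by (subst funpow_Suc_right) (simp del: tm_step.simps)
qed

lemma rewind_out:
  assumes "u (-1) = 0" "\<forall>i<h. u (int i) \<noteq> 0" "length ps \<le> k"
  shows "(tm_step scan_tm ^^ Suc h) (e (q, False, True, ps), [T, (t, i), (u, int h - 1)]) =
     (e (q, False, False, ps), [T, (t, i), (u, 0)])"
  using assms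
proof (induction h)
  case 0
  obtain f x where "T = (f, x)" by fastforce
  with 0 show ?case
    using tm_step_scan[of "(q, False, True, ps)" f x t i u "-1"] by (simp add: ctls_def fun_upd_idem del: tm_step.simps)
next
  case (Suc h)
  obtain f x where T: "T = (f, x)" by fastforce
  have nz: "u (int h) \<noteq> 0" using Suc.prems(2) by blast
  have "tm_step scan_tm (e (q, False, True, ps), [T, (t, i), (u, int (Suc h) - 1)]) =
    (e (q, False, True, ps), [T, (t, i), (u, int h - 1)])"
    using nz Suc.prems(3) tm_step_scan[of "(q, False, True, ps)" f x t i u "int h"] by (simp add: ctls_def T del: tm_step.simps)
  then show ?case
    using Suc by (subst funpow_Suc_right) (simp del: tm_step.simps)
qed

text \<open>Nothing is required at the head or beyond it, where remains of discarded output may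
  stand.\<close>

definition holds_out :: "bool list \<Rightarrow> tape \<Rightarrow> bool" where
  "holds_out out T \<longleftrightarrow> snd T = int (length out) \<and> fst T (-1) = 0 \<and>
     (\<forall>i<length out. fst T (int i) = bit_symbol (out ! i))"

lemma push_out:
  assumes "holds_out out (u, j)" "length ps \<le> k"
  shows "\<exists>U. holds_out (out @ ps) U \<and>
     (tm_step scan_tm ^^ length ps) (e (q, False, False, ps), [T, (t, i), (u, j)]) =
     (e (q, False, False, []), [T, (t, i), U])"
  using assms
proof (induction ps arbitrary: out u j)
  case Nil
  then show ?case by auto
next
  case (Cons b ps)
  obtain f x where T: "T = (f, x)" by fastforce
  have "holds_out (out @ [b]) (u(j := bit_symbol b), j + 1)"
    using Cons.prems(1) by (auto simp: holds_out_def nth_append less_Suc_eq)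
  moreover have "length ps \<le> k" using Cons.prems(2) by simp
  ultimately have "\<exists>U. holds_out ((out @ [b]) @ ps) U \<and>
     (tm_step scan_tm ^^ length ps) (e (q, False, False, ps), [T, (t, i), (u(j := bit_symbol b), j + 1)]) =
     (e (q, False, False, []), [T, (t, i), U])" by (rule Cons.IH)
  then obtain U where U: "holds_out (out @ b # ps) U"
    "(tm_step scan_tm ^^ length ps) (e (q, False, False, ps), [T, (t, i), (u(j := bit_symbol b), j + 1)]) =
     (e (q, False, False, []), [T, (t, i), U])" by (auto simp del: tm_step.simps funpow.simps)
  have "tm_step scan_tm (e (q, False, False, b # ps), [T, (t, i), (u, j)]) =
    (e (q, False, False, ps), [T, (t, i), (u(j := bit_symbol b), j + 1)])"
    using Cons.prems tm_step_scan[of "(q, False, False, b # ps)" f x t i u j] by (simp add: ctls_def T del: tm_step.simps)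
  with U show ?case
    by (cases U) (auto simp: funpow_Suc_right simp del: tm_step.simps funpow.simps)
qed

definition work_ok :: "(int \<Rightarrow> nat) \<times> nat \<Rightarrow> bool" where
  "work_ok w \<longleftrightarrow> fst w (-1) = 0 \<and> (\<forall>i<snd w. fst w (int i) \<noteq> 0)"

lemma work_ok_act_head: "work_ok (t, h) \<Longrightarrow> work_ok (act_head a t h)"
  by (cases a) (auto simp: work_ok_def bit_symbol_def less_Suc_eq)

text \<open>The bound adds up one step for reading, at most \<open>h + 1\<close> for rewinding the
  work tape, at most \<open>length out + 1\<close> for rewinding the output tape, and at most
  \<open>k\<close> for writing.\<close>

lemma scan_bit:
  assumes "work_ok (t, h)" and "holds_out out U"
    and "scan_step \<delta> (q, (t, h), out) b = (q', (t', h'), out')"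
    and "f x = bit_symbol b"
  shows "\<exists>m\<le>h + length out + k + 3. \<exists>U'. holds_out out' U' \<and>
    (tm_step scan_tm ^^ m) (e (q, False, False, []), [(f, x), (t, int h), U]) =
    (e (q', False, False, []), [(f, x + 1), (t', int h'), U'])"
proof -
  obtain a r ps where d: "\<delta> q b (t (int h)) = (q', a, r, ps)"
    and hd: "act_head a t h = (t', h')" and out': "out' = (if r then [] else out) @ ps"
    using assms(3) by (auto split: prod.splits)
  obtain u j where U: "U = (u, j)" by fastforce
  have ps: "length ps \<le> k" using pushes[OF d] .
  define l where "l \<longleftrightarrow> a = Rew \<or> a = Cut"
  define i where "i = (if l then int h - 1 else int h')"
  define j' where "j' = (if r then j - 1 else j)"
  have nz: "bit_symbol b \<noteq> 0" "(bit_symbol b = 2) = b" by (auto simp: bit_symbol_def)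
  have work: "tape_act (head_move a (t (int h))) (t, int h) = (t', i)"
    using hd by (cases a) (auto simp: i_def l_def)
  have 1: "(tm_step scan_tm ^^ 1) (e (q, False, False, []), [(f, x), (t, int h), U]) =
    (e (q', l, r, ps), [(f, x + 1), (t', i), (u, j')])"
    using tm_step_scan[of "(q, False, False, [])" f x t "int h" u j] assms(4) nz d work
    by (simp add: ctls_def U l_def j'_def fun_upd_idem del: tm_step.simps)
  obtain m2 where m2: "m2 \<le> Suc h" "(tm_step scan_tm ^^ m2)
      (e (q', l, r, ps), [(f, x + 1), (t', i), (u, j')]) =
      (e (q', False, r, ps), [(f, x + 1), (t', int h'), (u, j')])"
  proof (cases l)
    case True
    then have "t' (-1) = 0" "\<forall>i<h. t' (int i) \<noteq> 0" "h' = 0"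
      using hd assms(1) by (auto simp: l_def work_ok_def)
    from rewind_work[OF this(1,2) ps] this(3) True that[of "Suc h"] show thesis
      by (simp add: i_def del: tm_step.simps funpow.simps)
  next
    case False
    with that[of 0] show thesis by (simp add: i_def)
  qed
  obtain m3 j'' where m3: "m3 \<le> Suc (length out)" "(tm_step scan_tm ^^ m3)
      (e (q', False, r, ps), [(f, x + 1), (t', int h'), (u, j')]) =
      (e (q', False, False, ps), [(f, x + 1), (t', int h'), (u, j'')])"
    and j'': "holds_out (if r then [] else out) (u, j'')"
  proof (cases r)
    case True
    have "u (-1) = 0" "\<forall>i<length out. u (int i) \<noteq> 0" "j = int (length out)"
      using assms(2) by (auto simp: holds_out_def U bit_symbol_def)
    with rewind_out[OF this(1,2) ps] True that[of "Suc (length out)" 0] show thesis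
      by (simp add: j'_def holds_out_def del: tm_step.simps funpow.simps)
  next
    case False
    with that[of 0 j] assms(2) show thesis by (simp add: j'_def U)
  qed
  obtain U' where U': "holds_out out' U'"
     "(tm_step scan_tm ^^ length ps) (e (q', False, False, ps), [(f, x + 1), (t', int h'), (u, j'')]) =
     (e (q', False, False, []), [(f, x + 1), (t', int h'), U'])"
    using push_out[OF j'' ps] unfolding out' by blast
  have "(tm_step scan_tm ^^ (length ps + (m3 + (m2 + 1)))) (e (q, False, False, []), [(f, x), (t, int h), U]) =
    (e (q', False, False, []), [(f, x + 1), (t', int h'), U'])"
    unfolding funpow_add comp_apply 1 m2 m3 U' by (rule refl)
  moreover have "length ps + (m3 + (m2 + 1)) \<le> h + length out + k + 3"
    using ps m2(1) m3(1) by simp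
  ultimately show ?thesis using U'(1) by blast
qed

lemma scan_step_size:
  assumes "scan_step \<delta> (q, (t, h), out) b = (q', (t', h'), out')"
  shows "h' \<le> Suc h" "length out' \<le> length out + k"
proof -
  obtain a r ps where d: "\<delta> q b (t (int h)) = (q', a, r, ps)"
    and hd: "act_head a t h = (t', h')" and out': "out' = (if r then [] else out) @ ps"
    using assms by (auto split: prod.splits)
  show "h' \<le> Suc h" using hd by (cases a) (auto split: if_splits)
  show "length out' \<le> length out + k" using pushes[OF d] out' by auto
qed

text \<open>An input bit raises the head position by at most \<open>1\<close> and the output length
  by at most \<open>k\<close>, so the induction passes from \<open>c\<close> to
  \<open>c + 1\<close>. Each bit costs linear time, hence the quadratic total.\<close>

lemma scan_bits:
  assumes "work_ok (t, h)" and "holds_out out U"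
    and "foldl (scan_step \<delta>) (q, (t, h), out) bs = (q', (t', h'), out')"
    and "\<forall>i<length bs. f (x + int i) = bit_symbol (bs ! i)"
    and "h + length out \<le> (k + 1) * c"
  shows "\<exists>m\<le>length bs * ((k + 1) * (c + length bs) + k + 3). \<exists>U'. holds_out out' U' \<and>
    (tm_step scan_tm ^^ m) (e (q, False, False, []), [(f, x), (t, int h), U]) =
    (e (q', False, False, []), [(f, x + int (length bs)), (t', int h'), U'])"
  using assms
proof (induction bs arbitrary: q t h out U x c)
  case Nil
  then show ?case by (cases U) auto
next
  case (Cons b bs)
  obtain q1 t1 h1 out1 where s: "scan_step \<delta> (q, (t, h), out) b = (q1, (t1, h1), out1)"
    by (metis surj_pair)
  have "f x = bit_symbol b" using Cons.prems(4) by force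
  then obtain m1 U1 where
    m1: "m1 \<le> h + length out + k + 3" "holds_out out1 U1"
      "(tm_step scan_tm ^^ m1) (e (q, False, False, []), [(f, x), (t, int h), U]) =
        (e (q1, False, False, []), [(f, x + 1), (t1, int h1), U1])"
    using scan_bit[OF Cons.prems(1,2) s, of f x] by blast
  have ok: "work_ok (t1, h1)"
    using s work_ok_act_head[OF Cons.prems(1)] by (auto split: prod.splits) metis
  have "\<forall>i<length bs. f (x + 1 + int i) = bit_symbol (bs ! i)"
  proof (intro allI impI)
    fix i assume "i < length bs"
    with Cons.prems(4)[rule_format, of "Suc i"] show "f (x + 1 + int i) = bit_symbol (bs ! i)"
      by (simp add: add_ac)
  qed
  moreover have "h1 + length out1 \<le> (k + 1) * (c + 1)"
    using scan_step_size[OF s] Cons.prems(5) by simp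
  moreover have "foldl (scan_step \<delta>) (q1, (t1, h1), out1) bs = (q', (t', h'), out')"
    using Cons.prems(3) s by simp
  ultimately obtain m2 U' where
    m2: "m2 \<le> length bs * ((k + 1) * (c + 1 + length bs) + k + 3)" "holds_out out' U'"
      "(tm_step scan_tm ^^ m2) (e (q1, False, False, []), [(f, x + 1), (t1, int h1), U1]) =
        (e (q', False, False, []), [(f, x + 1 + int (length bs)), (t', int h'), U'])"
    using Cons.IH[OF ok m1(2)] by blast
  have "m2 + m1 \<le> length (b # bs) * ((k + 1) * (c + length (b # bs)) + k + 3)"
  proof -
    have "m1 \<le> (k + 1) * (c + 1 + length bs) + k + 3"
      using m1(1) Cons.prems(5) by (simp add: algebra_simps)
    with m2(1) show ?thesis by simp
  qed
  moreover have "(tm_step scan_tm ^^ (m2 + m1)) (e (q, False, False, []), [(f, x), (t, int h), U]) =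
    (e (q', False, False, []), [(f, x + int (length (b # bs))), (t', int h'), U'])"
    unfolding funpow_add comp_apply m1 m2 by (simp add: add_ac)
  ultimately show ?case using m2(2) by blast
qed

lemma scan_tm_computes:
  assumes "foldl (scan_step \<delta>) (q0, (\<lambda>_. 0, 0), []) x = (q, w, out)"
  shows "tm_computes_within scan_tm x out (length x * ((k + 1) * length x + k + 3) + 1)"
proof -
  obtain t h where w: "w = (t, h)" by fastforce
  define f :: "int \<Rightarrow> nat" where
    "f = (\<lambda>i. if 0 \<le> i \<and> i < int (length x) then bit_symbol (x ! nat i) else 0)"
  have "\<exists>m\<le>length x * ((k + 1) * (0 + length x) + k + 3). \<exists>U. holds_out out U \<and>
    (tm_step scan_tm ^^ m) (e (q0, False, False, []), [(f, 0), (\<lambda>_. 0, int 0), (\<lambda>_. 0, 0)]) =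
    (e (q, False, False, []), [(f, 0 + int (length x)), (t, int h), U])"
    by (rule scan_bits[OF _ _ assms[unfolded w]]) (auto simp: work_ok_def holds_out_def f_def)
  then obtain m U where m: "m \<le> length x * ((k + 1) * length x + k + 3)" "holds_out out U"
    "(tm_step scan_tm ^^ m) (0, [(f, 0), (\<lambda>_. 0, 0), (\<lambda>_. 0, 0)]) =
    (e (q, False, False, []), [(f, int (length x)), (t, int h), U])"
    by (auto simp: e0)
  obtain u j where U: "U = (u, j)" by fastforce
  have "f (int (length x)) = 0" by (simp add: f_def)
  then have "tm_step scan_tm (e (q, False, False, []), [(f, int (length x)), (t, int h), U]) =
    (card ctls, [(f, int (length x)), (t, int h), (u(j := 0), j)])"
    using tm_step_scan[of "(q, False, False, [])" f "int (length x)" t "int h" u j]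
    by (simp add: fun_upd_idem ctls_def U del: tm_step.simps)
  then have "(tm_step scan_tm ^^ Suc m) (0, [(f, 0), (\<lambda>_. 0, 0), (\<lambda>_. 0, 0)]) =
    (card ctls, [(f, int (length x)), (t, int h), (u(j := 0), j)])"
    using m(3) by (simp del: tm_step.simps)
  moreover have "tm_init scan_tm x = (0, [(f, 0), (\<lambda>_. 0, 0), (\<lambda>_. 0, 0)])"
    by (simp add: tm_init_def input_tape_def f_def scan_tm_def numeral_2_eq_2)
  moreover have "has_output (u(j := 0), j) out"
    using m(2) by (auto simp: has_output_def holds_out_def U)
  ultimately show ?thesis
    unfolding tm_computes_within_def using m(1)
    by (intro exI[of _ "Suc m"] conjI exI[of _ "[(f, int (length x)), (t, int h), (u(j := 0), j)]"])
       (auto simp: scan_tm_def)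
qed

end

lemma scanner_polytime:
  fixes \<delta> :: "('q::finite) scanner"
  assumes "\<And>q b y q' a r ps. \<delta> q b y = (q', a, r, ps) \<Longrightarrow> length ps \<le> k"
  shows "\<exists>M T. valid_tm M \<and> poly_bounded T \<and> (\<forall>x q w out.
    foldl (scan_step \<delta>) (q0, (\<lambda>_. 0, 0), []) x = (q, w, out) \<longrightarrow> tm_computes_within M x out (T (length x)))"
proof -
  let ?S = "{(q :: 'q, l :: bool, l' :: bool, ps :: bool list). length ps \<le> k}"
  have "?S = UNIV \<times> UNIV \<times> UNIV \<times> {ps. set ps \<subseteq> UNIV \<and> length ps \<le> k}" by auto
  then have "finite ?S"
    using finite_lists_length_le[of "UNIV :: bool set" k] by (simp add: finite_cartesian_product)
  then obtain e where e: "bij_betw e ?S {..<card ?S}" "e (q0, False, False, []) = 0"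
    by (rule ex_bij_betw_nat_start[of _ "(q0, False, False, [])"]) auto
  interpret scanner_tm \<delta> k q0 e
    by standard (use assms e in blast)+
  have id: "poly_bounded (\<lambda>n. n)"
    unfolding poly_bounded_def by (rule exI[of _ 1], rule exI[of _ 1]) simp
  have "poly_bounded (\<lambda>n. n * ((k + 1) * n + k + 3) + 1)"
    by (intro poly_bounded_add poly_bounded_mult poly_bounded_const id)
  then show ?thesis
    using valid_scan_tm scan_tm_computes by blast
qed

section \<open>The moves of the collision finder\<close>

type_synonym fun_move = "bool list ground + bool ground"
type_synonym coll_move = "(nat \<times> (nat \<times> fun_move + bool list ground)) + (fun_move + fun_move)"

definition side :: "bool \<Rightarrow> 'a \<Rightarrow> 'a + 'a" where
  "side c y = (if c then Inr y else Inl y)"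

text \<open>What the collision finder remembers of a position: whether it has received an argument, the
  component of the last move on the right, the last argument received, and whether \<open>F\<close> has queried
  that argument since.\<close>

type_synonym memory = "bool \<times> bool \<times> bool list \<times> bool"

fun notice_side :: "memory \<Rightarrow> bool \<Rightarrow> fun_move \<Rightarrow> memory" where
  "notice_side (st, c, w, fd) c' (Inl (Ans w')) = (True, c', w', False)"
| "notice_side (st, c, w, fd) c' y = (st, c', w, fd)"

fun notice :: "memory \<Rightarrow> coll_move \<Rightarrow> memory" where
  "notice (st, c, w, fd) (Inl (i, Inl (k, Inl (Ans w')))) = (st, c, w, fd \<or> w = w')"
| "notice m (Inr (Inl y)) = notice_side m False y"
| "notice m (Inr (Inr y)) = notice_side m True y"
| "notice m x = m"

text \<open>These are the functions \<open>g\<close> (for \<open>c = False\<close>) and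
  \<open>h\<close> (for \<open>c = True\<close>), with \<open>fd\<close> standing for membership of
  \<open>w\<close> in \<open>Q\<close>.\<close>

definition answer :: "bool \<Rightarrow> bool list \<Rightarrow> bool \<Rightarrow> bool" where
  "answer c w fd \<longleftrightarrow> \<not> fd \<and> (c \<longrightarrow> w \<noteq> [] \<and> hd w)"

text \<open>The argument is empty only for \<open>n = 0\<close>, where no copy of \<open>F\<close> may be available: all functions in
  \<open>Pol\<close> may vanish at \<open>0\<close>.\<close>

fun reply_side :: "memory \<Rightarrow> bool \<Rightarrow> fun_move \<Rightarrow> coll_move" where
  "reply_side (st, c, w, fd) c' (Inl (Ans w')) =
     (if w' = [] then Inr (side c' (Inr (Ans True))) else Inl (if st then 1 else 0, Inr Ask))"
| "reply_side m c' y = Inr (side c' (Inl Ask))"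

text \<open>The third equation is the moment at which a run ends: once \<open>F\<close> has
  delivered a string, all its queries have been seen and the pending component can be
  answered.\<close>

fun reply :: "memory \<Rightarrow> coll_move \<Rightarrow> coll_move" where
  "reply m (Inl (i, Inl (k, Inl y))) = Inl (i, Inl (k, Inr (Ans False)))"
| "reply m (Inl (i, Inl (k, Inr y))) = Inl (i, Inl (k, Inl Ask))"
| "reply (st, c, w, fd) (Inl (i, Inr y)) = Inr (side c (Inr (Ans (answer c w fd))))"
| "reply m (Inr (Inl y)) = reply_side m False y"
| "reply m (Inr (Inr y)) = reply_side m True y"

lemma notice_side_simp [simp]: "notice m (Inr (side c y)) = notice_side m c y"
  by (simp add: side_def)

lemma reply_side_simp [simp]: "reply m (Inr (side c y)) = reply_side m c y"
  by (simp add: side_def)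

definition memory :: "coll_move list \<Rightarrow> memory" where
  "memory u = foldl notice (False, False, [], False) u"

definition next_move :: "coll_move list \<Rightarrow> coll_move" where
  "next_move u = reply (memory (butlast u)) (last u)"

section \<open>A parser for encoded positions\<close>

datatype pos = Start | Item | Stop | Move | Player | Component | Side | SideB | SideStr | Arg0 | ArgBit | Arg | Index | Copy | Out | OutStr | OutBit
  | QueryIndex | Query | QueryB | QueryStr | QueryArg | QueryBit | Skip

instance pos :: finite
proof
  have "(UNIV :: pos set) \<subseteq> {Start, Item, Stop, Move, Player, Component, Side, SideB, SideStr, Arg0, Arg,
    ArgBit, Index, Copy, Out, OutStr, OutBit, QueryIndex, Query, QueryB, QueryStr, QueryArg, QueryBit, Skip}"
    by (rule subsetI, case_tac x) simp_all
  then show "finite (UNIV :: pos set)" by (rule finite_subset) simp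
qed

text \<open>The flags are the three booleans of the memory, and whether the query being read agrees with the
  argument so far; the argument is on the work tape. While a move is being read, the prefix which it shares
  with the reply is written to the output.\<close>

fun parse :: "(pos \<times> bool \<times> bool \<times> bool \<times> bool) scanner" where
  "parse (Start, st, c, fd, mt) b y = ((if b then Start else Item, st, c, fd, mt), Keep, False, [])"
| "parse (Item, st, c, fd, mt) b y = ((if b then Move else Stop, st, c, fd, mt), Keep, b, [])"
| "parse (Stop, st, c, fd, mt) b y = ((Stop, st, c, fd, mt), Keep, False, [])"
| "parse (Move, st, c, fd, mt) b y = ((Player, st, c, fd, mt), Keep, False, [b])"
| "parse (Player, st, c, fd, mt) b y = ((if b then Component else Index, st, c, fd, mt), Keep, False, [b])"
| "parse (Component, st, c, fd, mt) b y = ((Side, st, b, fd, mt), Keep, False, [b])"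
| "parse (Side, st, c, fd, mt) b y = ((if b then SideB else SideStr, st, c, fd, mt), Keep, False, [])"
| "parse (SideB, st, c, fd, mt) b y =
     ((if b then Skip else Item, st, c, fd, mt), Keep, False, if b then [] else [False, False])"
| "parse (SideStr, st, c, fd, mt) b y = ((if b then Arg0 else Item, st, c, fd, mt), Keep, False, [])"
| "parse (Arg0, st, c, fd, mt) b y =
     (if b then ((ArgBit, st, c, fd, mt), Keep, False, [])
      else ((Item, True, c, False, mt), Cut, False, [True, True, True]))"
| "parse (ArgBit, st, c, fd, mt) b y = ((Arg, st, c, fd, mt), Put b, False, [])"
| "parse (Arg, st, c, fd, mt) b y =
     (if b then ((ArgBit, st, c, fd, mt), Keep, False, [])
      else ((Item, True, c, False, mt), Cut, True,
        [True, False] @ (if st then [True] else []) @ [False, True, False]))"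
| "parse (Index, st, c, fd, mt) b y = ((if b then Index else Copy, st, c, fd, mt), Keep, False, [b])"
| "parse (Copy, st, c, fd, mt) b y =
     (if b then ((Out, st, c, fd, mt), Keep, False, []) else ((QueryIndex, st, c, fd, mt), Keep, False, [False]))"
| "parse (Out, st, c, fd, mt) b y = ((if b then OutStr else Item, st, c, fd, mt), Keep, False, [])"
| "parse (OutStr, st, c, fd, mt) b y =
     (if b then ((OutBit, st, c, fd, mt), Keep, False, [])
      else ((Item, st, c, fd, mt), Keep, True, [True, True, c, True, True, \<not> fd \<and> (c \<longrightarrow> y = 2)]))"
| "parse (OutBit, st, c, fd, mt) b y = ((OutStr, st, c, fd, mt), Keep, False, [])"
| "parse (QueryIndex, st, c, fd, mt) b y = ((if b then QueryIndex else Query, st, c, fd, mt), Keep, False, [b])"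
| "parse (Query, st, c, fd, mt) b y = ((if b then QueryB else QueryStr, st, c, fd, mt), Keep, False, [])"
| "parse (QueryB, st, c, fd, mt) b y =
     ((if b then Skip else Item, st, c, fd, mt), Keep, False, if b then [] else [False, False])"
| "parse (QueryStr, st, c, fd, mt) b y = ((if b then QueryArg else Item, st, c, fd, True), Keep, False, [])"
| "parse (QueryArg, st, c, fd, mt) b y =
     (if b then ((QueryBit, st, c, fd, mt), Keep, False, [])
      else ((Item, st, c, fd \<or> mt \<and> y = 0, mt), Rew, False, [True, True, False]))"
| "parse (QueryBit, st, c, fd, mt) b y =
     (if y = bit_symbol b then ((QueryArg, st, c, fd, mt), Adv, False, [])
      else ((QueryArg, st, c, fd, False), Keep, False, []))"
| "parse (Skip, st, c, fd, mt) b y = ((Item, st, c, fd, mt), Keep, False, [])"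

text \<open>Six bits are the code of a whole reply, written at once when the output collected from
  the move has been discarded (\<open>Arg\<close> for the second argument, and
  \<open>OutStr\<close>).\<close>

lemma parse_pushes: "parse q b y = (q', a, r, ps) \<Longrightarrow> length ps \<le> 6"
  by (cases "(q, b, y)" rule: parse.cases) (auto split: if_splits)

definition holds :: "bool list \<Rightarrow> (int \<Rightarrow> nat) \<Rightarrow> bool" where
  "holds w t \<longleftrightarrow> (\<forall>i<length w. t (int i) = bit_symbol (w ! i)) \<and> t (int (length w)) = 0"

lemma holds_Nil: "holds [] t \<longleftrightarrow> t 0 = 0"
  by (simp add: holds_def)

abbreviation scan where "scan \<equiv> foldl (scan_step parse)"

lemma scan_OutStr: "scan ((OutStr, f), (t, h), out) (enc (z :: bool list)) = scan_step parse ((OutStr, f), (t, h), out) False"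
proof (induction z)
  case (Cons a z)
  then show ?case by (cases f) (simp add: enc_bool_def)
qed simp

lemma scan_Index: "scan ((Index, f), (t, h), out) (enc i) = ((Copy, f), (t, h), out @ enc i)" for i :: nat
  by (induction i arbitrary: out; cases f) (simp_all add: enc_nat_def)

lemma scan_QueryIndex: "scan ((QueryIndex, f), (t, h), out) (enc i) = ((Query, f), (t, h), out @ enc i)" for i :: nat
  by (induction i arbitrary: out; cases f) (simp_all add: enc_nat_def)

text \<open>The part of the argument already copied to the tape is \<open>v\<close>. The hypothesis
  inserts the blank at the head by hand, since symbols of an earlier argument may stand there until
  \<open>Cut\<close> overwrites them.\<close>

lemma scan_Arg:
  assumes "holds v (t(int h := 0))" "h = length v"
  shows "\<exists>t'. holds (v @ w) t' \<and> scan ((Arg, st, c, fd, mt), (t, h), out) (enc w) =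
    ((Item, True, c, False, mt), (t', 0), True # enc (Inl (if st then 1 else 0, Inr Ask) :: coll_move))"
  using assms
proof (induction w arbitrary: v t h)
  case Nil
  then show ?case by (intro exI[of _ "t(int h := 0)"]) (simp add: enc_nat_def fun_upd_def)
next
  case (Cons a w)
  have "holds (v @ [a]) ((t(int h := bit_symbol a))(int (Suc h) := 0))"
    using Cons.prems by (auto simp: holds_def nth_append less_Suc_eq)
  moreover have "Suc h = length (v @ [a])" using Cons.prems(2) by simp
  ultimately obtain t' where "holds ((v @ [a]) @ w) t'"
    "scan ((Arg, st, c, fd, mt), (t(int h := bit_symbol a), Suc h), out) (enc w) =
      ((Item, True, c, False, mt), (t', 0), True # enc (Inl (if st then 1 else 0, Inr Ask) :: coll_move))"
    using Cons.IH by blast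
  moreover have "scan ((Arg, st, c, fd, mt), (t, h), out) (enc (a # w)) =
      scan ((Arg, st, c, fd, mt), (t(int h := bit_symbol a), Suc h), out) (enc w)"
    by (simp add: enc_bool_def)
  ultimately show ?case
    by (intro exI[of _ t'] conjI) (simp_all only: append_assoc append.simps)
qed

lemma bit_symbol_inj: "bit_symbol a = bit_symbol b \<longleftrightarrow> a = b"
  by (auto simp: bit_symbol_def)

lemma bit_symbol_pos: "bit_symbol a \<noteq> 0"
  by (auto simp: bit_symbol_def)

text \<open>The head advances only while the bits agree, so \<open>drop h w\<close> is what remains
  to be compared. Testing for a blank at the end rules out a query that is a proper prefix of the
  argument; a longer query fails because a blank differs from every bit symbol.\<close>

lemma scan_QueryArg:
  assumes "holds w t" "h \<le> length w"
  shows "\<exists>mt'. scan ((QueryArg, st, c, fd, mt), (t, h), out) (enc w') =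
    ((Item, st, c, fd \<or> mt \<and> drop h w = w', mt'), (t, 0), out @ [True, True, False])"
  using assms
proof (induction w' arbitrary: h mt)
  case Nil
  have "t (int h) = 0 \<longleftrightarrow> h = length w"
    using Nil bit_symbol_pos by (cases "h = length w") (auto simp: holds_def)
  with Nil show ?case by auto
next
  case (Cons a w')
  show ?case
  proof (cases "h < length w \<and> w ! h = a")
    case True
    then have "t (int h) = bit_symbol a" "drop h w = a # drop (Suc h) w"
      using Cons.prems(1) Cons_nth_drop_Suc[of h w] by (auto simp: holds_def)
    with True Cons.IH[of "Suc h" mt] Cons.prems show ?thesis
      by (simp add: enc_bool_def bit_symbol_pos)
  next
    case False
    then have 1: "t (int h) \<noteq> bit_symbol a"
      using Cons.prems bit_symbol_pos[of a]
      by (cases "h = length w") (auto simp: holds_def bit_symbol_inj)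
    have "drop h w \<noteq> a # w'"
      using False Cons.prems by (metis drop_eq_Nil hd_drop_conv_nth le_neq_implies_less list.discI list.sel(1) order_refl)
    with 1 Cons.IH[of h False] Cons.prems show ?thesis
      by (simp add: enc_bool_def)
  qed
qed

text \<open>The state between two moves. The output is left open because the next item discards it,
  and \<open>mt\<close> because the next query resets it.\<close>

definition ready :: "memory \<Rightarrow> (pos \<times> bool \<times> bool \<times> bool \<times> bool) \<times> ((int \<Rightarrow> nat) \<times> nat) \<times> bool list \<Rightarrow> bool" where
  "ready m S \<longleftrightarrow> (\<exists>st c w fd mt t out. m = (st, c, w, fd) \<and> S = ((Item, st, c, fd, mt), (t, 0), out) \<and> holds w t)"

lemma ready_iff: "ready (st, c, w, fd) ((q, st', c', fd', mt), (t, h), out) \<longleftrightarrow>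
    q = Item \<and> st' = st \<and> c' = c \<and> fd' = fd \<and> h = 0 \<and> holds w t"
  by (auto simp: ready_def)

definition opponent :: "coll_move \<Rightarrow> bool" where
  "opponent x \<longleftrightarrow> (\<exists>i k w. x = Inl (i, Inl (k, Inl (Ans w)))) \<or> (\<exists>i k. x = Inl (i, Inl (k, Inr Ask))) \<or>
     (\<exists>i z. x = Inl (i, Inr (Ans z))) \<or> (\<exists>c w. x = Inr (side c (Inl (Ans w)))) \<or> (\<exists>c. x = Inr (side c (Inr Ask)))"

lemma enc_side: "enc (side c y) = c # enc y"
  by (simp add: side_def)

lemma scan_side:
  assumes "ready m S"
  shows "ready (notice_side m c y) (scan S (True # True # enc (Inr (side c y) :: coll_move))) \<and>
    (y = Inr Ask \<or> (\<exists>w. y = Inl (Ans w)) \<longrightarrow>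
      snd (snd (scan S (True # True # enc (Inr (side c y) :: coll_move)))) = True # enc (reply_side m c y))"
proof -
  obtain st c0 w fd mt t out where m: "m = (st, c0, w, fd)" "S = ((Item, st, c0, fd, mt), (t, 0), out)" "holds w t"
    using assms unfolding ready_def by blast
  consider "y = Inl Ask" | "y = Inr Ask" | b where "y = Inr (Ans b)" | "y = Inl (Ans [])"
    | a w' where "y = Inl (Ans (a # w'))"
    by (metis ground.exhaust sum.exhaust list.exhaust)
  then show ?thesis
  proof cases
    case 5
    have "holds [a] ((t(0 := bit_symbol a))(1 := 0))" by (simp add: holds_def)
    with scan_Arg[of "[a]" "t(0 := bit_symbol a)" 1 w' st c fd mt "[True, True, c]"]
    obtain t' where t': "holds (a # w') t'"
      "scan ((Arg, st, c, fd, mt), (t(0 := bit_symbol a), 1), [True, True, c]) (enc w') =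
        ((Item, True, c, False, mt), (t', 0), True # enc (Inl (if st then 1 else 0, Inr Ask) :: coll_move))" by auto
    have "scan S (True # True # enc (Inr (side c y) :: coll_move)) =
       scan ((Arg, st, c, fd, mt), (t(0 := bit_symbol a), 1), [True, True, c]) (enc w')"
      by (simp add: 5 m enc_side enc_bool_def)
    with t' show ?thesis by (auto simp: 5 m ready_iff)
  qed (use m(3) in \<open>auto simp: m enc_side enc_bool_def ready_iff holds_Nil\<close>)
qed

text \<open>The memory has to be tracked through the moves of both players, but a reply is due only
  after a move of the opponent. After other moves the output may be an incomplete code, which the
  next item discards.\<close>

lemma scan_move:
  assumes "ready m S"
  shows "ready (notice m x) (scan S (True # True # enc x)) \<and>
    (opponent x \<longrightarrow> snd (snd (scan S (True # True # enc x))) = True # enc (reply m x))"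
proof (cases x)
  case (Inr y)
  obtain c f where "y = side c f" using that[of False] that[of True] by (cases y) (auto simp: side_def)
  with scan_side[OF assms, of c f] Inr show ?thesis
    by (auto simp: opponent_def side_def split: if_splits)
next
  case (Inl y)
  obtain st c w fd mt t out where m: "m = (st, c, w, fd)" "S = ((Item, st, c, fd, mt), (t, 0), out)" "holds w t"
    using assms unfolding ready_def by blast
  obtain i y' where y: "y = (i, y')" by fastforce
  consider "y' = Inr Ask" | z where "y' = Inr (Ans z)" | k where "y' = Inl (k, Inl Ask)"
    | k where "y' = Inl (k, Inr Ask)" | k b where "y' = Inl (k, Inr (Ans b))"
    | k w' where "y' = Inl (k, Inl (Ans w'))"
    by (metis ground.exhaust sum.exhaust surj_pair)
  then show ?thesis
  proof cases
    case 2
    \<comment> \<open>Between moves the head rests on cell \<open>0\<close>, so the symbol under it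
      tells whether the argument is nonempty and starts with \<open>True\<close>.\<close>
    have "t 0 = (if w = [] then 0 else bit_symbol (hd w))"
      using m(3) by (cases w) (force simp: holds_def)+
    then have "t 0 = 2 \<longleftrightarrow> w \<noteq> [] \<and> hd w"
      by (simp add: bit_symbol_def)
    then show ?thesis
      by (simp add: 2 Inl y m scan_Index scan_OutStr ready_iff enc_side enc_bool_def answer_def)
  next
    case 6
    from scan_QueryArg[OF m(3), of 0 st c fd True "[True, False] @ enc i @ False # enc k" w']
    obtain mt' where "scan ((QueryArg, st, c, fd, True), (t, 0), [True, False] @ enc i @ False # enc k) (enc w') =
      ((Item, st, c, fd \<or> w = w', mt'), (t, 0), ([True, False] @ enc i @ False # enc k) @ [True, True, False])"
      by auto
    with m(3) show ?thesis
      by (simp add: 6 Inl y m(1,2) scan_Index scan_QueryIndex ready_iff enc_bool_def)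
  next
    case 1
    then show ?thesis
      using m(3) by (simp add: Inl y m(1,2) scan_Index scan_QueryIndex ready_iff enc_bool_def opponent_def)
  next
    case 3
    then show ?thesis
      using m(3) by (simp add: Inl y m(1,2) scan_Index scan_QueryIndex ready_iff enc_bool_def opponent_def)
  next
    case 4
    then show ?thesis
      using m(3) by (simp add: Inl y m(1,2) scan_Index scan_QueryIndex ready_iff enc_bool_def opponent_def)
  next
    case 5
    then show ?thesis
      using m(3) by (simp add: Inl y m(1,2) scan_Index scan_QueryIndex ready_iff enc_bool_def opponent_def)
  qed
qed

lemma enc_map_Inr_Cons:
  "enc (map Inr (x # u) :: (bool ground + coll_move) list) = (True # True # enc x) @ enc (map Inr u :: (bool ground + coll_move) list)"
  by simp

text \<open>In the code of a list every item is announced by \<open>True\<close>, on which the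
  scanner discards its output, and the end is marked by \<open>False\<close>, on which it does not.
  Hence exactly the reply to the last move survives.\<close>

lemma scan_moves:
  assumes "ready m S" "opponent x"
  shows "\<exists>q w. scan S (enc (map Inr (u @ [x]) :: (bool ground + coll_move) list)) =
    (q, w, enc (Inr (reply (foldl notice m u) x) :: bool ground + coll_move))"
  using assms(1)
proof (induction u arbitrary: m S)
  case Nil
  define S' where "S' = scan S (True # True # enc x)"
  have S': "ready (notice m x) S'" "snd (snd S') = True # enc (reply m x)"
    using scan_move[OF Nil, of x] assms(2) unfolding S'_def by blast+
  obtain f t where "S' = ((Item, f), (t, 0), snd (snd S'))"
    using S'(1) unfolding ready_def by fastforce
  then have "scan_step parse S' False = ((Stop, f), (t, 0), True # enc (reply m x))"
    unfolding S'(2) by (cases f) simp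
  moreover have "scan S (enc (map Inr ([] @ [x]) :: (bool ground + coll_move) list)) = scan_step parse S' False"
    unfolding append_Nil enc_map_Inr_Cons foldl_append S'_def[symmetric] by simp
  ultimately have "scan S (enc (map Inr ([] @ [x]) :: (bool ground + coll_move) list)) =
      ((Stop, f), (t, 0), enc (Inr (reply (foldl notice m []) x) :: bool ground + coll_move))"
    by (simp only: foldl.simps enc_sum.simps)
  then show ?case by blast
next
  case (Cons a u)
  have "scan S (enc (map Inr ((a # u) @ [x]) :: (bool ground + coll_move) list)) =
      scan (scan S (True # True # enc a)) (enc (map Inr (u @ [x]) :: (bool ground + coll_move) list))"
    unfolding append_Cons[of a u] enc_map_Inr_Cons foldl_append by (rule refl)
  moreover have "ready (notice m a) (scan S (True # True # enc a))"
    using scan_move[OF Cons.prems] by blast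
  ultimately show ?case
    using Cons.IH by (simp only: foldl.simps)
qed

lemma next_move_polytime:
  "\<exists>M T. valid_tm M \<and> poly_bounded T \<and> (\<forall>n u x. opponent x \<longrightarrow>
     (let y = replicate n True @ [False] @ enc (map Inr (u @ [x]) :: (bool ground + coll_move) list)
      in tm_computes_within M y (enc (Inr (next_move (u @ [x])) :: bool ground + coll_move)) (T (length y))))"
proof -
  have "\<exists>M T. valid_tm M \<and> poly_bounded T \<and>
    (\<forall>x q w out. scan ((Start, False, False, False, False), (\<lambda>_. 0, 0), []) x = (q, w, out) \<longrightarrow>
      tm_computes_within M x out (T (length x)))"
    by (rule scanner_polytime) (rule parse_pushes)
  then obtain M T where M: "valid_tm M" "poly_bounded T" and
    c: "\<forall>x q w out. scan ((Start, False, False, False, False), (\<lambda>_. 0, 0), []) x = (q, w, out) \<longrightarrow>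
      tm_computes_within M x out (T (length x))" by blast
  have start: "scan ((Start, f), (t, h), out) (replicate n True @ [False]) = ((Item, f), (t, h), out)" for n f t h out
    by (induction n; cases f) simp_all
  have "tm_computes_within M y (enc (Inr (next_move (u @ [x])) :: bool ground + coll_move)) (T (length y))"
    if "opponent x" and y: "y = replicate n True @ [False] @ enc (map Inr (u @ [x]) :: (bool ground + coll_move) list)"
    for n u x y
  proof -
    have "ready (False, False, [], False) ((Item, False, False, False, False), (\<lambda>_. 0, 0), [])"
      by (simp add: ready_iff holds_def)
    from scan_moves[OF this that(1), of u] obtain q w where
      "scan ((Item, False, False, False, False), (\<lambda>_. 0, 0), []) (enc (map Inr (u @ [x]) :: (bool ground + coll_move) list)) =
        (q, w, enc (Inr (next_move (u @ [x])) :: bool ground + coll_move))"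
      by (auto simp: next_move_def memory_def)
    moreover have "scan ((Start, False, False, False, False), (\<lambda>_. 0, 0), []) y =
      scan ((Item, False, False, False, False), (\<lambda>_. 0, 0), []) (enc (map Inr (u @ [x]) :: (bool ground + coll_move) list))"
      unfolding y append_assoc[symmetric] foldl_append[of _ _ "replicate n True @ [False]"] start by (rule refl)
    ultimately have "scan ((Start, False, False, False, False), (\<lambda>_. 0, 0), []) y =
      (q, w, enc (Inr (next_move (u @ [x])) :: bool ground + coll_move))" by (simp only:)
    with c show ?thesis by blast
  qed
  with M show ?thesis unfolding Let_def by blast
qed

section \<open>Plays of composite games\<close>

lemma alternating_snoc:
  "alternating Om Pm (t @ [x]) \<longleftrightarrow> alternating Om Pm t \<and> x \<in> (if even (length t) then Om else Pm)"
  by (simp add: alternating_def All_less_Suc nth_append cong: conj_cong) blast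

lemma play_append: "is_game G \<Longrightarrow> t @ t' \<in> plays G n \<Longrightarrow> t \<in> plays G n"
  using prefixI[of "t @ t'" t t'] unfolding is_game_def by blast

lemma snoc_polarity:
  assumes "is_game G" "t @ [x] \<in> plays G n"
  shows "x \<in> (if even (length t) then omoves G else pmoves G)"
proof -
  have "alternating (omoves G) (pmoves G) (t @ [x])"
    using assms unfolding is_game_def by blast
  then show ?thesis by (simp add: alternating_snoc)
qed

text \<open>As the two sets of moves are disjoint, the owner of a move reveals the parity of the
  play before it. Applied to the single components of a composite game, this is the source of all
  switching arguments below.\<close>

lemma move_parity:
  assumes "is_game G" "t @ [x] \<in> plays G n"
  shows "x \<in> omoves G \<longleftrightarrow> even (length t)" "x \<in> pmoves G \<longleftrightarrow> odd (length t)"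
proof -
  have "omoves G \<inter> pmoves G = {}" using assms(1) unfolding is_game_def by blast
  with snoc_polarity[OF assms] show "x \<in> omoves G \<longleftrightarrow> even (length t)" "x \<in> pmoves G \<longleftrightarrow> odd (length t)"
    by (cases "even (length t)"; auto)+
qed

lemma lefts_simps [simp]: "lefts [] = []" "lefts (Inl x # t) = x # lefts t" "lefts (Inr y # t) = lefts t"
  by (simp_all add: lefts_def)

lemma rights_simps [simp]: "rights [] = []" "rights (Inl x # t) = rights t" "rights (Inr y # t) = y # rights t"
  by (simp_all add: rights_def)

lemma copy_simps [simp]: "copy i [] = []" "copy i ((j, x) # t) = (if i = j then x # copy i t else copy i t)"
  by (simp_all add: copy_def)

lemmas split_appends [simp] = lefts_append rights_append copy_append

lemma set_lefts: "x \<in> set (lefts t) \<longleftrightarrow> Inl x \<in> set t"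
  proof (induction t)
  case (Cons a t)
  then show ?case by (cases a) auto
qed simp

lemma set_copy: "x \<in> set (copy i t) \<longleftrightarrow> (i, x) \<in> set t"
  by (auto simp: copy_def)

lemma Inl_in_Plus_iff: "Inl x \<in> A <+> B \<longleftrightarrow> x \<in> A"
  by auto

lemma Inr_in_Plus_iff: "Inr y \<in> A <+> B \<longleftrightarrow> y \<in> B"
  by auto

section \<open>Extending plays of composite games by one move\<close>

lemma lolli_plays:
  "t \<in> plays (G \<multimap> H) n \<longleftrightarrow> alternating (pmoves G <+> omoves H) (omoves G <+> pmoves H) t \<and>
     lefts t \<in> plays G n \<and> rights t \<in> plays H n"
  by (simp add: lolli_def)

lemma lolli_snoc_Inl:
  assumes "is_game G"
  shows "t @ [Inl x] \<in> plays (G \<multimap> H) n \<longleftrightarrow> t \<in> plays (G \<multimap> H) n \<and> lefts t @ [x] \<in> plays G n \<and>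
    x \<in> (if even (length t) then pmoves G else omoves G)"
  using play_append[OF assms, of "lefts t" "[x]" n]
  by (simp add: lolli_plays alternating_snoc Inl_in_Plus_iff) blast

lemma lolli_snoc_Inr:
  assumes "is_game H"
  shows "t @ [Inr y] \<in> plays (G \<multimap> H) n \<longleftrightarrow> t \<in> plays (G \<multimap> H) n \<and> rights t @ [y] \<in> plays H n \<and>
    y \<in> (if even (length t) then omoves H else pmoves H)"
  using play_append[OF assms, of "rights t" "[y]" n]
  by (simp add: lolli_plays alternating_snoc Inr_in_Plus_iff) blast

definition part :: "bool \<Rightarrow> ('a + 'a) list \<Rightarrow> 'a list" where
  "part d t = (if d then rights t else lefts t)"

lemma part_simps [simp]:
  "part d [] = []" "part d (side d' x # t) = (if d = d' then x # part d t else part d t)"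
  "part d (t @ t') = part d t @ part d t'"
  by (auto simp: part_def side_def)

lemma length_part: "length t = length (part False t) + length (part True t)"
  using length_lefts_rights[of t] by (simp add: part_def)

lemma side_in_Plus_iff: "side d x \<in> A <+> A \<longleftrightarrow> x \<in> A"
  by (auto simp: side_def)

lemma tensor_plays:
  "t \<in> plays (G \<otimes> H) n \<longleftrightarrow> alternating (omoves G <+> omoves H) (pmoves G <+> pmoves H) t \<and>
     lefts t \<in> plays G n \<and> rights t \<in> plays H n"
  by (simp add: tensor_def)

lemma tensor_part_plays:
  "t \<in> plays (G \<otimes> G) n \<longleftrightarrow> alternating (omoves G <+> omoves G) (pmoves G <+> pmoves G) t \<and>
     (\<forall>d. part d t \<in> plays G n)"
  unfolding tensor_plays part_def by (auto split: if_splits)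

lemma tensor_snoc:
  assumes "is_game G"
  shows "t @ [side d x] \<in> plays (G \<otimes> G) n \<longleftrightarrow> t \<in> plays (G \<otimes> G) n \<and> part d t @ [x] \<in> plays G n \<and>
    x \<in> (if even (length t) then omoves G else pmoves G)"
proof -
  have part: "part d' (t @ [side d x]) = (if d' = d then part d t @ [x] else part d' t)" for d'
    by simp
  have "(\<forall>d'. part d' (t @ [side d x]) \<in> plays G n) \<longleftrightarrow> (\<forall>d'. part d' t \<in> plays G n) \<and> part d t @ [x] \<in> plays G n"
    unfolding part using play_append[OF assms, of "part d t" "[x]" n]
    by (cases d) (auto simp: all_bool_eq)
  moreover have "side d x \<in> (if even (length t) then omoves G <+> omoves G else pmoves G <+> pmoves G) \<longleftrightarrow>
      x \<in> (if even (length t) then omoves G else pmoves G)"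
    by (simp add: side_in_Plus_iff)
  ultimately show ?thesis
    unfolding tensor_part_plays alternating_snoc by argo
qed

lemma bang_plays:
  "t \<in> plays (bang r G) n \<longleftrightarrow> alternating (UNIV \<times> omoves G) (UNIV \<times> pmoves G) t \<and>
     (\<forall>i. copy i t \<in> plays G n) \<and>
     (\<forall>k<length t. \<forall>i. fst (t ! k) = Suc i \<longrightarrow> (\<exists>l<k. fst (t ! l) = i)) \<and>
     (\<forall>m\<in>set t. fst m < r n)"
  by (simp add: bang_def)

lemma fst_set_nth: "j \<in> fst ` set t \<longleftrightarrow> (\<exists>l<length t. fst (t ! l) = j)"
  by (metis in_set_conv_nth image_iff)

lemma bang_snoc:
  assumes "is_game G"
  shows "t @ [(i, x)] \<in> plays (bang r G) n \<longleftrightarrow> t \<in> plays (bang r G) n \<and> copy i t @ [x] \<in> plays G n \<and>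
    i < r n \<and> (i = 0 \<or> i - 1 \<in> fst ` set t) \<and> x \<in> (if even (length t) then omoves G else pmoves G)"
proof -
  have order: "(\<forall>k<length (t @ [(i, x)]). \<forall>j. fst ((t @ [(i, x)]) ! k) = Suc j \<longrightarrow> (\<exists>l<k. fst ((t @ [(i, x)]) ! l) = j)) \<longleftrightarrow>
      (\<forall>k<length t. \<forall>j. fst (t ! k) = Suc j \<longrightarrow> (\<exists>l<k. fst (t ! l) = j)) \<and> (i = 0 \<or> i - 1 \<in> fst ` set t)"
    (is "?A \<longleftrightarrow> ?B \<and> ?C")
  proof -
    have C: "?C \<longleftrightarrow> (\<forall>j. i = Suc j \<longrightarrow> (\<exists>l<length t. fst (t ! l) = j))"
      by (cases i) (simp_all add: fst_set_nth)
    have nth: "fst ((t @ [(i, x)]) ! k) = fst (t ! k)" if "k < length t" for k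
      using that by (simp add: nth_append)
    have ex: "(\<exists>l<k. fst ((t @ [(i, x)]) ! l) = j) \<longleftrightarrow> (\<exists>l<k. fst (t ! l) = j)" if "k \<le> length t" for k j
      using that by (metis nth_append order_less_le_trans)
    have "(\<forall>k<length t. \<forall>j. fst ((t @ [(i, x)]) ! k) = Suc j \<longrightarrow> (\<exists>l<k. fst ((t @ [(i, x)]) ! l) = j)) \<longleftrightarrow> ?B"
      by (simp add: ex nth)
    moreover have "(\<forall>j. fst ((t @ [(i, x)]) ! length t) = Suc j \<longrightarrow>
        (\<exists>l<length t. fst ((t @ [(i, x)]) ! l) = j)) \<longleftrightarrow> ?C"
      unfolding C ex[OF order_refl] by simp
    ultimately show ?thesis
      unfolding length_append_singleton All_less_Suc by argo
  qed
  have copies: "(\<forall>j. copy j (t @ [(i, x)]) \<in> plays G n) \<longleftrightarrow> (\<forall>j. copy j t \<in> plays G n) \<and> copy i t @ [x] \<in> plays G n"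
    using play_append[OF assms, of "copy i t" "[x]" n] by (auto split: if_splits)
  show ?thesis
    unfolding bang_plays order copies alternating_snoc by auto
qed

lemma copy_used: "copy i t \<noteq> [] \<longleftrightarrow> i \<in> fst ` set t"
proof (induction t)
  case (Cons a t)
  then show ?case by (cases a) auto
qed simp

lemma bang_order:
  "t \<in> plays (bang r G) n \<Longrightarrow> k < length t \<Longrightarrow> fst (t ! k) = Suc i \<Longrightarrow> \<exists>l<k. fst (t ! l) = i"
  by (simp add: bang_def)

text \<open>A copy in use was opened legally, so the bound on its index and the opening order need
  no new check when it is continued.\<close>

lemma bang_snoc_used:
  assumes "is_game G" "t \<in> plays (bang r G) n" "copy i t \<noteq> []"
  shows "i < r n" "i = 0 \<or> i - 1 \<in> fst ` set t"
proof -
  obtain k where k: "k < length t" "fst (t ! k) = i"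
    using assms(3) unfolding copy_used fst_set_nth by blast
  then have "t ! k \<in> set t" by simp
  with assms(2) k(2) show "i < r n" by (auto simp: bang_def)
  show "i = 0 \<or> i - 1 \<in> fst ` set t"
  proof (cases i)
    case (Suc j)
    then obtain l where "l < k" "fst (t ! l) = j"
      using bang_order[OF assms(2) k(1)] k(2) by metis
    then have "l < length t \<and> fst (t ! l) = i - 1" using k(1) Suc by simp
    then show ?thesis unfolding fst_set_nth by blast
  qed simp
qed

section \<open>The plays of the game of Boolean functions\<close>

lemma is_game_fun: "is_game fun_game"
  by (intro is_game_lolli is_game_Str is_game_B)

lemma alternating_Nil: "alternating Om Pm []"
  by (simp add: alternating_def)

lemma alternating_single: "alternating Om Pm [x] \<longleftrightarrow> x \<in> Om"
  by (simp add: alternating_def)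

lemma fun_game_omoves: "omoves fun_game = range (Inl \<circ> Ans) \<union> {Inr Ask}"
  by (simp add: lolli_def Str_game_def B_game_def Plus_def image_comp)

lemma fun_game_pmoves: "pmoves fun_game = {Inl Ask} \<union> range (Inr \<circ> Ans)"
  by (simp add: lolli_def Str_game_def B_game_def Plus_def image_comp)

lemma fun_play_iff: "t \<in> plays fun_game n \<longleftrightarrow> alternating (range (Inl \<circ> Ans) \<union> {Inr Ask}) ({Inl Ask} \<union> range (Inr \<circ> Ans)) t \<and>
   (lefts t = [] \<or> lefts t = [Ask] \<or> (\<exists>w. length w = n \<and> lefts t = [Ask, Ans w])) \<and>
   (rights t = [] \<or> rights t = [Ask] \<or> (\<exists>b. rights t = [Ask, Ans b]))"
proof -
  have "t \<in> plays fun_game n \<longleftrightarrow> alternating (omoves fun_game) (pmoves fun_game) t \<and>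
    lefts t \<in> plays (Str_game (\<lambda>n. n)) n \<and> rights t \<in> plays B_game n"
    by (simp add: lolli_def)
  then show ?thesis
    unfolding fun_game_omoves fun_game_pmoves by (auto simp: Str_game_def B_game_def bits_def)
qed

lemma fun_play1:
  "[x] \<in> plays fun_game n \<longleftrightarrow> x = Inr Ask"
  by (cases x) (auto simp: fun_play_iff alternating_Cons2 alternating_single alternating_Nil)
lemma fun_play2:
  "[Inr Ask, x] \<in> plays fun_game n \<longleftrightarrow> x = Inl Ask \<or> (\<exists>b. x = Inr (Ans b))"
  by (cases x) (auto simp: fun_play_iff alternating_Cons2 alternating_single alternating_Nil)
lemma fun_play3:
  "[Inr Ask, Inl Ask, x] \<in> plays fun_game n \<longleftrightarrow> (\<exists>w. x = Inl (Ans w) \<and> length w = n)"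
  by (cases x) (auto simp: fun_play_iff alternating_Cons2 alternating_single alternating_Nil)
lemma fun_play4:
  "[Inr Ask, Inl Ask, Inl (Ans w), x] \<in> plays fun_game n \<longleftrightarrow> length w = n \<and> (\<exists>b. x = Inr (Ans b))"
  by (cases x) (auto simp: fun_play_iff alternating_Cons2 alternating_single alternating_Nil)
lemma fun_play5:
  "[Inr Ask, Inl Ask, Inl (Ans w), Inr (Ans b), x] \<notin> plays fun_game n"
  by (cases x) (auto simp: fun_play_iff alternating_Cons2 alternating_single alternating_Nil)

section \<open>Running the hash strategy on a function\<close>

type_synonym hash_move = "nat \<times> fun_move + bool list ground"

lemma Str_play1: "[x] \<in> plays (Str_game r) n \<longleftrightarrow> x = Ask"
  by (auto simp: Str_game_def)

lemma Str_play2: "[Ask, x] \<in> plays (Str_game r) n \<longleftrightarrow> (\<exists>z. length z = r n \<and> x = Ans z)"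
  by (auto simp: Str_game_def bits_def)

lemma Str_play3: "[Ask, Ans z, x] \<notin> plays (Str_game r) n"
  by (simp add: Str_game_def)

lemma Str_game_moves: "omoves (Str_game r) = {Ask}" "pmoves (Str_game r) = range Ans"
  by (simp_all add: Str_game_def)

lemma bang_moves: "omoves (bang r G) = UNIV \<times> omoves G" "pmoves (bang r G) = UNIV \<times> pmoves G"
  by (simp_all add: bang_def)

lemma lolli_moves: "omoves (G \<multimap> H) = pmoves G <+> omoves H" "pmoves (G \<multimap> H) = omoves G <+> pmoves H"
  by (simp_all add: lolli_def)

text \<open>These are positions with the player to move, after an opponent whose argument copies all
  follow \<phi>. The player is unconstrained; legality is always imposed separately.\<close>

inductive run :: "(bool list \<Rightarrow> bool) \<Rightarrow> hash_move list \<Rightarrow> bool" for \<phi> where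
  run_start: "run \<phi> [Inr Ask]"
| run_ask: "run \<phi> t \<Longrightarrow> run \<phi> (t @ [Inl (k, Inr Ask), Inl (k, Inl Ask)])"
| run_arg: "run \<phi> t \<Longrightarrow> run \<phi> (t @ [Inl (k, Inl (Ans w)), Inl (k, Inr (Ans (\<phi> w)))])"

definition queried :: "hash_move list \<Rightarrow> bool list set" where
  "queried t = {w. \<exists>k. Inl (k, Inl (Ans w)) \<in> set t}"

lemma queried_simps [simp]:
  "queried [] = {}" "queried (t @ t') = queried t \<union> queried t'"
  "queried (Inl (k, Inl (Ans w)) # t) = insert w (queried t)"
  "queried (Inl (k, Inl Ask) # t) = queried t" "queried (Inl (k, Inr y) # t) = queried t"
  "queried (Inr z # t) = queried t"
  by (auto simp: queried_def)

text \<open>A run sees only the values at its queries. This is what makes two different functions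
  collide.\<close>

lemma run_cong:
  assumes "run \<phi> t" "\<And>w. w \<in> queried t \<Longrightarrow> \<phi> w = \<psi> w"
  shows "run \<psi> t"
  using assms
proof induction
  case (run_arg t k w)
  then have "run \<psi> t" "\<phi> w = \<psi> w" by auto
  then show ?case by (simp add: run.run_arg)
qed (auto intro: run.intros)

fun respond :: "(bool list \<Rightarrow> bool) \<Rightarrow> hash_move \<Rightarrow> hash_move" where
  "respond \<phi> (Inl (k, Inl (Ans w))) = Inl (k, Inr (Ans (\<phi> w)))"
| "respond \<phi> (Inl (k, y)) = Inl (k, Inl Ask)"
| "respond \<phi> (Inr z) = Inr Ask"

text \<open>The positionwise description allows two runs to be compared by induction on a common
  index.\<close>

lemma run_nth:
  assumes "run \<phi> t"
  shows "odd (length t) \<and> t ! 0 = Inr Ask \<and>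
    (\<forall>i. odd i \<longrightarrow> i < length t \<longrightarrow> (\<exists>y. t ! i = Inl y) \<and> t ! Suc i = respond \<phi> (t ! i))"
  using assms
proof induction
  case (run_ask t k)
  then have l: "odd (length t)" "0 < length t" by (auto intro: Nat.gr0I)
  have "(\<exists>y. (t @ [Inl (k, Inr Ask), Inl (k, Inl Ask)]) ! i = Inl y) \<and>
      (t @ [Inl (k, Inr Ask), Inl (k, Inl Ask)]) ! Suc i = respond \<phi> ((t @ [Inl (k, Inr Ask), Inl (k, Inl Ask)]) ! i)"
    if "odd i" "i < length t + 2" for i
  proof -
    from that l consider "Suc i < length t" | "i = length t"
      by (metis Suc_lessI add_2_eq_Suc' even_Suc less_SucE)
    then show ?thesis
      by cases (use run_ask that in \<open>auto simp: nth_append\<close>)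
  qed
  with run_ask l show ?case by (auto simp: nth_append)
next
  case (run_arg t k w)
  then have l: "odd (length t)" "0 < length t" by (auto intro: Nat.gr0I)
  have "(\<exists>y. (t @ [Inl (k, Inl (Ans w)), Inl (k, Inr (Ans (\<phi> w)))]) ! i = Inl y) \<and>
      (t @ [Inl (k, Inl (Ans w)), Inl (k, Inr (Ans (\<phi> w)))]) ! Suc i =
        respond \<phi> ((t @ [Inl (k, Inl (Ans w)), Inl (k, Inr (Ans (\<phi> w)))]) ! i)"
    if "odd i" "i < length t + 2" for i
  proof -
    from that l consider "Suc i < length t" | "i = length t"
      by (metis Suc_lessI add_2_eq_Suc' even_Suc less_SucE)
    then show ?thesis
      by cases (use run_arg that in \<open>auto simp: nth_append\<close>)
  qed
  with run_arg l show ?case by (auto simp: nth_append)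
qed (simp add: odd_pos)

lemma plays_of_even: "t \<in> plays_of f \<Longrightarrow> even (length t)"
  by (induction rule: plays_of.induct) auto

lemma plays_of_nth:
  assumes "t \<in> plays_of f" "odd i" "i < length t"
  shows "f (take i t) = Some (t ! i)"
  using assms
proof (induction arbitrary: i rule: plays_of.induct)
  case (plays_of_step t x y)
  have "even (length t)" using plays_of_step.hyps(1) by (rule plays_of_even)
  with plays_of_step.prems consider "i < length t" | "i = Suc (length t)"
    by (metis One_nat_def Suc_1 add_2_eq_Suc' even_Suc length_Cons length_append less_SucE list.size(3) plus_1_eq_Suc)
  then show ?case
  proof cases
    case 1
    with plays_of_step show ?thesis by (simp add: nth_append)
  next
    case 2
    with plays_of_step show ?thesis by (simp add: nth_append)
  qed
qed simp

text \<open>Moves at odd positions are determined by \<open>f\<close> and those at even positions by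
  \<phi>, so the plays agree as long as both last. If one run were shorter, its output would have to
  coincide with a move that the other makes in the argument.\<close>

lemma run_output_unique:
  assumes "run \<phi> h" "h @ [Inr (Ans z)] \<in> plays_of f" and "run \<phi> h'" "h' @ [Inr (Ans z')] \<in> plays_of f"
  shows "h = h' \<and> z = z'"
proof -
  have *: "take i (h @ [Inr (Ans z)]) = take i (h' @ [Inr (Ans z')])"
    if "run \<phi> h" "h @ [Inr (Ans z)] \<in> plays_of f" "run \<phi> h'" "h' @ [Inr (Ans z')] \<in> plays_of f"
      "length h \<le> length h'" "i \<le> Suc (length h)" for h h' z z' i
    using that(6)
  proof (induction i)
    case (Suc i)
    let ?t = "h @ [Inr (Ans z)]" and ?t' = "h' @ [Inr (Ans z')]"
    have IH: "take i ?t = take i ?t'" using Suc by simp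
    have "?t ! i = ?t' ! i"
    proof (cases "odd i")
      case True
      have "f (take i ?t) = Some (?t ! i)"
        by (rule plays_of_nth[OF that(2) True]) (use Suc.prems in simp)
      moreover have "f (take i ?t') = Some (?t' ! i)"
        by (rule plays_of_nth[OF that(4) True]) (use Suc.prems that(5) in simp)
      ultimately show ?thesis using IH by simp
    next
      case False
      show ?thesis
      proof (cases i)
        case 0
        then show ?thesis
          using run_nth[OF that(1)] run_nth[OF that(3)] by (auto simp: nth_append)
      next
        case (Suc j)
        then have "odd j" using False by simp
        have i: "i < length h"
          using False Suc.prems run_nth[OF that(1)] by (metis Suc_le_mono le_neq_implies_less)
        have "?t ! j = take i ?t ! j" "?t' ! j = take i ?t' ! j" using Suc by (simp_all only: nth_take lessI)
        then have "?t ! j = ?t' ! j" using IH by simp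
        then have "h ! j = h' ! j" using i Suc that(5) by (simp add: nth_append)
        then show ?thesis
          using run_nth[OF that(1)] run_nth[OF that(3)] \<open>odd j\<close> i Suc that(5) by (simp add: nth_append)
      qed
    qed
    then show ?case
      using IH Suc.prems that(5) by (simp add: take_Suc_conv_app_nth del: take_append)
  qed simp
  have eq: "h = h' \<and> z = z'"
    if "run \<phi> h" "h @ [Inr (Ans z)] \<in> plays_of f" "run \<phi> h'" "h' @ [Inr (Ans z')] \<in> plays_of f"
      "length h \<le> length h'" for h h' z z'
  proof -
    have t: "h @ [Inr (Ans z)] = take (Suc (length h)) (h' @ [Inr (Ans z')])"
      using *[OF that, of "Suc (length h)"] by simp
    have "length h = length h'"
    proof (rule ccontr)
      assume "length h \<noteq> length h'"
      with that(5) have l: "length h < length h'" by simp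
      then have "h' ! length h = Inr (Ans z)"
        using arg_cong[OF t, of "\<lambda>x. x ! length h"] by (simp add: nth_append)
      then show False
        using run_nth[OF that(1)] run_nth[OF that(3)] l by auto
    qed
    with t show ?thesis by simp
  qed
  show ?thesis
    using eq[OF assms] eq[OF assms(3,4,1,2)] by (metis nat_le_linear)
qed

locale hash =
  fixes q p :: "nat \<Rightarrow> nat"
  assumes q: "poly_bounded q"
begin

abbreviation hash_plays :: "nat \<Rightarrow> hash_move list set" where
  "hash_plays \<equiv> plays (hash_game q p)"

lemma is_game_hash: "is_game (hash_game q p)"
  by (intro is_game_lolli is_game_bang is_game_fun is_game_Str q)

lemma hash_snoc_Inl:
  "t @ [Inl (k, y)] \<in> hash_plays n \<longleftrightarrow> t \<in> hash_plays n \<and> copy k (lefts t) @ [y] \<in> plays fun_game n \<and>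
    lefts t \<in> plays (bang q fun_game) n \<and>
    k < q n \<and> (k = 0 \<or> k - 1 \<in> fst ` set (lefts t)) \<and>
    y \<in> (if even (length (lefts t)) then omoves fun_game else pmoves fun_game) \<and>
    y \<in> (if even (length t) then pmoves fun_game else omoves fun_game)"
proof -
  have "(k, y) \<in> (if even (length t) then pmoves (bang q fun_game) else omoves (bang q fun_game)) \<longleftrightarrow>
      y \<in> (if even (length t) then pmoves fun_game else omoves fun_game)"
    by (simp add: bang_moves)
  then show ?thesis
    unfolding lolli_snoc_Inl[OF is_game_bang[OF is_game_fun q]] bang_snoc[OF is_game_fun] by blast
qed

lemma hash_snoc_Inr:
  "t @ [Inr z] \<in> hash_plays n \<longleftrightarrow> t \<in> hash_plays n \<and> rights t @ [z] \<in> plays (Str_game p) n \<and>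
    z \<in> (if even (length t) then {Ask} else range Ans)"
  using lolli_snoc_Inr[OF is_game_Str, of t z "bang q fun_game" p n] by (simp add: Str_game_moves)

text \<open>After a move of the player in copy \<open>k\<close> the opponent may always answer in
  the same copy: the parity of the argument part is right, and the copy is already open.\<close>

lemma hash_local_reply:
  assumes "t @ [Inl (k, x)] \<in> hash_plays n" "odd (length t)"
    and "copy k (lefts t) @ [x, y] \<in> plays fun_game n" "y \<in> pmoves fun_game"
  shows "t @ [Inl (k, x), Inl (k, y)] \<in> hash_plays n"
proof -
  have "x \<in> omoves fun_game" using assms(1,2) unfolding hash_snoc_Inl by simp
  moreover have "omoves fun_game \<inter> pmoves fun_game = {}" using is_game_fun unfolding is_game_def by blast
  ultimately have "even (length (lefts t))" using assms(1) unfolding hash_snoc_Inl by (auto split: if_splits)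
  moreover have "lefts t @ [(k, x)] \<in> plays (bang q fun_game) n"
    using assms(1) unfolding lolli_snoc_Inl[OF is_game_bang[OF is_game_fun q]] by blast
  moreover from bang_snoc_used[OF is_game_fun this, of k]
  have "k < q n" "k = 0 \<or> k - 1 \<in> fst ` set (lefts t @ [(k, x)])" by simp_all
  ultimately have "(t @ [Inl (k, x)]) @ [Inl (k, y)] \<in> hash_plays n"
    unfolding hash_snoc_Inl[of "t @ [Inl (k, x)]"] using assms by simp
  then show ?thesis by simp
qed

lemma hash_prefix: "t @ t' \<in> hash_plays n \<Longrightarrow> t \<in> hash_plays n"
  by (rule play_append[OF is_game_hash])

lemma hash_prefix1: "t @ [x, y] \<in> hash_plays n \<Longrightarrow> t @ [x] \<in> hash_plays n"
  using hash_prefix[of "t @ [x]" "[y]"] by simp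

lemma fun_plays_ask: "t \<in> fun_plays n \<phi> \<Longrightarrow> t @ [Inr Ask] \<in> plays fun_game n \<Longrightarrow> t = []"
  by (auto simp: fun_plays_def fun_play3 fun_play5)

lemma fun_plays_arg:
  "t \<in> fun_plays n \<phi> \<Longrightarrow> t @ [Inl (Ans w)] \<in> plays fun_game n \<Longrightarrow> t = [Inr Ask, Inl Ask] \<and> length w = n"
  by (auto simp: fun_plays_def fun_play1 fun_play3 fun_play5)

text \<open>Legality prevents a copy from being asked twice or from receiving two arguments, so each
  copy passes through the plays of \<phi>.\<close>

lemma run_shape:
  assumes "run \<phi> t" "t \<in> hash_plays n"
  shows "rights t = [Ask] \<and> (\<forall>k. copy k (lefts t) \<in> fun_plays n \<phi>)"
  using assms
proof induction
  case run_start
  then show ?case by (simp add: fun_plays_def)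
next
  case (run_ask t k)
  then have IH: "rights t = [Ask]" "\<And>k. copy k (lefts t) \<in> fun_plays n \<phi>" using hash_prefix by blast+
  have "copy k (lefts t) @ [Inr Ask] \<in> plays fun_game n"
    using hash_prefix1[OF run_ask.prems] unfolding hash_snoc_Inl by blast
  with IH(2) have "copy k (lefts t) = []" by (rule fun_plays_ask)
  with IH show ?case by (auto simp: fun_plays_def)
next
  case (run_arg t k w)
  then have IH: "rights t = [Ask]" "\<And>k. copy k (lefts t) \<in> fun_plays n \<phi>" using hash_prefix by blast+
  have "copy k (lefts t) @ [Inl (Ans w)] \<in> plays fun_game n"
    using hash_prefix1[OF run_arg.prems] unfolding hash_snoc_Inl by blast
  with IH(2) have "copy k (lefts t) = [Inr Ask, Inl Ask] \<and> length w = n" by (rule fun_plays_arg)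
  with IH show ?case by (auto simp: fun_plays_def bits_def)
qed

lemma run_next:
  assumes "run \<phi> t" "t @ [x] \<in> hash_plays n"
  obtains (ask) k where "x = Inl (k, Inr Ask)" "copy k (lefts t) = []"
    | (arg) k w where "x = Inl (k, Inl (Ans w))" "copy k (lefts t) = [Inr Ask, Inl Ask]" "length w = n"
    | (out) z where "x = Inr (Ans z)"
proof (cases x)
  case (Inr z)
  with assms run_nth[OF assms(1)] have "z \<in> range Ans" by (simp add: hash_snoc_Inr)
  with Inr out show thesis by auto
next
  case (Inl y)
  obtain k m where y: "y = (k, m)" by fastforce
  have m: "m \<in> omoves fun_game" "copy k (lefts t) @ [m] \<in> plays fun_game n"
    using assms(2) run_nth[OF assms(1)] unfolding Inl y hash_snoc_Inl by simp_all
  have c: "copy k (lefts t) \<in> fun_plays n \<phi>"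
    using run_shape[OF assms(1) hash_prefix[OF assms(2)]] by blast
  from m(1) consider "m = Inr Ask" | w where "m = Inl (Ans w)"
    unfolding fun_game_omoves by auto
  then show thesis
  proof cases
    case 1
    with fun_plays_ask[OF c] m(2) ask Inl y show thesis by blast
  next
    case 2
    with fun_plays_arg[OF c, of w] m(2) arg Inl y show thesis by blast
  qed
qed

lemma run_reply:
  assumes "run \<phi> t"
  shows "t @ [Inl (k, Inr Ask)] \<in> hash_plays n \<Longrightarrow> t @ [Inl (k, Inr Ask), Inl (k, Inl Ask)] \<in> hash_plays n"
    and "t @ [Inl (k, Inl (Ans w))] \<in> hash_plays n \<Longrightarrow>
      t @ [Inl (k, Inl (Ans w)), Inl (k, Inr (Ans b))] \<in> hash_plays n"
proof -
  have odd: "odd (length t)" using run_nth[OF assms] by blast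
  show "t @ [Inl (k, Inr Ask), Inl (k, Inl Ask)] \<in> hash_plays n" if *: "t @ [Inl (k, Inr Ask)] \<in> hash_plays n"
    using assms * by (rule run_next)
      (use * odd in \<open>auto intro!: hash_local_reply simp: fun_play2 fun_game_pmoves\<close>)
  show "t @ [Inl (k, Inl (Ans w)), Inl (k, Inr (Ans b))] \<in> hash_plays n"
    if *: "t @ [Inl (k, Inl (Ans w))] \<in> hash_plays n"
    using assms * by (rule run_next)
      (use * odd in \<open>auto intro!: hash_local_reply simp: fun_play4 fun_game_pmoves\<close>)
qed

lemma fun_plays_even: "t \<in> fun_plays n \<phi> \<Longrightarrow> even (length t)"
  by (auto simp: fun_plays_def)

text \<open>All argument copies have even length at this point, where the opponent of the hash game
  has no move in them, and the string game is over.\<close>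

lemma run_output_final:
  assumes "run \<phi> t"
  shows "t @ [Inr (Ans z), x] \<notin> hash_plays n"
proof
  assume *: "t @ [Inr (Ans z), x] \<in> hash_plays n"
  then have **: "(t @ [Inr (Ans z)]) @ [x] \<in> hash_plays n" by simp
  have t: "rights t = [Ask]" "\<And>k. copy k (lefts t) \<in> fun_plays n \<phi>"
    using run_shape[OF assms hash_prefix[OF *]] by blast+
  show False
  proof (cases x)
    case (Inr y)
    then show False using ** t by (simp add: hash_snoc_Inr Str_play3 del: append_assoc)
  next
    case (Inl y)
    obtain k m where y: "y = (k, m)" by fastforce
    have m: "m \<in> pmoves fun_game" "copy k (lefts t) @ [m] \<in> plays fun_game n"
      using ** run_nth[OF assms] unfolding Inl y hash_snoc_Inl by simp_all
    with move_parity(2)[OF is_game_fun m(2)] fun_plays_even[OF t(2)[of k]] show False by simp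
  qed
qed

text \<open>Each of the \<open>q n\<close> copies receives at most one string, so the queries are
  the image of a function on the indices of the copies.\<close>

lemma run_queried_card:
  assumes "run \<phi> t" "t \<in> hash_plays n"
  shows "finite (queried t) \<and> card (queried t) \<le> q n \<and> queried t \<subseteq> bits n"
proof -
  have c: "copy k (lefts t) \<in> fun_plays n \<phi>" for k using run_shape[OF assms] by blast
  have mem: "Inl (Ans w) \<in> set (copy k (lefts t)) \<longleftrightarrow> Inl (k, Inl (Ans w)) \<in> set t" for k w
    by (simp add: set_copy set_lefts)
  have uniq: "w = w'" if "Inl (k, Inl (Ans w)) \<in> set t" "Inl (k, Inl (Ans w')) \<in> set t" for k w w'
    using that c[of k] unfolding mem[symmetric] by (auto simp: fun_plays_def)
  have len: "w \<in> bits n" if "Inl (k, Inl (Ans w)) \<in> set t" for k w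
    using that c[of k] unfolding mem[symmetric] by (auto simp: fun_plays_def)
  have less: "k < q n" if "Inl (k, Inl (Ans w)) \<in> set t" for k w
  proof -
    have "lefts t \<in> plays (bang q fun_game) n" using assms(2) by (simp add: lolli_plays)
    moreover have "(k, Inl (Ans w)) \<in> set (lefts t)" using that by (simp add: set_lefts)
    ultimately show ?thesis unfolding bang_plays by fastforce
  qed
  have sub: "queried t \<subseteq> (\<lambda>k. THE w. Inl (k, Inl (Ans w)) \<in> set t) ` {..<q n}"
  proof
    fix w assume "w \<in> queried t"
    then obtain k where k: "Inl (k, Inl (Ans w)) \<in> set t" unfolding queried_def by blast
    then have "(THE w. Inl (k, Inl (Ans w)) \<in> set t) = w" using uniq by blast
    with less[OF k] show "w \<in> (\<lambda>k. THE w. Inl (k, Inl (Ans w)) \<in> set t) ` {..<q n}" by force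
  qed
  then have "finite (queried t)" by (rule finite_subset) simp
  moreover have "card (queried t) \<le> q n" using surj_card_le[OF _ sub] by simp
  moreover have "queried t \<subseteq> bits n" using len unfolding queried_def by blast
  ultimately show ?thesis by blast
qed

text \<open>Against the opponent who lets every copy of the argument follow \<open>\<phi>\<close>, the opponent's moves are
  forced: by parity, the only copy in which it can move is the one just entered by the player.\<close>

lemma interaction_run:
  assumes u: "u \<in> hash_plays n" and even: "even (length u)"
    and copies: "\<And>k. copy k (lefts u) \<in> fun_plays n \<phi>" and out: "rights u = [Ask, Ans z]"
  shows "\<exists>h. run \<phi> h \<and> u = h @ [Inr (Ans z)]"
proof -
  have pre: "\<exists>v. copy k (lefts u) = copy k (lefts t) @ v" if "take i u = t" for t k i
    using append_take_drop_id[of i u] that by (metis copy_append lefts_append)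
  \<comment> \<open>The prefixes of odd length are those after a move of the opponent, so the
    induction consumes one move of the player and the reply to it.\<close>
  have "run \<phi> (take (2 * j + 1) u)" if "2 * j + 1 < length u" for j
    using that
  proof (induction j)
    case 0
    then obtain x where x: "take 1 u = [x]" by (cases u) auto
    then have "u = [x] @ drop 1 u" by (metis append_take_drop_id)
    with u have play: "[] @ [x] \<in> hash_plays n" using hash_prefix[of "[x]" "drop 1 u"] by simp
    have "x = Inr Ask"
    proof (cases x)
      case (Inl y)
      obtain k m where "y = (k, m)" by fastforce
      with play Inl have "m \<in> omoves fun_game" "m \<in> pmoves fun_game"
        unfolding Inl \<open>y = _\<close> hash_snoc_Inl by simp_all
      then show ?thesis using is_game_fun unfolding is_game_def by blast
    next
      case (Inr y)
      with play show ?thesis unfolding Inr hash_snoc_Inr by simp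
    qed
    with x show ?case by (simp add: run_start)
  next
    case (Suc j)
    define t where "t = take (2 * j + 1) u"
    define a where "a = u ! (2 * j + 1)"
    define b where "b = u ! (2 * j + 2)"
    have run: "run \<phi> t" using Suc unfolding t_def by simp
    have split: "take (2 * Suc j + 1) u = t @ [a, b]"
      using Suc.prems unfolding t_def a_def b_def by (simp add: take_Suc_conv_app_nth)
    then have "u = (t @ [a, b]) @ drop (2 * Suc j + 1) u" by (metis append_take_drop_id)
    with u have play: "t @ [a, b] \<in> hash_plays n" by (metis hash_prefix)
    then have play': "(t @ [a]) @ [b] \<in> hash_plays n" by simp
    have t: "rights t = [Ask]" "\<And>k. copy k (lefts t) \<in> fun_plays n \<phi>" "odd (length t)"
      using run_shape[OF run hash_prefix[OF play]] run_nth[OF run] by blast+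
    \<comment> \<open>Before \<open>a\<close> all copies have even length, and the opponent needs
      odd length to move in one of them. Only the copy touched by \<open>a\<close>
      qualifies.\<close>
    have b_copy: "\<exists>m. b = Inl (k, m) \<and> copy k (lefts t) @ [x, m] \<in> plays fun_game n \<and>
        (\<exists>v. copy k (lefts u) = copy k (lefts t) @ [x, m] @ v)" if "a = Inl (k, x)" for k x
    proof (cases b)
      case (Inr y)
      from play' show ?thesis unfolding Inr hash_snoc_Inr using t that by (auto simp: Str_play2)
    next
      case (Inl y)
      obtain k' m where y: "y = (k', m)" by fastforce
      have m: "m \<in> pmoves fun_game" "copy k' (lefts (t @ [a])) @ [m] \<in> plays fun_game n"
        using play' t(3) unfolding Inl y hash_snoc_Inl by simp_all
      have "k' = k"
        using move_parity(2)[OF is_game_fun m(2)] m(1) that fun_plays_even[OF t(2)[of k']]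
        by (auto split: if_splits)
      with m(2) pre[OF split, of k] Inl y that show ?thesis by auto
    qed
    have "run \<phi> (t @ [a, b])"
      using run hash_prefix1[OF play]
    proof (rule run_next)
      fix k assume a: "a = Inl (k, Inr Ask)" and c: "copy k (lefts t) = []"
      obtain m v where m: "b = Inl (k, m)" "copy k (lefts u) = [Inr Ask, m] @ v"
        using b_copy[OF a] c by auto
      then have "m = Inl Ask" using copies[of k] by (auto simp: fun_plays_def)
      with a m run show ?thesis by (simp add: run_ask)
    next
      fix k w assume a: "a = Inl (k, Inl (Ans w))" and c: "copy k (lefts t) = [Inr Ask, Inl Ask]"
      obtain m v where m: "b = Inl (k, m)" "copy k (lefts u) = [Inr Ask, Inl Ask, Inl (Ans w), m] @ v"
        using b_copy[OF a] c by auto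
      then have "m = Inr (Ans (\<phi> w))" using copies[of k] by (auto simp: fun_plays_def)
      with a m run show ?thesis by (simp add: run_arg)
    next
      fix z' assume "a = Inr (Ans z')"
      with play run_output_final[OF run] show ?thesis by blast
    qed
    then show ?case unfolding split .
  qed
  moreover have "u \<noteq> []" using out by auto
  ultimately have run: "run \<phi> (butlast u)"
  proof -
    obtain j where j: "length u = 2 * j" using even by (auto elim: evenE)
    with \<open>u \<noteq> []\<close> obtain i where "j = Suc i" by (cases j) auto
    with j \<open>\<And>j. 2 * j + 1 < length u \<Longrightarrow> run \<phi> (take (2 * j + 1) u)\<close>[of i] show ?thesis
      by (simp add: butlast_conv_take)
  qed
  have u': "u = butlast u @ [last u]" using \<open>u \<noteq> []\<close> by simp
  have cp: "copy k (lefts u) = copy k (lefts (butlast u)) @ copy k (lefts [last u])" for k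
    by (metis u' copy_append lefts_append)
  have play: "butlast u @ [last u] \<in> hash_plays n" using u u' by simp
  have shape: "rights (butlast u) = [Ask]" "\<And>k. copy k (lefts (butlast u)) \<in> fun_plays n \<phi>"
    using run_shape[OF run hash_prefix[OF play]] by blast+
  \<comment> \<open>The copies have even length both before and after the last move, so it is made
    in none of them.\<close>
  have not_Inl: "last u \<noteq> Inl (k, m)" for k m
  proof
    assume "last u = Inl (k, m)"
    with cp[of k] have "length (copy k (lefts u)) = Suc (length (copy k (lefts (butlast u))))" by simp
    with fun_plays_even[OF copies[of k]] fun_plays_even[OF shape(2)[of k]] show False by simp
  qed
  from run_next[OF run play] not_Inl obtain z' where z': "last u = Inr (Ans z')" by metis
  have "rights u = rights (butlast u) @ [Ans z']"
    by (subst u') (simp add: z')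
  with shape(1) have "z' = z" using out by simp
  with run u' z' show ?thesis by metis
qed

end

section \<open>The reachable plays\<close>

lemma run_not_snoc: "run \<phi> h \<Longrightarrow> run \<psi> h' \<Longrightarrow> h \<noteq> h' @ [x]"
  using run_nth[of \<phi> h] run_nth[of \<psi> h'] by auto

lemma next_move_snoc: "next_move (u @ [x]) = reply (memory u) x"
  by (simp add: next_move_def)

lemma memory_simps [simp]: "memory [] = (False, False, [], False)" "memory (u @ [x, y]) = notice (notice (memory u) x) y"
  by (simp_all add: memory_def)

abbreviation zero :: "bool list \<Rightarrow> bool" where "zero \<equiv> \<lambda>_. False"

text \<open>The index \<open>j\<close> is left open because either copy may have served the
  component. For \<open>n = 0\<close> the answer is not derived from a run.\<close>

definition settled :: "nat \<Rightarrow> (nat \<times> hash_move) list \<Rightarrow> bool \<Rightarrow> fun_move list \<Rightarrow> bool" where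
  "settled n l d t \<longleftrightarrow> (\<exists>w b. t = [Inr Ask, Inl Ask, Inl (Ans w), Inr (Ans b)] \<and> length w = n \<and>
     (n = 0 \<or> (\<exists>j h z. copy j l = h @ [Inr (Ans z)] \<and> run zero h \<and> b = answer d w (w \<in> queried h))))"

definition completed :: "hash_move list \<Rightarrow> bool" where
  "completed t \<longleftrightarrow> (\<exists>h z. t = h @ [Inr (Ans z)] \<and> run zero h)"

text \<open>For positive \<open>n\<close> every argument received opens one copy of
  \<open>F\<close>, so the cardinality of this set is the number of copies opened.\<close>

definition args :: "coll_move list \<Rightarrow> bool set" where
  "args u = {d. 2 < length (part d (rights u))}"

locale collider = hash +
  fixes s :: "nat \<Rightarrow> nat"
  assumes s: "poly_bounded s" and s_ge: "0 < n \<Longrightarrow> 2 \<le> s n"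
begin

abbreviation coll_plays :: "nat \<Rightarrow> coll_move list set" where
  "coll_plays \<equiv> plays (bang s (hash_game q p) \<multimap> fun_game \<otimes> fun_game)"

text \<open>The opponent is arbitrary here; in particular the copies of \<open>F\<close> need not
  agree with each other.\<close>

inductive_set reach :: "nat \<Rightarrow> coll_move list set" for n where
  reach_Nil: "[] \<in> reach n"
| reach_step: "u \<in> reach n \<Longrightarrow> u @ [x] \<in> coll_plays n \<Longrightarrow> u @ [x, next_move (u @ [x])] \<in> reach n"

text \<open>\<open>R\<close> says that a run of \<open>F\<close> is in progress; it takes place in the last copy opened.\<close>

definition inv :: "nat \<Rightarrow> coll_move list \<Rightarrow> bool \<Rightarrow> bool \<Rightarrow> bool \<Rightarrow> bool list \<Rightarrow> bool \<Rightarrow> bool" where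
  "inv n u R st c w fd \<longleftrightarrow> memory u = (st, c, w, fd) \<and> u \<in> coll_plays n \<and> even (length u) \<and>
     (\<forall>d. part d (rights u) = [] \<or> part d (rights u) = [Inr Ask, Inl Ask] \<or>
        settled n (lefts u) d (part d (rights u)) \<or> (R \<and> d = c)) \<and>
     (R \<longrightarrow> part c (rights u) = [Inr Ask, Inl Ask, Inl (Ans w)] \<and> length w = n \<and> 0 < n) \<and>
     (if n = 0 then lefts u = [] else (st \<longleftrightarrow> args u \<noteq> {}) \<and>
        (\<forall>j. if R \<and> Suc j = card (args u) then run zero (copy j (lefts u)) \<and> (fd \<longleftrightarrow> w \<in> queried (copy j (lefts u)))
             else if j < card (args u) then completed (copy j (lefts u)) else copy j (lefts u) = []))"

lemma invD:
  assumes "inv n u R st c w fd"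
  shows "memory u = (st, c, w, fd)" "u \<in> coll_plays n" "even (length u)"
    and "\<not> (R \<and> d = c) \<Longrightarrow> part d (rights u) = [] \<or> part d (rights u) = [Inr Ask, Inl Ask] \<or>
      settled n (lefts u) d (part d (rights u))"
    and "R \<Longrightarrow> part c (rights u) = [Inr Ask, Inl Ask, Inl (Ans w)]" "R \<Longrightarrow> length w = n" "R \<Longrightarrow> n \<noteq> 0"
    and "n = 0 \<Longrightarrow> lefts u = []" "n \<noteq> 0 \<Longrightarrow> st \<longleftrightarrow> args u \<noteq> {}"
    and "n \<noteq> 0 \<Longrightarrow> R \<Longrightarrow> Suc j = card (args u) \<Longrightarrow> run zero (copy j (lefts u))"
    and "n \<noteq> 0 \<Longrightarrow> R \<Longrightarrow> Suc j = card (args u) \<Longrightarrow> fd \<longleftrightarrow> w \<in> queried (copy j (lefts u))"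
    and "n \<noteq> 0 \<Longrightarrow> \<not> (R \<and> Suc j = card (args u)) \<Longrightarrow>
      if j < card (args u) then completed (copy j (lefts u)) else copy j (lefts u) = []"
proof -
  note a = assms[unfolded inv_def]
  show "memory u = (st, c, w, fd)" "u \<in> coll_plays n" "even (length u)"
    using a by simp_all
  show "\<not> (R \<and> d = c) \<Longrightarrow> part d (rights u) = [] \<or> part d (rights u) = [Inr Ask, Inl Ask] \<or>
      settled n (lefts u) d (part d (rights u))"
    using a by blast
  show "R \<Longrightarrow> part c (rights u) = [Inr Ask, Inl Ask, Inl (Ans w)]" "R \<Longrightarrow> length w = n" "R \<Longrightarrow> n \<noteq> 0"
    using a by simp_all
  show "n = 0 \<Longrightarrow> lefts u = []" "n \<noteq> 0 \<Longrightarrow> st \<longleftrightarrow> args u \<noteq> {}"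
    using a by presburger+
  have b: "n \<noteq> 0 \<Longrightarrow> if R \<and> Suc j = card (args u) then run zero (copy j (lefts u)) \<and> (fd \<longleftrightarrow> w \<in> queried (copy j (lefts u)))
             else if j < card (args u) then completed (copy j (lefts u)) else copy j (lefts u) = []"
    using a by presburger
  show "n \<noteq> 0 \<Longrightarrow> R \<Longrightarrow> Suc j = card (args u) \<Longrightarrow> run zero (copy j (lefts u))"
    and "n \<noteq> 0 \<Longrightarrow> R \<Longrightarrow> Suc j = card (args u) \<Longrightarrow> fd \<longleftrightarrow> w \<in> queried (copy j (lefts u))"
    and "n \<noteq> 0 \<Longrightarrow> \<not> (R \<and> Suc j = card (args u)) \<Longrightarrow>
      if j < card (args u) then completed (copy j (lefts u)) else copy j (lefts u) = []"
    using b by (auto split: if_splits)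
qed

lemma invI:
  assumes "memory u = (st, c, w, fd)" "u \<in> coll_plays n" "even (length u)"
    and "\<And>d. \<not> (R \<and> d = c) \<Longrightarrow> part d (rights u) = [] \<or> part d (rights u) = [Inr Ask, Inl Ask] \<or>
      settled n (lefts u) d (part d (rights u))"
    and "R \<Longrightarrow> part c (rights u) = [Inr Ask, Inl Ask, Inl (Ans w)] \<and> length w = n \<and> n \<noteq> 0"
    and "n = 0 \<Longrightarrow> lefts u = []" "n \<noteq> 0 \<Longrightarrow> st \<longleftrightarrow> args u \<noteq> {}"
    and "\<And>j. n \<noteq> 0 \<Longrightarrow> R \<Longrightarrow> Suc j = card (args u) \<Longrightarrow>
      run zero (copy j (lefts u)) \<and> (fd \<longleftrightarrow> w \<in> queried (copy j (lefts u)))"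
    and "\<And>j. n \<noteq> 0 \<Longrightarrow> \<not> (R \<and> Suc j = card (args u)) \<Longrightarrow>
      if j < card (args u) then completed (copy j (lefts u)) else copy j (lefts u) = []"
  shows "inv n u R st c w fd"
proof -
  have "if n = 0 then lefts u = [] else (st \<longleftrightarrow> args u \<noteq> {}) \<and>
        (\<forall>j. if R \<and> Suc j = card (args u) then run zero (copy j (lefts u)) \<and> (fd \<longleftrightarrow> w \<in> queried (copy j (lefts u)))
             else if j < card (args u) then completed (copy j (lefts u)) else copy j (lefts u) = [])"
    using assms(6-9) by presburger
  moreover have "\<forall>d. part d (rights u) = [] \<or> part d (rights u) = [Inr Ask, Inl Ask] \<or>
        settled n (lefts u) d (part d (rights u)) \<or> (R \<and> d = c)"
    using assms(4) by blast
  ultimately show ?thesis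
    unfolding inv_def using assms(1-3,5) by blast
qed

section \<open>Legal moves in the game of the collision finder\<close>

lemma is_game_coll_left: "is_game (bang s (hash_game q p))"
  by (intro is_game_bang is_game_hash s)

lemma is_game_pair: "is_game (fun_game \<otimes> fun_game)"
  by (intro is_game_tensor is_game_fun)

lemma coll_snoc_Inl:
  "u @ [Inl (i, m)] \<in> coll_plays n \<longleftrightarrow> u \<in> coll_plays n \<and> copy i (lefts u) @ [m] \<in> hash_plays n \<and>
    lefts u \<in> plays (bang s (hash_game q p)) n \<and>
    i < s n \<and> (i = 0 \<or> i - 1 \<in> fst ` set (lefts u)) \<and>
    m \<in> (if even (length (lefts u)) then omoves (hash_game q p) else pmoves (hash_game q p)) \<and>
    m \<in> (if even (length u) then pmoves (hash_game q p) else omoves (hash_game q p))"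
proof -
  have "(i, m) \<in> (if even (length u) then pmoves (bang s (hash_game q p)) else omoves (bang s (hash_game q p))) \<longleftrightarrow>
      m \<in> (if even (length u) then pmoves (hash_game q p) else omoves (hash_game q p))"
    by (simp add: bang_moves)
  then show ?thesis
    unfolding lolli_snoc_Inl[OF is_game_coll_left] bang_snoc[OF is_game_hash] by blast
qed

lemma coll_lefts: "u \<in> coll_plays n \<Longrightarrow> lefts u \<in> plays (bang s (hash_game q p)) n"
  unfolding lolli_plays[of u "bang s (hash_game q p)"] by blast

lemma coll_rights: "u \<in> coll_plays n \<Longrightarrow> rights u \<in> plays (fun_game \<otimes> fun_game) n"
  unfolding lolli_plays[of u "bang s (hash_game q p)"] by blast

lemma tensor_moves: "omoves (G \<otimes> H) = omoves G <+> omoves H" "pmoves (G \<otimes> H) = pmoves G <+> pmoves H"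
  by (simp_all add: tensor_def)

lemma coll_snoc_side:
  "u @ [Inr (side d y)] \<in> coll_plays n \<longleftrightarrow> u \<in> coll_plays n \<and> part d (rights u) @ [y] \<in> plays fun_game n \<and>
    rights u \<in> plays (fun_game \<otimes> fun_game) n \<and>
    y \<in> (if even (length (rights u)) then omoves fun_game else pmoves fun_game) \<and>
    y \<in> (if even (length u) then omoves fun_game else pmoves fun_game)"
proof -
  have "side d y \<in> (if even (length u) then omoves (fun_game \<otimes> fun_game) else pmoves (fun_game \<otimes> fun_game)) \<longleftrightarrow>
      y \<in> (if even (length u) then omoves fun_game else pmoves fun_game)"
    by (simp add: tensor_moves side_in_Plus_iff)
  then show ?thesis
    unfolding lolli_snoc_Inr[OF is_game_pair] tensor_snoc[OF is_game_fun] by blast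
qed

lemma hash_disjoint: "x \<in> omoves (hash_game q p) \<Longrightarrow> x \<notin> pmoves (hash_game q p)"
  using is_game_hash unfolding is_game_def by blast

lemma fun_disjoint: "x \<in> omoves fun_game \<Longrightarrow> x \<notin> pmoves fun_game"
  using is_game_fun unfolding is_game_def by blast

lemma hash_moves:
  "Inl (k, y) \<in> omoves (hash_game q p) \<longleftrightarrow> y \<in> pmoves fun_game"
  "Inl (k, y) \<in> pmoves (hash_game q p) \<longleftrightarrow> y \<in> omoves fun_game"
  "Inr z \<in> omoves (hash_game q p) \<longleftrightarrow> z = Ask"
  "Inr z \<in> pmoves (hash_game q p) \<longleftrightarrow> z \<in> range Ans"
  by (auto simp: lolli_moves bang_moves Str_game_moves)

lemma opponent_legal:
  assumes "u @ [x] \<in> coll_plays n" "even (length u)"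
  shows "opponent x"
proof (cases x)
  case (Inl y)
  obtain i m where y: "y = (i, m)" by fastforce
  have m: "m \<in> pmoves (hash_game q p)" using assms unfolding Inl y coll_snoc_Inl by simp
  show ?thesis
  proof (cases m)
    case (Inl a)
    obtain k b where "a = (k, b)" by fastforce
    with m Inl have "b \<in> omoves fun_game" by (simp add: hash_moves)
    then show ?thesis
      unfolding fun_game_omoves \<open>x = _\<close> y Inl \<open>a = _\<close> opponent_def by auto
  next
    case (Inr z)
    with m have "z \<in> range Ans" by (simp add: hash_moves)
    then show ?thesis
      unfolding \<open>x = _\<close> y Inr opponent_def by auto
  qed
next
  case (Inr y)
  obtain d a where y: "y = side d a"
    using that[of False] that[of True] by (cases y) (auto simp: side_def)
  have "a \<in> omoves fun_game" using assms unfolding Inr y coll_snoc_side by simp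
  then show ?thesis
    unfolding fun_game_omoves Inr y opponent_def by auto
qed

lemma coll_left_reply:
  assumes "u @ [Inl (i, m)] \<in> coll_plays n" "even (length u)"
    and "copy i (lefts u) @ [m, m'] \<in> hash_plays n" "m' \<in> omoves (hash_game q p)"
  shows "u @ [Inl (i, m), Inl (i, m')] \<in> coll_plays n"
proof -
  have "m \<in> pmoves (hash_game q p)" using assms(1,2) unfolding coll_snoc_Inl by simp
  then have "odd (length (lefts u))"
    using assms(1) hash_disjoint unfolding coll_snoc_Inl by (auto split: if_splits)
  moreover have "lefts u @ [(i, m)] \<in> plays (bang s (hash_game q p)) n"
    using assms(1) unfolding lolli_snoc_Inl[OF is_game_coll_left] by blast
  moreover from bang_snoc_used[OF is_game_hash this, of i]
  have "i < s n" "i = 0 \<or> i - 1 \<in> fst ` set (lefts u @ [(i, m)])" by simp_all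
  ultimately have "(u @ [Inl (i, m)]) @ [Inl (i, m')] \<in> coll_plays n"
    unfolding coll_snoc_Inl[of "u @ [Inl (i, m)]"] using assms by simp
  then show ?thesis by simp
qed

lemma settled_length: "settled n l d t \<Longrightarrow> length t = 4"
  by (auto simp: settled_def)

text \<open>An answer refers only to a completed copy, and completed copies are never played in
  again.\<close>

lemma settled_mono:
  assumes "settled n l d t" "\<And>j. completed (copy j l) \<Longrightarrow> copy j l' = copy j l"
  shows "settled n l' d t"
proof -
  obtain w b where t: "t = [Inr Ask, Inl Ask, Inl (Ans w), Inr (Ans b)]" "length w = n"
    "n = 0 \<or> (\<exists>j h z. copy j l = h @ [Inr (Ans z)] \<and> run zero h \<and> b = answer d w (w \<in> queried h))"
    using assms(1) unfolding settled_def by (elim exE conjE) (rule that)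
  have "\<exists>j h z. copy j l' = h @ [Inr (Ans z)] \<and> run zero h \<and> b = answer d w (w \<in> queried h)" if "n \<noteq> 0"
  proof -
    from t(3) that obtain j h z
      where j: "copy j l = h @ [Inr (Ans z)]" "run zero h" "b = answer d w (w \<in> queried h)" by blast
    then have "copy j l' = copy j l" by (intro assms(2)) (auto simp: completed_def)
    with j show ?thesis by (intro exI[of _ j] exI[of _ h] exI[of _ z]) simp
  qed
  then show ?thesis
    unfolding settled_def by (intro exI[of _ w] exI[of _ b] conjI t(1,2)) blast
qed

text \<open>This decides where the opponent can move: during a run only in the copies of
  \<open>F\<close>, between runs only in the two components.\<close>

lemma inv_parity:
  assumes "inv n u R st c w fd"
  shows "odd (length (rights u)) \<longleftrightarrow> R" "odd (length (lefts u)) \<longleftrightarrow> R"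
proof -
  have "odd (length (part d (rights u))) \<longleftrightarrow> R \<and> d = c" for d
  proof (cases "R \<and> d = c")
    case True
    with invD(5)[OF assms] show ?thesis by simp
  next
    case False
    from invD(4)[OF assms False] settled_length[of n "lefts u" d "part d (rights u)"] False show ?thesis
      by (elim disjE) simp_all
  qed
  then show 1: "odd (length (rights u)) \<longleftrightarrow> R"
    using length_part[of "rights u"] by (cases c) auto
  have "even (length u)" using assms by (rule invD)
  with 1 show "odd (length (lefts u)) \<longleftrightarrow> R"
    using length_lefts_rights[of u] by auto
qed

lemma completed_even: "completed t \<Longrightarrow> even (length t)"
  using run_nth unfolding completed_def by force

lemma run_not_completed: "run \<phi> h \<Longrightarrow> \<not> completed h"
  using run_not_snoc unfolding completed_def by blast

text \<open>The opponent can move only in a copy of odd length. Completed and unopened copies have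
  even length, so the move falls into the running copy and prolongs or ends its run.\<close>

lemma inv_left:
  assumes I: "inv n u R st c w fd" and x: "u @ [Inl (i, m)] \<in> coll_plays n"
  shows "\<exists>R' st' c' w' fd'. inv n (u @ [Inl (i, m), next_move (u @ [Inl (i, m)])]) R' st' c' w' fd'"
proof -
  let ?u = "u @ [Inl (i, m), next_move (u @ [Inl (i, m)])]"
  note ev = invD(3)[OF I] and mem = invD(1)[OF I]
  have m: "m \<in> pmoves (hash_game q p)" and play: "copy i (lefts u) @ [m] \<in> hash_plays n"
    using x ev unfolding coll_snoc_Inl by simp_all
  have odd: "odd (length (copy i (lefts u)))"
    using move_parity(2)[OF is_game_hash play] m by blast
  then have n: "n \<noteq> 0" using invD(8)[OF I] by fastforce
  have "R \<and> Suc i = card (args u)"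
  proof (rule ccontr)
    assume "\<not> ?thesis"
    from invD(12)[OF I n this] odd completed_even[of "copy i (lefts u)"] show False
      by (simp split: if_splits)
  qed
  then have i: "R" "Suc i = card (args u)" by blast+
  note R = i(1) invD(5,6)[OF I i(1)] invD(9)[OF I n]
  note run = invD(10)[OF I n i] and fd = invD(11)[OF I n i]
  have others: "if j < card (args u) then completed (copy j (lefts u)) else copy j (lefts u) = []" if "j \<noteq> i" for j
    using invD(12)[OF I n] that i by simp
  have stage: "part d (rights u) = [] \<or> part d (rights u) = [Inr Ask, Inl Ask] \<or>
      settled n (lefts u) d (part d (rights u))" if "d \<noteq> c" for d
    using invD(4)[OF I] that by blast
  \<comment> \<open>This treats asking and querying together, the two kinds of moves after which the
    run goes on in the same copy.\<close>
  have inner: "inv n ?u R st c w fd'"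
    if next_move: "next_move (u @ [Inl (i, m)]) = Inl (i, m')" and "m' \<in> omoves (hash_game q p)"
      and "copy i (lefts u) @ [m, m'] \<in> hash_plays n"
      and run': "run zero (copy i (lefts u) @ [m, m'])"
      and mem': "memory ?u = (st, c, w, fd')" and fd': "fd' \<longleftrightarrow> w \<in> queried (copy i (lefts u) @ [m, m'])" for m' fd'
  proof -
    have u: "lefts ?u = lefts u @ [(i, m), (i, m')]" "rights ?u = rights u" by (simp_all add: next_move)
    have settled: "settled n (lefts ?u) d t" if "settled n (lefts u) d t" for d t
      using that by (rule settled_mono) (use run run_not_completed in \<open>auto simp: next_move\<close>)
    have args: "args ?u = args u" by (simp add: args_def next_move)
    have copy: "copy j (lefts ?u) = (if j = i then copy i (lefts u) @ [m, m'] else copy j (lefts u))" for j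
      by (simp add: next_move)
    show ?thesis
    proof (rule invI)
      show "?u \<in> coll_plays n"
        unfolding next_move by (rule coll_left_reply[OF x ev that(3,2)])
      show "part d (rights ?u) = [] \<or> part d (rights ?u) = [Inr Ask, Inl Ask] \<or>
          settled n (lefts ?u) d (part d (rights ?u))" if "\<not> (R \<and> d = c)" for d
        using stage[of d] settled[of d] that R(1) unfolding u(2) by blast
      show "run zero (copy j (lefts ?u)) \<and> (fd' \<longleftrightarrow> w \<in> queried (copy j (lefts ?u)))" if "Suc j = card (args ?u)" for j
        using that run' fd' i(2) unfolding args copy by simp
      show "if j < card (args ?u) then completed (copy j (lefts ?u)) else copy j (lefts ?u) = []"
        if "\<not> (R \<and> Suc j = card (args ?u))" for j
        using that others[of j] i unfolding args copy by auto
    qed (use mem' ev R n args u(2) in simp_all)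
  qed
  from run play show ?thesis
  proof (rule run_next)
    fix k assume a: "m = Inl (k, Inr Ask)"
    have "inv n ?u R st c w fd"
      by (rule inner[of "Inl (k, Inl Ask)"])
        (use run_reply(1)[OF run] run.run_ask[OF run] play in
          \<open>simp_all add: next_move_snoc a hash_moves fun_game_pmoves mem fd\<close>)
    then show ?thesis by blast
  next
    fix k w' assume a: "m = Inl (k, Inl (Ans w'))"
    have "inv n ?u R st c w (fd \<or> w = w')"
      by (rule inner[of "Inl (k, Inr (Ans False))"])
        (use run_reply(2)[OF run] run.run_arg[OF run] play in
          \<open>auto simp: next_move_snoc a hash_moves fun_game_pmoves mem fd\<close>)
    then show ?thesis by blast
  next
    fix z assume a: "m = Inr (Ans z)"
    define b where "b = answer c w fd"
    have next_move: "next_move (u @ [Inl (i, m)]) = Inr (side c (Inr (Ans b)))"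
      by (simp add: next_move_snoc a mem b_def)
    have u: "lefts ?u = lefts u @ [(i, m)]" "rights ?u = rights u @ [side c (Inr (Ans b))]"
      by (simp_all add: next_move)
    have "(u @ [Inl (i, m)]) @ [Inr (side c (Inr (Ans b)))] \<in> coll_plays n"
      unfolding coll_snoc_side[of "u @ [Inl (i, m)]"] using x ev inv_parity(1)[OF I] R
        coll_rights[OF invD(2)[OF I]] by (simp add: fun_play4 fun_game_pmoves)
    then have legal: "?u \<in> coll_plays n" by (simp add: next_move)
    have settled: "settled n (lefts ?u) d t" if "settled n (lefts u) d t" for d t
      using that by (rule settled_mono) (use run run_not_completed in \<open>auto simp: next_move\<close>)
    have settled_c: "settled n (lefts ?u) c (part c (rights ?u))"
      unfolding settled_def
      by (rule exI[of _ w], rule exI[of _ b], intro conjI disjI2 exI[of _ i] exI[of _ "copy i (lefts u)"] exI[of _ z])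
        (use R run in \<open>simp_all add: next_move[unfolded a] a b_def fd\<close>)
    have completed: "completed (copy i (lefts ?u))"
      using run unfolding completed_def by (auto simp: next_move[unfolded a] a)
    \<comment> \<open>In component \<open>c\<close> the length grows from \<open>3\<close> to
      \<open>4\<close>, so its argument was already counted.\<close>
    have "2 < length (part d (rights ?u)) \<longleftrightarrow> 2 < length (part d (rights u))" for d
      using R(2) by (cases "d = c") (simp_all add: next_move)
    then have args: "args ?u = args u" by (simp add: args_def)
    have part: "part d (rights ?u) = part d (rights u)" if "d \<noteq> c" for d
      using that by (simp add: next_move)
    have copy: "copy j (lefts ?u) = copy j (lefts u)" if "j \<noteq> i" for j
      using that by (simp add: next_move)
    have "inv n ?u False st c w fd"
    proof (rule invI)
      show "memory ?u = (st, c, w, fd)" by (simp add: next_move[unfolded a] mem a)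
      show "part d (rights ?u) = [] \<or> part d (rights ?u) = [Inr Ask, Inl Ask] \<or>
          settled n (lefts ?u) d (part d (rights ?u))" for d
        using stage[of d] settled[of d] settled_c part[of d] by (cases "d = c") auto
      show "if j < card (args ?u) then completed (copy j (lefts ?u)) else copy j (lefts ?u) = []" for j
        using completed others[of j] copy[of j] i(2) unfolding args by (cases "j = i") auto
    qed (use legal ev R n args in simp_all)
    then show ?thesis by blast
  qed
qed

text \<open>By parity no run is in progress, so each component is untouched, waiting for its
  argument, or finished. The three cases are treated in this order.\<close>

lemma inv_right:
  assumes I: "inv n u R st c w fd" and x: "u @ [Inr (side d y)] \<in> coll_plays n"
  shows "\<exists>R' st' c' w' fd'. inv n (u @ [Inr (side d y), next_move (u @ [Inr (side d y)])]) R' st' c' w' fd'"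
proof -
  let ?u = "u @ [Inr (side d y), next_move (u @ [Inr (side d y)])]"
  note ev = invD(3)[OF I] and mem = invD(1)[OF I]
  have y: "y \<in> omoves fun_game" and play: "part d (rights u) @ [y] \<in> plays fun_game n"
    and right: "rights u @ [side d y] \<in> plays (fun_game \<otimes> fun_game) n"
    using x ev coll_rights[OF x] unfolding coll_snoc_side by simp_all
  have "even (length (rights u))"
    using x y fun_disjoint unfolding coll_snoc_side by (auto split: if_splits)
  then have R: "\<not> R" "even (length (rights u))" "even (length (lefts u))"
    using inv_parity[OF I] by blast+
  have stage: "part d (rights u) = [] \<or> part d (rights u) = [Inr Ask, Inl Ask] \<or>
      settled n (lefts u) d (part d (rights u))" for d
    using invD(4)[OF I] R(1) by blast
  note l0 = invD(8)[OF I] and st = invD(9)[OF I]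
  have cp: "if j < card (args u) then completed (copy j (lefts u)) else copy j (lefts u) = []" if "n \<noteq> 0" for j
    using invD(12)[OF I that] R(1) by blast
  have reply: "(u @ [Inr (side d y)]) @ [Inr (side d y')] \<in> coll_plays n"
    if "part d (rights u) @ [y, y'] \<in> plays fun_game n" "y' \<in> pmoves fun_game" for y'
    unfolding coll_snoc_side[of "u @ [Inr (side d y)]"] using x right ev that R by simp
  from stage[of d] show ?thesis
  proof (elim disjE)
    assume p: "part d (rights u) = []"
    with play have y: "y = Inr Ask" by (simp add: fun_play1)
    have next_move: "next_move (u @ [Inr (side d y)]) = Inr (side d (Inl Ask))"
      by (simp add: next_move_snoc y mem)
    have legal: "?u \<in> coll_plays n"
      using reply[of "Inl Ask"] by (simp add: next_move[unfolded y] p y fun_play2 fun_game_pmoves)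
    have part: "part e (rights ?u) = (if e = d then [Inr Ask, Inl Ask] else part e (rights u))" for e
      by (simp add: next_move[unfolded y] y p)
    have "2 < length (part e (rights ?u)) \<longleftrightarrow> 2 < length (part e (rights u))" for e
      unfolding part by (cases "e = d") (simp_all add: p)
    then have args: "args ?u = args u" by (simp add: args_def)
    have lefts: "lefts ?u = lefts u" by (simp add: next_move)
    have "inv n ?u False st d w fd"
    proof (rule invI)
      show "memory ?u = (st, d, w, fd)" by (simp add: next_move[unfolded y] mem y)
      show "part e (rights ?u) = [] \<or> part e (rights ?u) = [Inr Ask, Inl Ask] \<or>
          settled n (lefts ?u) e (part e (rights ?u))" for e
        using stage[of e] unfolding part lefts by (cases "e = d") simp_all
      show "if j < card (args ?u) then completed (copy j (lefts ?u)) else copy j (lefts ?u) = []" if "n \<noteq> 0" for j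
        using cp[OF that] unfolding args lefts .
    qed (use legal ev l0 st args lefts in simp_all)
    then show ?thesis by blast
  next
    assume p: "part d (rights u) = [Inr Ask, Inl Ask]"
    with play obtain w' where y: "y = Inl (Ans w')" "length w' = n" by (auto simp: fun_play3)
    show ?thesis
    proof (cases "n = 0")
      case True
      then have next_move: "next_move (u @ [Inr (side d y)]) = Inr (side d (Inr (Ans True)))"
        using y by (simp add: next_move_snoc mem)
      have legal: "?u \<in> coll_plays n"
        using reply[of "Inr (Ans True)"] y(2)
        by (auto simp: next_move[unfolded y(1)] p y(1) fun_play4 fun_game_pmoves)
      have settled: "settled n l d [Inr Ask, Inl Ask, Inl (Ans w'), Inr (Ans True)]" for l
        using True y by (auto simp: settled_def)
      have part: "part e (rights ?u) =
          (if e = d then [Inr Ask, Inl Ask, Inl (Ans w'), Inr (Ans True)] else part e (rights u))" for e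
        by (simp add: next_move[unfolded y(1)] y(1) p)
      have lefts: "lefts ?u = lefts u" by (simp add: next_move)
      have "inv n ?u False True d w' False"
      proof (rule invI)
        show "memory ?u = (True, d, w', False)" by (simp add: next_move[unfolded y(1)] mem y)
        show "part e (rights ?u) = [] \<or> part e (rights ?u) = [Inr Ask, Inl Ask] \<or>
            settled n (lefts ?u) e (part e (rights ?u))" for e
          using stage[of e] settled unfolding part lefts by (cases "e = d") simp_all
      qed (use legal ev l0 True lefts in simp_all)
      then show ?thesis by blast
    next
      case False
      define i where "i = (if st then 1 else 0 :: nat)"
      have next_move: "next_move (u @ [Inr (side d y)]) = Inl (i, Inr Ask)"
        using False y by (auto simp: next_move_snoc mem i_def)
      have u: "lefts ?u = lefts u @ [(i, Inr Ask)]" "rights ?u = rights u @ [side d y]"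
        by (simp_all add: next_move)
      note st = st[OF False] and cp = cp[OF False]
      \<comment> \<open>Only the other component can have received an argument before. Hence the
        number of copies opened is \<open>0\<close> or \<open>1\<close> according to
        \<open>st\<close>, and the index chosen by \<open>reply_side\<close> is the first free
        one.\<close>
      have d: "d \<notin> args u" by (simp add: args_def p)
      then have "e = (\<not> d)" if "e \<in> args u" for e using that by (cases "e = d") auto
      then have "args u \<subseteq> {\<not> d}" by blast
      then have "args u = (if st then {\<not> d} else {})" using st by (metis subset_singletonD)
      then have card: "card (args u) = i" by (simp add: i_def)
      have part: "part e (rights ?u) = (if e = d then [Inr Ask, Inl Ask, Inl (Ans w')] else part e (rights u))" for e
        by (simp add: next_move[unfolded y(1)] y(1) p)
      have args': "args ?u = insert d (args u)" unfolding args_def part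
        by (rule set_eqI, rename_tac e, case_tac "e = d") simp_all
      then have card': "card (args ?u) = Suc i" using d card by simp
      have empty: "copy i (lefts u) = []" using cp[of i] card by simp
      have "i = 0 \<or> i - 1 \<in> fst ` set (lefts u)"
      proof (cases st)
        case True
        then have "completed (copy 0 (lefts u))" using cp[of 0] card by (simp add: i_def)
        then have "copy 0 (lefts u) \<noteq> []" by (auto simp: completed_def)
        then show ?thesis using True unfolding copy_used by (simp add: i_def)
      qed (simp add: i_def)
      moreover have "i < s n" using s_ge[of n] False by (auto simp: i_def)
      moreover have "[Inr Ask] \<in> hash_plays n"
        using hash_snoc_Inr[of "[]" Ask n] is_game_nil[OF is_game_hash] by (simp add: Str_play1)
      ultimately have "(u @ [Inr (side d y)]) @ [Inl (i, Inr Ask)] \<in> coll_plays n"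
        unfolding coll_snoc_Inl[of "u @ [Inr (side d y)]"] using x ev R empty coll_lefts[OF invD(2)[OF I]]
        by (simp add: hash_moves)
      then have legal: "?u \<in> coll_plays n" by (simp add: next_move)
      have settled: "settled n (lefts ?u) e t" if "settled n (lefts u) e t" for t e
        using that by (rule settled_mono) (use empty in \<open>auto simp: next_move completed_def\<close>)
      have copy: "copy j (lefts ?u) = (if j = i then [Inr Ask] else copy j (lefts u))" for j
        using empty by (simp add: next_move)
      have "inv n ?u True True d w' False"
      proof (rule invI)
        show "memory ?u = (True, d, w', False)" by (simp add: next_move[unfolded y(1)] mem y)
        show "part e (rights ?u) = [] \<or> part e (rights ?u) = [Inr Ask, Inl Ask] \<or>
            settled n (lefts ?u) e (part e (rights ?u))" if "\<not> (True \<and> e = d)" for e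
        proof -
          have eq: "part e (rights ?u) = part e (rights u)" using that unfolding part by simp
          show ?thesis unfolding eq using stage[of e] settled[of e "part e (rights u)"] by blast
        qed
        show "run zero (copy j (lefts ?u)) \<and> (False \<longleftrightarrow> w' \<in> queried (copy j (lefts ?u)))"
          if "Suc j = card (args ?u)" for j
          using that unfolding card' copy by (simp add: run_start)
        show "if j < card (args ?u) then completed (copy j (lefts ?u)) else copy j (lefts ?u) = []"
          if "\<not> (True \<and> Suc j = card (args ?u))" for j
          using that cp[of j] unfolding card' copy card by (auto simp: less_Suc_eq split: if_splits)
        show "part d (rights ?u) = [Inr Ask, Inl Ask, Inl (Ans w')] \<and> length w' = n \<and> n \<noteq> 0"
          unfolding part using False y(2) by simp
      qed (use legal ev False args' in simp_all)
      then show ?thesis by blast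
    qed
  next
    assume "settled n (lefts u) d (part d (rights u))"
    with play show ?thesis by (auto simp: settled_def fun_play5)
  qed
qed

lemma inv_step:
  assumes "inv n u R st c w fd" "u @ [x] \<in> coll_plays n"
  shows "\<exists>R' st' c' w' fd'. inv n (u @ [x, next_move (u @ [x])]) R' st' c' w' fd'"
proof (cases x)
  case (Inl y)
  with inv_left[OF assms(1)] assms(2) show ?thesis by (cases y) simp
next
  case (Inr y)
  obtain d a where y: "y = side d a"
    using that[of False] that[of True] by (cases y) (auto simp: side_def)
  with Inr inv_right[OF assms(1)] assms(2) show ?thesis by simp
qed

lemma reach_inv: "u \<in> reach n \<Longrightarrow> \<exists>R st c w fd. inv n u R st c w fd"
proof (induction rule: reach.induct)
  case reach_Nil
  have "[] \<in> coll_plays n"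
    using is_game_nil[OF is_game_lolli[OF is_game_coll_left is_game_pair]] .
  then have "inv n [] False False False [] False"
    by (simp add: inv_def args_def)
  then show ?case by blast
qed (use inv_step in blast)

end

section \<open>The collision finder\<close>

lemma strategy_plays:
  assumes "is_game G" "is_strategy G f" "t \<in> plays_of (f n)"
  shows "t \<in> plays G n"
  using assms(3)
proof (induction rule: plays_of.induct)
  case plays_of_Nil
  show ?case by (rule is_game_nil[OF assms(1)])
next
  case (plays_of_step t x y)
  then have "(t @ [x]) @ [y] \<in> plays G n" using assms(2) unfolding is_strategy_def by blast
  then show ?case by simp
qed

lemma lefts_map_Inr [simp]: "lefts (map Inr u) = []" and rights_map_Inr [simp]: "rights (map Inr u) = u"
  by (induction u) simp_all

lemma copy_map_Pair [simp]: "copy i (map (Pair j) h) = (if i = j then h else [])"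
  by (cases "i = j"; induction h) simp_all

lemma oracle_game_Nil: "[] \<in> plays (oracle_game r) n"
  by (simp add: oracle_game_def alternating_Nil)

lemma alternating_map_Inr: "alternating (A <+> Om) (C <+> Pm) (map Inr u) \<longleftrightarrow> alternating Om Pm u"
  by (simp add: alternating_def Inr_in_Plus_iff if_distrib[of "\<lambda>X. Inr x \<in> X" for x] cong: if_cong)

lemma oracle_lolli_plays:
  assumes "is_game G"
  shows "map Inr u \<in> plays (oracle_game r \<multimap> G) n \<longleftrightarrow> u \<in> plays G n"
proof -
  have "alternating (omoves G) (pmoves G) u" if "u \<in> plays G n"
    using assms that unfolding is_game_def by blast
  then show ?thesis
    unfolding lolli_plays alternating_map_Inr by (auto simp: oracle_game_Nil)
qed

text \<open>An oracle play begins with a question of the finder. As none has been asked, the oracle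
  has nothing to answer.\<close>

lemma oracle_lolli_snoc:
  assumes "map Inr u @ [x] \<in> plays (oracle_game r \<multimap> G) n" "even (length u)"
  shows "\<exists>y. x = Inr y"
proof (cases x)
  case (Inl a)
  have "lefts (map Inr u @ [Inl a]) \<in> plays (oracle_game r) n"
    and "alternating (pmoves (oracle_game r) <+> omoves G) (omoves (oracle_game r) <+> pmoves G) (map Inr u @ [Inl a])"
    using assms(1) unfolding lolli_plays Inl by blast+
  with assms(2) have "a = Ask" "a \<in> range Ans"
    by (auto simp: oracle_game_def alternating_single alternating_snoc)
  then show ?thesis by auto
qed simp

context collider
begin

text \<open>The restriction to legal extensions of reachable positions is forced: a strategy may be
  defined only at positions consistent with its own earlier moves.\<close>

definition coll :: "(bool ground + coll_move) strategy" where
  "coll n t = (if \<exists>u x. t = map Inr (u @ [x]) \<and> u \<in> reach n \<and> u @ [x] \<in> coll_plays n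
     then Some (Inr (next_move (rights t))) else None)"

lemma coll_SomeD:
  assumes "coll n t = Some y"
  obtains u x where "t = map Inr (u @ [x])" "u \<in> reach n" "u @ [x] \<in> coll_plays n" "y = Inr (next_move (u @ [x]))"
proof -
  from assms obtain u x where *: "t = map Inr (u @ [x])" "u \<in> reach n" "u @ [x] \<in> coll_plays n"
    and y: "y = Inr (next_move (rights t))"
    unfolding coll_def by (auto split: if_splits)
  have "rights t = u @ [x]" unfolding *(1) by (rule rights_map_Inr)
  with * y that show thesis by simp
qed

lemma coll_SomeI:
  assumes "u \<in> reach n" "u @ [x] \<in> coll_plays n"
  shows "coll n (map Inr (u @ [x])) = Some (Inr (next_move (u @ [x])))"
  using assms rights_map_Inr[of "u @ [x]"] unfolding coll_def by (simp del: map_append rights_append)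

text \<open>Here the invariant pays off: every reply given by \<open>next_move\<close> is
  legal.\<close>

lemma reach_play: "u \<in> reach n \<Longrightarrow> u \<in> coll_plays n \<and> even (length u)"
  using reach_inv invD(2,3) by blast

lemma plays_of_coll: "plays_of (coll n) = map Inr ` reach n"
proof (intro equalityI subsetI)
  fix t assume "t \<in> plays_of (coll n)"
  then show "t \<in> map Inr ` reach n"
  proof induction
    case plays_of_Nil
    then show ?case using reach_Nil by force
  next
    case (plays_of_step t x y)
    from plays_of_step.hyps(2) obtain u x' where u: "t @ [x] = map Inr (u @ [x'])" "u \<in> reach n"
      "u @ [x'] \<in> coll_plays n" "y = Inr (next_move (u @ [x']))" by (rule coll_SomeD)
    then have "t @ [x, y] = map Inr (u @ [x', next_move (u @ [x'])])" by simp
    with reach_step[OF u(2,3)] show ?case by blast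
  qed
next
  fix t :: "(bool ground + coll_move) list" assume "t \<in> map Inr ` reach n"
  then obtain u where "u \<in> reach n" "t = map Inr u" by blast
  from this(1) have "map Inr u \<in> plays_of (coll n)"
  proof induction
    case (reach_step u x)
    have "map Inr u @ [Inr x, Inr (next_move (u @ [x]))] \<in> plays_of (coll n)"
      by (rule plays_of_step) (use reach_step coll_SomeI[of u n x] in simp_all)
    then show ?case by simp
  qed (simp add: plays_of_Nil)
  with \<open>t = _\<close> show "t \<in> plays_of (coll n)" by simp
qed

lemma is_game_coll: "is_game (bang s (hash_game q p) \<multimap> fun_game \<otimes> fun_game)"
  by (intro is_game_lolli is_game_coll_left is_game_pair)

lemma coll_is_strategy: "is_strategy (oracle_game r \<multimap> bang s (hash_game q p) \<multimap> fun_game \<otimes> fun_game) coll"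
  unfolding is_strategy_def
proof (intro allI conjI impI)
  fix n t y assume "coll n t = Some y"
  then obtain u x where u: "t = map Inr (u @ [x])" "u \<in> reach n" "u @ [x] \<in> coll_plays n"
    "y = Inr (next_move (u @ [x]))" by (rule coll_SomeD)
  show "odd (length t)" using u(1) reach_play[OF u(2)] by simp
  show "t \<in> plays (oracle_game r \<multimap> bang s (hash_game q p) \<multimap> fun_game \<otimes> fun_game) n"
    unfolding u(1) oracle_lolli_plays[OF is_game_coll] by (rule u)
  have "t @ [y] = map Inr (u @ [x, next_move (u @ [x])])" by (simp add: u)
  then show "t @ [y] \<in> plays (oracle_game r \<multimap> bang s (hash_game q p) \<multimap> fun_game \<otimes> fun_game) n"
    using reach_play[OF reach_step[OF u(2,3)]] by (simp only: oracle_lolli_plays[OF is_game_coll])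
  show "butlast t \<in> plays_of (coll n)"
    unfolding plays_of_coll using u by simp
next
  fix n t x
  assume "t \<in> plays_of (coll n)"
    and x: "t @ [x] \<in> plays (oracle_game r \<multimap> bang s (hash_game q p) \<multimap> fun_game \<otimes> fun_game) n"
  then obtain u where u: "u \<in> reach n" "t = map Inr u" unfolding plays_of_coll by blast
  then obtain y where y: "x = Inr y" using oracle_lolli_snoc x reach_play by blast
  then have eq: "t @ [x] = map Inr (u @ [y])" by (simp add: u)
  with x have "u @ [y] \<in> coll_plays n" by (simp only: oracle_lolli_plays[OF is_game_coll])
  with coll_SomeI[OF u(1)] eq show "coll n (t @ [x]) \<noteq> None" by simp
qed

lemma coll_polytime: "polytime coll"
proof -
  obtain M T where M: "valid_tm M" "poly_bounded T" "\<forall>n u x. opponent x \<longrightarrow>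
     (let y = replicate n True @ [False] @ enc (map Inr (u @ [x]) :: (bool ground + coll_move) list)
      in tm_computes_within M y (enc (Inr (next_move (u @ [x])) :: bool ground + coll_move)) (T (length y)))"
    using next_move_polytime by blast
  have "let x = replicate n True @ [False] @ enc t in tm_computes_within M x (enc y) (T (length x))"
    if "coll n t = Some y" for n t y
    using that
  proof (rule coll_SomeD)
    fix u x assume u: "t = map Inr (u @ [x])" "u \<in> reach n" "u @ [x] \<in> coll_plays n" "y = Inr (next_move (u @ [x]))"
    have "opponent x" using opponent_legal[OF u(3)] reach_play[OF u(2)] by blast
    with M(3) show ?thesis unfolding u by blast
  qed
  with M(1,2) show ?thesis unfolding polytime_def by blast
qed

lemma coll_prob_strategy: "prob_strategy r (bang s (hash_game q p) \<multimap> fun_game \<otimes> fun_game) coll"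
  unfolding prob_strategy_def using coll_is_strategy coll_polytime by blast

text \<open>The oracle is never asked, so every \<omega> yields the same plays.\<close>

lemma compose_oracle_coll: "compose (oracle_plays r n \<omega>) (plays_of (coll n)) = reach n"
proof -
  have "[] \<in> oracle_plays r n \<omega>" by (simp add: oracle_plays_def oracle_game_Nil)
  then show ?thesis unfolding compose_def plays_of_coll by force
qed

lemma computes_run:
  assumes "is_strategy (hash_game q p) f" "computes q f F"
  shows "\<exists>h. run \<phi> h \<and> h @ [Inr (Ans (F n \<phi>))] \<in> plays_of (f n)"
proof -
  have "[Ask, Ans (F n \<phi>)] \<in> compose (copies q fun_game n (fun_plays n \<phi>)) (plays_of (f n))"
    using assms(2) unfolding computes_def by blast
  then obtain u where u: "rights u = [Ask, Ans (F n \<phi>)]" "u \<in> plays_of (f n)"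
    "\<And>k. copy k (lefts u) \<in> fun_plays n \<phi>"
    unfolding compose_def copies_def by auto
  from interaction_run[OF strategy_plays[OF is_game_hash assms(1) u(2)] plays_of_even[OF u(2)] u(3,1)] u(2)
  show ?thesis by blast
qed

text \<open>Since \<open>g\<close> vanishes on the queries of \<open>h\<close>, the run
  \<open>h\<close> on the zero function is also a run on \<open>g\<close>, and the output is unique
  by determinism.\<close>

lemma hash_value:
  assumes "is_strategy (hash_game q p) f" "computes q f F"
    and "run zero h" "h @ [Inr (Ans z)] \<in> plays_of (f n)" "\<And>w. w \<in> queried h \<Longrightarrow> \<not> g w"
  shows "F n g = z"
proof -
  obtain h' where h': "run g h'" "h' @ [Inr (Ans (F n g))] \<in> plays_of (f n)"
    using computes_run[OF assms(1,2)] by blast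
  have "run g h" by (rule run_cong[OF assms(3)]) (use assms(5) in blast)
  from run_output_unique[OF h' this assms(4)] show ?thesis by blast
qed

lemma coll_extend:
  assumes "u \<in> reach n" "odd (length (lefts u))" "copy i (lefts u) \<noteq> []"
    and "copy i (lefts u) @ [m] \<in> hash_plays n" "m \<in> pmoves (hash_game q p)"
  shows "u @ [Inl (i, m)] \<in> coll_plays n"
proof -
  have u: "u \<in> coll_plays n" "even (length u)" using reach_play[OF assms(1)] by blast+
  from bang_snoc_used[OF is_game_hash coll_lefts[OF u(1)] assms(3)] u assms coll_lefts[OF u(1)]
  show ?thesis unfolding coll_snoc_Inl by simp
qed

text \<open>Computing a pair requires that an answer is really reached. Any legal run on the zero
  function can be replayed in copy \<open>0\<close> while component \<open>d\<close> waits with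
  argument \<open>w\<close>.\<close>

lemma reach_simulate:
  assumes "run zero h" "h \<in> hash_plays n" "length w = n" "0 < n"
  shows "\<exists>u\<in>reach n. lefts u = map (Pair 0) h \<and>
    rights u = map (side d) [Inr Ask, Inl Ask, Inl (Ans w)] \<and> fst (snd (memory u)) = d"
  using assms(1,2)
proof induction
  case run_start
  have "[] \<in> coll_plays n" using reach_play[OF reach_Nil] by blast
  then have "[] @ [Inr (side d (Inr Ask))] \<in> coll_plays n"
    unfolding coll_snoc_side using coll_rights[of "[]" n] by (auto simp: fun_play1 fun_game_omoves)
  from reach_step[OF reach_Nil this]
  have 1: "[Inr (side d (Inr Ask)), Inr (side d (Inl Ask))] \<in> reach n"
    using next_move_snoc[of "[]" "Inr (side d (Inr Ask))"] by simp
  have "[Inr (side d (Inr Ask)), Inr (side d (Inl Ask))] @ [Inr (side d (Inl (Ans w)))] \<in> coll_plays n"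
    unfolding coll_snoc_side using reach_play[OF 1] assms(3)
      coll_rights[of "[Inr (side d (Inr Ask)), Inr (side d (Inl Ask))]" n]
    by (auto simp: fun_play3 fun_game_omoves)
  from reach_step[OF 1 this]
  have "[Inr (side d (Inr Ask)), Inr (side d (Inl Ask)), Inr (side d (Inl (Ans w))), Inl (0, Inr Ask)] \<in> reach n"
    using assms(3,4) next_move_snoc[of "[Inr (side d (Inr Ask)), Inr (side d (Inl Ask))]" "Inr (side d (Inl (Ans w)))"]
      memory_simps(2)[of "[]" "Inr (side d (Inr Ask))" "Inr (side d (Inl Ask))"] by (auto simp: Let_def)
  moreover have "memory ([Inr (side d (Inr Ask)), Inr (side d (Inl Ask))] @
      [Inr (side d (Inl (Ans w))), Inl (0, Inr Ask)]) = (True, d, w, False)"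
    by (simp add: memory_def)
  ultimately show ?case
    by (intro bexI[of _ "[Inr (side d (Inr Ask)), Inr (side d (Inl Ask)), Inr (side d (Inl (Ans w))), Inl (0, Inr Ask)]"])
      simp_all
next
  case (run_ask h k)
  then obtain u where u: "u \<in> reach n" "lefts u = map (Pair 0) h"
    "rights u = map (side d) [Inr Ask, Inl Ask, Inl (Ans w)]" "fst (snd (memory u)) = d"
    using hash_prefix by blast
  have h: "odd (length h)" "h \<noteq> []" using run_nth[OF run_ask.hyps] by auto
  have "u @ [Inl (0, Inl (k, Inr Ask))] \<in> coll_plays n"
    by (rule coll_extend[OF u(1)])
      (use h u(2) hash_prefix1[OF run_ask.prems] in \<open>simp_all add: hash_moves fun_game_omoves\<close>)
  from reach_step[OF u(1) this]
  have "u @ [Inl (0, Inl (k, Inr Ask)), Inl (0, Inl (k, Inl Ask))] \<in> reach n"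
    by (cases "memory u") (simp add: next_move_snoc)
  then show ?case
    by (rule bexI[rotated]) (use u in \<open>cases "memory u"; simp\<close>)
next
  case (run_arg h k w')
  then obtain u where u: "u \<in> reach n" "lefts u = map (Pair 0) h"
    "rights u = map (side d) [Inr Ask, Inl Ask, Inl (Ans w)]" "fst (snd (memory u)) = d"
    using hash_prefix by blast
  have h: "odd (length h)" "h \<noteq> []" using run_nth[OF run_arg.hyps] by auto
  have "u @ [Inl (0, Inl (k, Inl (Ans w')))] \<in> coll_plays n"
    by (rule coll_extend[OF u(1)])
      (use h u(2) hash_prefix1[OF run_arg.prems] in \<open>simp_all add: hash_moves fun_game_omoves\<close>)
  from reach_step[OF u(1) this]
  have "u @ [Inl (0, Inl (k, Inl (Ans w'))), Inl (0, Inl (k, Inr (Ans False)))] \<in> reach n"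
    by (cases "memory u") (simp add: next_move_snoc)
  then show ?case
    by (rule bexI[rotated]) (use u in \<open>cases "memory u"; simp\<close>)
qed

text \<open>An answer stems from a completed copy. When all copies follow \<open>f\<close>, this
  copy is the run of \<open>f\<close> on the zero function, so its queries are those of
  \<open>h\<close>, whichever copy served and whatever happened in the other component.\<close>

lemma reach_answers:
  assumes f: "is_strategy (hash_game q p) f" and h: "run zero h" "h @ [Inr (Ans z)] \<in> plays_of (f n)"
    and n: "0 < n" and w: "w \<in> bits n"
  shows "\<exists>t\<in>compose (copies s (hash_game q p) n (plays_of (f n))) (reach n).
      answers w (part d t) (answer d w (w \<in> queried h))"
    and "t \<in> compose (copies s (hash_game q p) n (plays_of (f n))) (reach n) \<Longrightarrow> answers w (part d t) b \<Longrightarrow>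
      b = answer d w (w \<in> queried h)"
proof -
  let ?C = "compose (copies s (hash_game q p) n (plays_of (f n))) (reach n)"
  have unique: "b = answer d w (w \<in> queried h)" if "t \<in> ?C" and b: "answers w (part d t) b" for t b
  proof -
    obtain u where u: "t = rights u" "u \<in> reach n" "\<And>i. copy i (lefts u) \<in> plays_of (f n)"
      using \<open>t \<in> ?C\<close> unfolding compose_def copies_def by auto
    obtain R st c w' fd where I: "inv n u R st c w' fd" using reach_inv[OF u(2)] by blast
    have r: "rights (part d (rights u)) = [Ask, Ans b]"
      and l: "lefts (part d (rights u)) = [] \<or> lefts (part d (rights u)) = [Ask, Ans w]"
      using b unfolding answers_def u(1) by blast+
    have "\<not> (R \<and> d = c)"
    proof
      assume "R \<and> d = c"
      with invD(5)[OF I] r show False by simp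
    qed
    from invD(4)[OF I this] r have "settled n (lefts u) d (part d (rights u))" by auto
    then obtain v b' where v: "part d (rights u) = [Inr Ask, Inl Ask, Inl (Ans v), Inr (Ans b')]"
      "\<exists>j h z. copy j (lefts u) = h @ [Inr (Ans z)] \<and> run zero h \<and> b' = answer d v (v \<in> queried h)"
      using n unfolding settled_def by (elim exE conjE) simp
    from v(2) obtain j h' z' where h': "copy j (lefts u) = h' @ [Inr (Ans z')]" "run zero h'"
      "b' = answer d v (v \<in> queried h')" by blast
    have "h' @ [Inr (Ans z')] \<in> plays_of (f n)" using u(3)[of j] h'(1) by simp
    from run_output_unique[OF h'(2) this h] have "h' = h" by blast
    with h'(3) v(1) r l show ?thesis by auto
  qed
  then show "t \<in> ?C \<Longrightarrow> answers w (part d t) b \<Longrightarrow> b = answer d w (w \<in> queried h)" by blast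
  have play: "h @ [Inr (Ans z)] \<in> hash_plays n"
    by (rule strategy_plays[OF is_game_hash f h(2)])
  have lw: "length w = n" using w by (simp add: bits_def)
  obtain u where u: "u \<in> reach n" "lefts u = map (Pair 0) h"
    "rights u = map (side d) [Inr Ask, Inl Ask, Inl (Ans w)]" "fst (snd (memory u)) = d"
    using reach_simulate[OF h(1) hash_prefix[OF play] lw n] by blast
  have "u @ [Inl (0, Inr (Ans z))] \<in> coll_plays n"
    by (rule coll_extend[OF u(1)]) (use run_nth[OF h(1)] u(2) play in \<open>auto simp: hash_moves\<close>)
  from reach_step[OF u(1) this] obtain b where
    b: "u @ [Inl (0, Inr (Ans z)), Inr (side d (Inr (Ans b)))] \<in> reach n"
    using u(4) by (cases "memory u") (auto simp: next_move_snoc)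
  let ?u = "u @ [Inl (0, Inr (Ans z)), Inr (side d (Inr (Ans b)))]"
  have "copy i (lefts ?u) \<in> plays_of (f n)" for i
    using u(2) h(2) by (simp add: plays_of_Nil)
  moreover have "lefts ?u \<in> plays (bang s (hash_game q p)) n"
    using coll_lefts reach_play[OF b] by blast
  ultimately have t: "rights ?u \<in> ?C"
    unfolding compose_def copies_def using b by blast
  have ans: "answers w (part d (rights ?u)) b"
    using u(3) by (simp add: answers_def)
  \<comment> \<open>The bit answered at the end of the simulated run was left open; uniqueness,
    applied to the play just built, identifies it.\<close>
  have "b = answer d w (w \<in> queried h)" by (rule unique[OF t ans])
  with ans have "answers w (part d (rights ?u)) (answer d w (w \<in> queried h))" by (simp only:)
  then show "\<exists>t\<in>?C. answers w (part d t) (answer d w (w \<in> queried h))"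
    using t by (rule bexI)
qed

lemma coll_computes_pair:
  assumes "is_strategy (hash_game q p) f" "run zero h" "h @ [Inr (Ans z)] \<in> plays_of (f n)" "0 < n"
  shows "computes_pair n (compose (copies s (hash_game q p) n (plays_of (f n))) (reach n))
    (\<lambda>w. answer False w (w \<in> queried h)) (\<lambda>w. answer True w (w \<in> queried h))"
proof -
  have part: "part False t = lefts t" "part True t = rights t" for t :: "(fun_move + fun_move) list"
    by (simp_all add: part_def)
  show ?thesis
    unfolding computes_pair_def part[symmetric]
    using reach_answers[OF assms] by blast
qed

text \<open>Every opened copy is a run on the zero function, possibly followed by an output, so no
  query is ever answered by \<open>True\<close>. Conversely, just after the opening any
  \<open>w\<close> can be queried through copy \<open>0\<close> of the argument.\<close>

lemma coll_supplies_zero: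
  assumes n: "0 < n" and v: "opens_copy S (reach n) v i"
  shows "supplies q n S (reach n) v i zero"
proof -
  have vr: "v \<in> reach n" and vi: "copy i (lefts v) = [Inr Ask]" and vj: "\<And>j. j \<noteq> i \<Longrightarrow> copy j (lefts v) \<in> S"
    using v unfolding opens_copy_def by blast+
  have zero: "\<not> b" if u: "u \<in> reach n" and b: "answers w (copy k (lefts (copy i (lefts u)))) b" for u k w b
  proof -
    obtain R st c w' fd where I: "inv n u R st c w' fd" using reach_inv[OF u] by blast
    have play: "copy i (lefts u) \<in> hash_plays n"
      using coll_lefts[OF invD(2)[OF I]] unfolding bang_plays by blast
    have run: "\<exists>h. run zero h \<and> lefts (copy i (lefts u)) = lefts h \<and> h \<in> hash_plays n"
      if ne: "copy i (lefts u) \<noteq> []"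
    proof (cases "R \<and> Suc i = card (args u)")
      case True
      with invD(10)[OF I] n play show ?thesis by blast
    next
      case False
      with invD(12)[OF I _ False] n ne have "completed (copy i (lefts u))" by (simp split: if_splits)
      then obtain h z where "copy i (lefts u) = h @ [Inr (Ans z)]" "run zero h" unfolding completed_def by blast
      with play hash_prefix show ?thesis by fastforce
    qed
    have "copy k (lefts (copy i (lefts u))) = [] \<or> copy k (lefts (copy i (lefts u))) \<in> fun_plays n zero"
    proof (cases "copy i (lefts u) = []")
      case False
      with run run_shape show ?thesis by metis
    qed simp
    then show ?thesis
      using b by (auto simp: answers_def fun_plays_def)
  qed
  have complete: "\<exists>u\<in>reach n. prefix v u \<and> (\<forall>j. j \<noteq> i \<longrightarrow> copy j (lefts u) \<in> S) \<and>
      answers w (copy 0 (lefts (copy i (lefts u)))) False" if q0: "0 < q n" and w: "w \<in> bits n" for w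
  proof -
    obtain R st c w' fd where I: "inv n v R st c w' fd" using reach_inv[OF vr] by blast
    \<comment> \<open>A copy of length one is neither empty nor completed, so it must host a run in
      progress.\<close>
    have "R"
    proof (rule ccontr)
      assume "\<not> R"
      with invD(12)[OF I, of i] n vi have "completed [Inr Ask]" by (auto split: if_splits)
      from completed_even[OF this] show False by simp
    qed
    then have odd: "odd (length (lefts v))" using inv_parity(2)[OF I] by blast
    have start: "[Inr Ask] \<in> hash_plays n"
      using coll_lefts[OF invD(2)[OF I]] vi unfolding bang_plays by metis
    have ask: "[Inr Ask] @ [Inl (0, Inr Ask)] \<in> hash_plays n"
      unfolding hash_snoc_Inl using start q0
      by (simp add: fun_play1 fun_game_omoves) (simp add: lolli_plays)
    have "v @ [Inl (i, Inl (0, Inr Ask))] \<in> coll_plays n"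
      by (rule coll_extend[OF vr odd]) (use vi ask in \<open>simp_all add: hash_moves fun_game_omoves\<close>)
    from reach_step[OF vr this]
    have v1: "v @ [Inl (i, Inl (0, Inr Ask)), Inl (i, Inl (0, Inl Ask))] \<in> reach n" (is "?v1 \<in> _")
      by (cases "memory v") (simp add: next_move_snoc)
    have "[Inr Ask] @ [Inl (0, Inr Ask), Inl (0, Inl Ask)] \<in> hash_plays n"
      using run_reply(1)[OF run_start ask] .
    then have arg: "[Inr Ask, Inl (0, Inr Ask), Inl (0, Inl Ask)] @ [Inl (0, Inl (Ans w))] \<in> hash_plays n"
      unfolding hash_snoc_Inl using q0 w
      by (simp add: fun_play3 fun_game_omoves bits_def) (simp add: lolli_plays)
    have "?v1 @ [Inl (i, Inl (0, Inl (Ans w)))] \<in> coll_plays n"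
      by (rule coll_extend[OF v1]) (use vi odd arg in \<open>simp_all add: hash_moves fun_game_omoves\<close>)
    from reach_step[OF v1 this]
    have "?v1 @ [Inl (i, Inl (0, Inl (Ans w))), Inl (i, Inl (0, Inr (Ans False)))] \<in> reach n"
      unfolding next_move_snoc reply.simps .
    then show ?thesis
      by (rule bexI[rotated]) (use vi vj in \<open>simp add: answers_def prefix_def\<close>)
  qed
  show ?thesis
    unfolding supplies_def Let_def
    using zero complete by blast
qed

end


section \<open>Counting for the Hamming distance\<close>

lemma finite_bits: "finite (bits n)" and card_bits: "card (bits n) = 2 ^ n"
  using finite_lists_length_eq[of "UNIV :: bool set" n] card_lists_length_eq[of "UNIV :: bool set" n]
  by (simp_all add: bits_def)

lemma bits_nonempty: "bits n \<noteq> {}"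
  using card_bits[of n] by force

lemma hamming_eq: "hamming n f g = card {w \<in> bits n. f w \<noteq> g w} / 2 ^ n"
proof -
  have "bits n \<inter> {w. f w \<noteq> g w} = {w \<in> bits n. f w \<noteq> g w}" by blast
  then show ?thesis
    unfolding hamming_def measure_pmf_of_set[OF bits_nonempty finite_bits] card_bits by simp
qed

lemma card_bits_hd: "card {w \<in> bits (Suc n). hd w = b} = 2 ^ n"
proof -
  have "{w \<in> bits (Suc n). hd w = b} = Cons b ` bits n"
    by (auto simp: bits_def length_Suc_conv)
  then show ?thesis by (simp add: card_image card_bits)
qed

text \<open>The strings with first bit \<open>b\<close> are half of all, and removing a fraction of
  \<open>0.4\<close> leaves at least \<open>0.1\<close>. One half suffices for each of the three
  pairs: \<open>g\<close> and \<open>h\<close> differ on the half \<open>b = False\<close> outside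
  \<open>Q\<close>, while the zero function differs from both on the half \<open>b = True\<close>
  outside \<open>Q\<close>.\<close>

lemma hamming_ge:
  assumes "\<And>w. w \<in> bits n \<Longrightarrow> hd w = b \<Longrightarrow> w \<notin> Q \<Longrightarrow> f w \<noteq> g w"
    and "0 < n" "finite Q" "real (card Q) \<le> 0.4 * 2 ^ n"
  shows "hamming n f g \<ge> 0.1"
proof -
  obtain m where m: "n = Suc m" using assms(2) by (cases n) auto
  have "card {w \<in> bits n. hd w = b} - card Q \<le> card ({w \<in> bits n. hd w = b} - Q)"
    by (rule diff_card_le_card_Diff[OF assms(3)])
  also have "\<dots> \<le> card {w \<in> bits n. f w \<noteq> g w}"
    by (rule card_mono) (use assms(1) finite_bits in auto)
  finally have "2 ^ m \<le> real (card {w \<in> bits n. f w \<noteq> g w}) + real (card Q)"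
    unfolding m card_bits_hd by (simp add: of_nat_diff le_diff_conv flip: of_nat_add)
  with assms(4) show ?thesis
    by (simp add: hamming_eq m field_simps)
qed

lemma poly_bounded_less_exp:
  assumes "poly_bounded f" "0 < c"
  shows "\<exists>N. \<forall>n\<ge>N. real (f n) \<le> c * 2 ^ n"
proof -
  obtain a d where f: "\<And>n. f n \<le> a * n ^ d + a" using assms(1) unfolding poly_bounded_def by blast
  have "(\<lambda>n. real a * (real n ^ d / 2 ^ n) + real a * (1 / 2) ^ n) \<longlonglongrightarrow> real a * 0 + real a * 0"
    by (intro tendsto_intros) (real_asymp | simp)+
  then have "eventually (\<lambda>n. real a * (real n ^ d / 2 ^ n) + real a * (1 / 2) ^ n < c) sequentially"
    using assms(2) by (intro order_tendstoD(2)) simp_all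
  then obtain N where N: "\<And>n. n \<ge> N \<Longrightarrow> real a * (real n ^ d / 2 ^ n) + real a * (1 / 2) ^ n < c"
    unfolding eventually_sequentially by blast
  have "real (f n) \<le> c * 2 ^ n" if "n \<ge> N" for n
  proof -
    have "real (f n) \<le> real (a * n ^ d + a)" using f[of n] by (rule of_nat_mono)
    also have "\<dots> = (real a * (real n ^ d / 2 ^ n) + real a * (1 / 2) ^ n) * 2 ^ n"
      by (simp add: field_simps power_divide)
    also have "\<dots> \<le> c * 2 ^ n"
      using N[OF that] by (intro mult_right_mono) simp_all
    finally show ?thesis .
  qed
  then show ?thesis by blast
qed

theorem mainTheorem4:
  fixes Pol :: "(nat \<Rightarrow> nat) set" and q p :: "nat \<Rightarrow> nat" and \<delta> :: real
  assumes "pol_class Pol" and "q \<in> Pol" and "p \<in> Pol" and "\<delta> > 0"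
  shows "\<exists>s\<in>Pol. \<exists>r\<in>Pol. \<exists>coll.
    prob_strategy r (bang s (hash_game q p) \<multimap> fun_game \<otimes> fun_game) coll \<and>
    (\<exists>N. \<forall>f F. is_strategy (hash_game q p) f \<longrightarrow> computes q f F \<longrightarrow>
      (\<forall>n\<ge>N. measure_pmf.prob (pmf_of_set (bits (r n)))
        {\<omega>. let S = plays_of (f n);
              T = compose (oracle_plays r n \<omega>) (plays_of (coll n))
          in \<exists>g h.
            computes_pair n (compose (copies s (hash_game q p) n S) T) g h \<and>
            hamming n g h \<ge> 0.1 \<and>
            F n g = F n h \<and>
            (\<forall>v i. opens_copy S T v i \<longrightarrow>
              (\<exists>\<phi>. supplies q n S T v i \<phi> \<and> hamming n \<phi> g \<ge> 0.1 \<and> hamming n \<phi> h \<ge> 0.1))}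
        \<ge> 1 - \<delta>))"
proof -
  \<comment> \<open>Two copies are needed for positive \<open>n\<close>. As \<open>Pol\<close> need
    not contain constants, the bound is built from the identity by addition.\<close>
  define s :: "nat \<Rightarrow> nat" where "s = (\<lambda>n. n + n)"
  define r :: "nat \<Rightarrow> nat" where "r = (\<lambda>n. n)"
  have r: "r \<in> Pol" and add: "\<And>f g. f \<in> Pol \<Longrightarrow> g \<in> Pol \<Longrightarrow> (\<lambda>n. f n + g n) \<in> Pol"
    and bounded: "\<And>f. f \<in> Pol \<Longrightarrow> poly_bounded f"
    using assms(1) unfolding pol_class_def r_def by simp_all
  have s_Pol: "s \<in> Pol" using add[OF r r] by (simp add: r_def s_def)
  note poly = bounded[OF assms(2)] bounded[OF s_Pol]
  interpret collider q p s
    by standard (use poly in \<open>auto simp: s_def\<close>)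
  obtain N where N: "\<And>n. n \<ge> N \<Longrightarrow> real (q n) \<le> 0.4 * 2 ^ n"
    using poly_bounded_less_exp[OF poly(1), of "0.4"] by auto
  have good: "\<exists>g h. computes_pair n (compose (copies s (hash_game q p) n (plays_of (f n))) (reach n)) g h \<and>
      hamming n g h \<ge> 0.1 \<and> F n g = F n h \<and>
      (\<forall>v i. opens_copy (plays_of (f n)) (reach n) v i \<longrightarrow>
        (\<exists>\<phi>. supplies q n (plays_of (f n)) (reach n) v i \<phi> \<and> hamming n \<phi> g \<ge> 0.1 \<and> hamming n \<phi> h \<ge> 0.1))"
    if f: "is_strategy (hash_game q p) f" "computes q f F" and n: "n \<ge> N + 1" for f F n
  proof -
    \<comment> \<open>The shift from \<open>N\<close> to \<open>N + 1\<close> makes \<open>n\<close>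
      positive, so that every string has a first bit.\<close>
    have n0: "0 < n" "n \<ge> N" using n by simp_all
    obtain h where h: "run zero h" "h @ [Inr (Ans (F n zero))] \<in> plays_of (f n)"
      using computes_run[OF f] by blast
    have "h \<in> plays (hash_game q p) n"
      using strategy_plays[OF is_game_hash f(1) h(2)] by (rule hash_prefix)
    then have Q: "finite (queried h)" "card (queried h) \<le> q n"
      using run_queried_card[OF h(1)] by blast+
    then have small: "real (card (queried h)) \<le> 0.4 * 2 ^ n"
      using N[OF n0(2)] by linarith
    let ?g = "\<lambda>w. answer False w (w \<in> queried h)" and ?h = "\<lambda>w. answer True w (w \<in> queried h)"
    have hash: "F n ?g = F n ?h"
      using hash_value[OF f h, of ?g] hash_value[OF f h, of ?h] by (simp add: answer_def)
    have far: "w \<noteq> []" if "w \<in> bits n" for w using that n0(1) by (auto simp: bits_def)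
    have "hamming n ?g ?h \<ge> 0.1"
      by (rule hamming_ge[where b = False and Q = "queried h"]) (use far n0 Q small in \<open>auto simp: answer_def\<close>)
    moreover have "hamming n zero ?g \<ge> 0.1"
      by (rule hamming_ge[where b = True and Q = "queried h"]) (use far n0 Q small in \<open>auto simp: answer_def\<close>)
    moreover have "hamming n zero ?h \<ge> 0.1"
      by (rule hamming_ge[where b = True and Q = "queried h"]) (use far n0 Q small in \<open>auto simp: answer_def\<close>)
    ultimately show ?thesis
      using coll_computes_pair[OF f(1) h n0(1)] hash coll_supplies_zero[OF n0(1)] by blast
  qed
  have main: "measure_pmf.prob (pmf_of_set (bits (r n)))
        {\<omega>. let S = plays_of (f n);
              T = compose (oracle_plays r n \<omega>) (plays_of (coll n))
          in \<exists>g h.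
            computes_pair n (compose (copies s (hash_game q p) n S) T) g h \<and>
            hamming n g h \<ge> 0.1 \<and>
            F n g = F n h \<and>
            (\<forall>v i. opens_copy S T v i \<longrightarrow>
              (\<exists>\<phi>. supplies q n S T v i \<phi> \<and> hamming n \<phi> g \<ge> 0.1 \<and> hamming n \<phi> h \<ge> 0.1))}
        \<ge> 1 - \<delta>"
    if "is_strategy (hash_game q p) f" "computes q f F" "n \<ge> N + 1" for f F n
    \<comment> \<open>After this rewriting the event no longer mentions \<omega>; it is the whole
      space and has probability \<open>1\<close>.\<close>
    unfolding compose_oracle_coll Let_def using good[OF that] assms(4) by simp
  show ?thesis
    by (rule bexI[OF _ s_Pol], rule bexI[OF _ r], rule exI, rule conjI, rule coll_prob_strategy,
      rule exI[of _ "N + 1"], intro allI impI, rule main)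
qed

end
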